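(* Let $G$, $W$, $\mathbb D$, $d$, $n$, $q=dn$, $V=W\oplus W$, $E_{\mathbb D}$, $r_{\mathbb D}=d+1$, $H$ and $Z$ be as in the context. (Direct part.) Let $x_1,\dots,x_s\in S(V)$, $w_1,\dots,w_s>0$ with $\sum_iw_i=1$, and $Z_i=Z(x_i)$. Assume that the defect equations $$\sum_i w_iZ_i=0,\qquad \sum_i w_i\,Z_i\otimes Z_i=\frac{1}{2(q+1)}I_{E_{\mathbb D}}$$ hold, that at least one orbit $Gx_i$ is a spherical $2$-design, and that equality $\alpha=\frac{r_{\mathbb D}}{q+1}$ holds in the correction bound $\alpha\ge\frac{r_{\mathbb D}}{q+1}$, where $\alpha:=\sum_{i:\,Z_i\ne0}w_i$ is the total weight of the correction orbits (the orbits $Gx_i$ with $Z_i\neq 0$). For each correction orbit write $v_i:=\sqrt2\,Z_i\in S(E_{\mathbb D})$ and $\lambda_i:=w_i/\alpha$. Then (sums over $i$ with $Z_i\ne0$) $$\sum_i\lambda_iv_i=0,\qquad \sum_i\lambda_i\,v_i\otimes v_i=\frac1{r_{\mathbb D}}I_{E_{\mathbb D}}.$$ Thus the normalized defects $v_i$, with weights $\lambda_i$, form a weighted spherical $2$-design on $S(E_{\mathbb D})\simeq\mathbb D\mathbb P^1$. (Converse.) Fix any zero-defect orbit $Gx_0$, i.e. $x_0\in S(V)$ with $Z(x_0)=0$ (so necessarily $n\ge2$), and any weighted spherical $2$-design $\{(v_i,\lambda_i)\}_i$ on $\mathbb D\mathbb P^1\simeq S(E_{\mathbb D})$. Choose rank-one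 correction representatives, i.e. points $x_i\in S(V)$ with $H(x_i)$ of rank one, such that $Z(x_i)=v_i/\sqrt2$; give the orbits $Gx_i$ the weights $$w_i=\alpha\lambda_i,\qquad \alpha=\frac{r_{\mathbb D}}{q+1},$$ and place the remaining mass $1-\alpha$ on the zero-defect orbit $Gx_0$. Then the defect equations hold, with equality in the correction bound (the total weight of the orbits with nonzero defect is exactly $\frac{r_{\mathbb D}}{q+1}$). Hence, after antipodalization if necessary, one obtains a correction-weight optimal weighted spherical $4$-design on $S(V)$.
   Context: Let $G$ be a finite group and $W$ a nontrivial irreducible (finite-dimensional) real orthogonal $G$-module. Put $\mathbb D=\operatorname{End}_G(W)\in\{\mathbb R,\mathbb C,\mathbb H\}$ and regard $W$ as a right $\mathbb D$-module (in quaternionic type via $\operatorname{End}_G(W)^{\mathrm{op}}\simeq\mathbb H$). Put $d=\dim_{\mathbb R}\mathbb D\in\{1,2,4\}$, $n=\dim_{\mathbb D}W$, $q=\dim_{\mathbb R}W=dn$. Fix a $G$-invariant $\mathbb D$-Hermitian form $\langle\cdot,\cdot\rangle$ on $W$ (with $\langle xa,yb\rangle=\bar a\langle x,y\rangle b$) whose real part is the given real inner product. Let $V=W\oplus W$ with the diagonal $G$-action and the orthogonal direct sum inner product, and $S(V)$ its unit sphere. For $x=(x_1,x_2)\in V$, the Hermitian Gram matrix is $H(x)=(\langle x_i,x_j\rangle)_{i,j}\in\operatorname{Herm}_2(\mathbb D)$. Let $E_{\mathbb D}$ be the real space of traceless matrices in $\operatorname{Herm}_2(\mathbb D)$ with inner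 product $\langle B,C\rangle_E=\operatorname{Re}\operatorname{tr}(BC)$, of real dimension $r_{\mathbb D}=d+1$, and $S(E_{\mathbb D})$ its unit sphere. For $x\in S(V)$ the quadratic defect is $Z(x)=H(x)-\frac12I_2\in E_{\mathbb D}$; it is constant on $G$-orbits, and $Gx$ is a spherical $2$-design if and only if $Z(x)=0$. An identity $\sum_i w_iZ_i\otimes Z_i=c\,I_{E_{\mathbb D}}$ means $\sum_i w_i\langle B,Z_i\rangle_E\langle C,Z_i\rangle_E=c\langle B,C\rangle_E$ for all $B,C\in E_{\mathbb D}$. The projective line $\mathbb D\mathbb P^1$ is identified with $S(E_{\mathbb D})$ by $[u]\mapsto\sqrt2\,(uu^*-\frac12I_2)$, $u\in\mathbb D^2$, $\|u\|=1$. Correction bound: whenever the defect equations hold and at least one constituent orbit is a spherical $2$-design, the total weight $\alpha$ of the orbits with nonzero defect satisfies $\alpha\ge\frac{r_{\mathbb D}}{q+1}$. A completion is called correction-weight optimal if equality holds in this bound. For a finite nonempty subset $X$ of a unit sphere, $\mu_X=\frac1{|X|}\sum_{x\in X}\delta_x$. A weighted collection of orbits $Gx_i$ with weights $w_i$ corresponds to the measure $\mu=\sum_iw_i\mu_{Gx_i}$. A weighted spherical $t$-design on the unit sphere of a Euclidean space is a finitely supported probability measure on it which integrates every real polynomial of degree at most $t$ to its average under normalized spherical measure; a spherical $t$-design is a finite set $X$ for which $\mu_X$ has this property. The antipodalization of $\mu$ is $\mu^{\pm}=\frac12(\mu+(-I)_*\mu)$.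
   Formalization: The final claim that one obtains a weighted spherical 4-design is proved only when every G-invariant quartic form on V is a quadratic form in the entries of H(x); without this it fails, e.g. for the dihedral group of order 8 on R^2. *)

theory Defs
  imports "HOL-Probability.Probability" "HOL-Algebra.Group_Action"
begin

section \<open>The division algebra\<close>

text \<open>
  A type of sort \<open>{real_normed_div_algebra, euclidean_space}\<close> is a finite-dimensional associative
  real division algebra with a multiplicative norm that comes from an inner product. By the
  theorem of Frobenius these are exactly the reals, the complex numbers and the quaternions with
  their standard norm (the library has the first two as instances, the quaternions are made an
  instance below). The real part of \<open>z\<close> is \<open>1 \<bullet> z\<close>, which determines the conjugation.
\<close>

definition real_part :: "'d::{real_normed_div_algebra,euclidean_space} \<Rightarrow> real"
  where "real_part z = 1 \<bullet> z"

definition hconj :: "'d::{real_normed_div_algebra,euclidean_space} \<Rightarrow> 'd"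
  where "hconj z = (2 * real_part z) *\<^sub>R 1 - z"

lemma inner_mult_left_same:
  fixes x y z :: "'d::{real_normed_div_algebra,euclidean_space}"
  shows "(x * y) \<bullet> (x * z) = (x \<bullet> x) * (y \<bullet> z)"
proof -
  have sq: "(x * u) \<bullet> (x * u) = (x \<bullet> x) * (u \<bullet> u)" for u
    by (simp add: dot_square_norm norm_mult power_mult_distrib)
  show ?thesis
    using sq[of "y + z"] sq[of y] sq[of z]
    by (simp add: algebra_simps inner_add_left inner_add_right inner_commute)
qed

lemma inner_mult_polarized:
  fixes x y z w :: "'d::{real_normed_div_algebra,euclidean_space}"
  shows "(x * y) \<bullet> (w * z) + (w * y) \<bullet> (x * z) = 2 * (x \<bullet> w) * (y \<bullet> z)"
  using inner_mult_left_same[of "x + w" y z] inner_mult_left_same[of x y z]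
    inner_mult_left_same[of w y z]
  by (simp add: algebra_simps inner_add_left inner_add_right inner_commute)

lemma real_part_add: "real_part (a + b) = real_part a + real_part b"
  by (simp add: real_part_def inner_add_right)

lemma real_part_diff: "real_part (a - b) = real_part a - real_part b"
  by (simp add: real_part_def inner_diff_right)

lemma real_part_scaleR: "real_part (r *\<^sub>R a) = r * real_part a"
  by (simp add: real_part_def)

lemma real_part_1: "real_part 1 = 1"
  by (simp add: real_part_def dot_square_norm)

lemma real_part_mult:
  fixes a b :: "'d::{real_normed_div_algebra,euclidean_space}"
  shows "real_part (a * b) = 2 * real_part a * real_part b - a \<bullet> b"
  using inner_mult_polarized[of 1 1 a b] by (simp add: real_part_def inner_commute[of a 1])

lemma real_part_mult_hconj:
  fixes a b :: "'d::{real_normed_div_algebra,euclidean_space}"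
  shows "real_part (a * hconj b) = a \<bullet> b"
proof -
  have "a * hconj b = (2 * real_part b) *\<^sub>R a - a * b"
    by (simp add: hconj_def right_diff_distrib)
  then show ?thesis
    by (simp add: real_part_diff real_part_scaleR real_part_mult)
qed

lemma real_part_hconj: "real_part (hconj a) = real_part a"
  by (simp add: hconj_def real_part_diff real_part_scaleR real_part_1)

lemma hconj_0 [simp]: "hconj 0 = 0"
  by (simp add: hconj_def real_part_def)

lemma hconj_add: "hconj (a + b) = hconj a + hconj b"
  by (simp add: hconj_def real_part_add distrib_left scaleR_left_distrib)

lemma hconj_scaleR: "hconj (r *\<^sub>R a) = r *\<^sub>R hconj a"
  by (simp add: hconj_def real_part_scaleR scaleR_right_diff_distrib mult.left_commute)

lemma hconj_minus: "hconj (- a) = - hconj a"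
  using hconj_scaleR[of "-1" a] by simp

lemma hconj_hconj [simp]: "hconj (hconj a) = a"
  unfolding hconj_def[of "hconj a"] real_part_hconj by (simp add: hconj_def)

lemma hconj_1 [simp]: "hconj 1 = 1"
  by (simp add: hconj_def real_part_1 scaleR_2)

lemma hconj_eq_self:
  assumes "hconj a = a"
  shows "a = real_part a *\<^sub>R 1"
proof -
  have "(2 * real_part a) *\<^sub>R 1 = a + a"
    using assms unfolding hconj_def by (metis diff_add_cancel)
  then have "2 *\<^sub>R (real_part a *\<^sub>R 1) = 2 *\<^sub>R a"
    by (simp add: scaleR_2[of a])
  then show ?thesis by (metis scaleR_cancel_left zero_neq_numeral)
qed

lemma inner_hconj_hconj: "hconj a \<bullet> hconj b = a \<bullet> b"
proof -
  have "hconj a \<bullet> hconj b = real_part (hconj a * b)"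
    by (metis hconj_hconj real_part_mult_hconj)
  also have "\<dots> = 2 * real_part a * real_part b - hconj a \<bullet> b"
    by (simp add: real_part_mult real_part_hconj)
  also have "hconj a \<bullet> b = 2 * real_part a * real_part b - a \<bullet> b"
    by (simp add: hconj_def inner_diff_left real_part_def)
  finally show ?thesis by simp
qed


section \<open>The quaternions\<close>

text \<open>Pairs of complex numbers with the Cayley-Dickson product.\<close>

typedef quat = "UNIV :: (complex \<times> complex) set" ..

setup_lifting type_definition_quat

instantiation quat :: euclidean_space
begin

lift_definition zero_quat :: quat is 0 .
lift_definition plus_quat :: "quat \<Rightarrow> quat \<Rightarrow> quat" is "(+)" .
lift_definition minus_quat :: "quat \<Rightarrow> quat \<Rightarrow> quat" is "(-)" .
lift_definition uminus_quat :: "quat \<Rightarrow> quat" is uminus .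
lift_definition scaleR_quat :: "real \<Rightarrow> quat \<Rightarrow> quat" is scaleR .
lift_definition inner_quat :: "quat \<Rightarrow> quat \<Rightarrow> real" is inner .
lift_definition norm_quat :: "quat \<Rightarrow> real" is norm .
lift_definition Basis_quat :: "quat set" is Basis .
definition sgn_quat :: "quat \<Rightarrow> quat"
  where "sgn_quat a = inverse (norm a) *\<^sub>R a"
definition dist_quat :: "quat \<Rightarrow> quat \<Rightarrow> real"
  where "dist_quat a b = norm (a - b)"
definition uniformity_quat :: "(quat \<times> quat) filter"
  where "uniformity_quat = (INF e\<in>{0<..}. principal {(x, y). dist x y < e})"
definition open_quat :: "quat set \<Rightarrow> bool"
  where "open_quat U \<longleftrightarrow> (\<forall>x\<in>U. \<forall>\<^sub>F (x', y) in uniformity. x' = x \<longrightarrow> y \<in> U)"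

instance
proof
  fix a b c :: quat and r s :: real
  show "a + b + c = a + (b + c)" "a + b = b + a" "0 + a = a" "- a + a = 0" "a - b = a + - b"
    by (transfer, simp)+
  show "r *\<^sub>R (a + b) = r *\<^sub>R a + r *\<^sub>R b" "(r + s) *\<^sub>R a = r *\<^sub>R a + s *\<^sub>R a"
    "r *\<^sub>R s *\<^sub>R a = (r * s) *\<^sub>R a" "1 *\<^sub>R a = a"
    by (transfer, simp add: scaleR_add_left scaleR_add_right)+
  show "dist a b = norm (a - b)" by (rule dist_quat_def)
  show "sgn a = inverse (norm a) *\<^sub>R a" by (rule sgn_quat_def)
  show "(uniformity :: (quat \<times> quat) filter) = (INF e\<in>{0<..}. principal {(x, y). dist x y < e})"
    by (rule uniformity_quat_def)
  show "open U \<longleftrightarrow> (\<forall>x\<in>U. \<forall>\<^sub>F (x', y) in uniformity. x' = x \<longrightarrow> y \<in> U)" for U :: "quat set"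
    by (rule open_quat_def)
  show "a \<bullet> b = b \<bullet> a" by transfer (rule inner_commute)
  show "(a + b) \<bullet> c = a \<bullet> c + b \<bullet> c" by transfer (rule inner_add_left)
  show "(r *\<^sub>R a) \<bullet> b = r * (a \<bullet> b)" by transfer (rule inner_scaleR_left)
  show "0 \<le> a \<bullet> a" by transfer (rule inner_ge_zero)
  show "a \<bullet> a = 0 \<longleftrightarrow> a = 0" by transfer (rule inner_eq_zero_iff)
  show "norm a = sqrt (a \<bullet> a)" by transfer (rule norm_eq_sqrt_inner)
  show "(Basis :: quat set) \<noteq> {}" "finite (Basis :: quat set)" by (transfer, simp)+
  show "u \<bullet> v = (if u = v then 1 else 0)" if "u \<in> Basis" "v \<in> Basis" for u v :: quat
    using that by transfer (rule inner_Basis)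
  show "(\<forall>v\<in>Basis. a \<bullet> v = 0) \<longleftrightarrow> a = 0" by transfer (rule euclidean_all_zero_iff)
qed

end

instantiation quat :: real_normed_div_algebra
begin

lift_definition one_quat :: quat is "(1, 0)" .
lift_definition times_quat :: "quat \<Rightarrow> quat \<Rightarrow> quat"
  is "\<lambda>(a, b) (c, d). (a * c - cnj d * b, d * a + b * cnj c)" .
lift_definition quat_cnj :: "quat \<Rightarrow> quat" is "\<lambda>(a, b). (cnj a, - b)" .
definition inverse_quat :: "quat \<Rightarrow> quat"
  where "inverse_quat a = quat_cnj a /\<^sub>R (a \<bullet> a)"
definition divide_quat :: "quat \<Rightarrow> quat \<Rightarrow> quat"
  where "divide_quat a b = a * inverse b"

lemma quat_mult_cnj: "a * quat_cnj a = (a \<bullet> a) *\<^sub>R 1" "quat_cnj a * a = (a \<bullet> a) *\<^sub>R 1"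
  by (transfer, clarsimp simp: inner_complex_def complex_eq_iff mult.commute)+

lemma quat_scaleR_mult: "(r *\<^sub>R a) * b = r *\<^sub>R (a * b)" "a * (r *\<^sub>R b) = r *\<^sub>R (a * b)" for a b :: quat
  by (transfer, clarsimp simp: scaleR_right_diff_distrib scaleR_right_distrib)+

instance
proof
  fix a b c :: quat and r s :: real
  show "a * b * c = a * (b * c)" "(a + b) * c = a * c + b * c" "a * (b + c) = a * b + a * c"
    "1 * a = a" "a * 1 = a" "(0::quat) \<noteq> 1"
    by (transfer, auto simp: zero_prod_def algebra_simps)+
  show "(r *\<^sub>R a) * b = r *\<^sub>R (a * b)" "a * (r *\<^sub>R b) = r *\<^sub>R (a * b)"
    by (rule quat_scaleR_mult)+
  show "inverse a * a = 1" "a * inverse a = 1" if "a \<noteq> 0"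
    using that by (simp_all add: inverse_quat_def quat_scaleR_mult quat_mult_cnj)
  show "a div b = a * inverse b" by (rule divide_quat_def)
  show "inverse (0::quat) = 0" by (simp add: inverse_quat_def)
  have "(a * b) \<bullet> (a * b) = (a \<bullet> a) * (b \<bullet> b)"
    by transfer (auto simp: inner_prod_def inner_complex_def algebra_simps)
  then show "norm (a * b) = norm a * norm b"
    by (simp add: norm_eq_sqrt_inner real_sqrt_mult)
qed

end

lemma DIM_quat: "DIM(quat) = 4"
proof -
  have "card (Rep_quat ` Basis) = DIM(quat)"
    by (rule card_image) (simp add: inj_on_def Rep_quat_inject)
  moreover have "card (Rep_quat ` Basis) = DIM(complex \<times> complex)"
    by (simp only: Basis_quat.rep_eq)
  ultimately show ?thesis by simp
qed


section \<open>Traceless Hermitian matrices\<close>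

definition hermitian :: "'d::{real_normed_div_algebra,euclidean_space}^'n^'n \<Rightarrow> bool"
  where "hermitian A \<longleftrightarrow> (\<forall>i j. hconj (A $ i $ j) = A $ j $ i)"

lemma hermitian_0: "hermitian 0"
  by (simp add: hermitian_def)

lemma hermitian_add: "hermitian A \<Longrightarrow> hermitian B \<Longrightarrow> hermitian (A + B)"
  by (simp add: hermitian_def hconj_add)

lemma hermitian_minus: "hermitian A \<Longrightarrow> hermitian (- A)"
  by (simp add: hermitian_def hconj_minus)

lemma hermitian_scaleR: "hermitian A \<Longrightarrow> hermitian (r *\<^sub>R A)"
  by (simp add: hermitian_def hconj_scaleR)

typedef (overloaded) ('d::"{real_normed_div_algebra,euclidean_space}") herm0 =
    "{A :: 'd^2^2. hermitian A \<and> trace A = 0}"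
  by (rule exI[of _ 0]) (simp add: hermitian_0 trace_def)

setup_lifting type_definition_herm0

lemma real_part_trace_mult:
  fixes A B :: "'d::{real_normed_div_algebra,euclidean_space}^2^2"
  assumes "hermitian B"
  shows "real_part (trace (A ** B)) = A \<bullet> B"
proof -
  have eq: "real_part (A $ i $ j * B $ j $ i) = A $ i $ j \<bullet> B $ i $ j" for i j
    using assms real_part_mult_hconj[of "A $ i $ j" "B $ i $ j"] by (simp add: hermitian_def)
  show ?thesis
    by (simp add: trace_def matrix_matrix_mult_def inner_vec_def sum_2 real_part_add eq)
qed

instantiation herm0 :: ("{real_normed_div_algebra,euclidean_space}") real_inner
begin

lift_definition zero_herm0 :: "'a herm0" is 0
  by (simp add: hermitian_0 trace_def)
lift_definition plus_herm0 :: "'a herm0 \<Rightarrow> 'a herm0 \<Rightarrow> 'a herm0" is "(+)"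
  by (simp add: hermitian_add trace_def sum.distrib)
lift_definition uminus_herm0 :: "'a herm0 \<Rightarrow> 'a herm0" is uminus
  by (simp add: hermitian_minus trace_def sum_negf)
definition minus_herm0 :: "'a herm0 \<Rightarrow> 'a herm0 \<Rightarrow> 'a herm0"
  where "minus_herm0 A B = A + - B"
lift_definition scaleR_herm0 :: "real \<Rightarrow> 'a herm0 \<Rightarrow> 'a herm0" is "scaleR"
  by (simp add: hermitian_scaleR trace_def scaleR_right.sum[symmetric])
definition inner_herm0 :: "'a herm0 \<Rightarrow> 'a herm0 \<Rightarrow> real"
  where "inner_herm0 A B = real_part (trace (Rep_herm0 A ** Rep_herm0 B))"
definition norm_herm0 :: "'a herm0 \<Rightarrow> real"
  where "norm_herm0 A = sqrt (A \<bullet> A)"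
definition sgn_herm0 :: "'a herm0 \<Rightarrow> 'a herm0"
  where "sgn_herm0 A = inverse (norm A) *\<^sub>R A"
definition dist_herm0 :: "'a herm0 \<Rightarrow> 'a herm0 \<Rightarrow> real"
  where "dist_herm0 A B = norm (A - B)"
definition uniformity_herm0 :: "('a herm0 \<times> 'a herm0) filter"
  where "uniformity_herm0 = (INF e\<in>{0<..}. principal {(x, y). dist x y < e})"
definition open_herm0 :: "'a herm0 set \<Rightarrow> bool"
  where "open_herm0 U \<longleftrightarrow> (\<forall>x\<in>U. \<forall>\<^sub>F (x', y) in uniformity. x' = x \<longrightarrow> y \<in> U)"

lemma inner_herm0_Rep: "A \<bullet> B = Rep_herm0 A \<bullet> Rep_herm0 B" for A B :: "'a herm0"
  using Rep_herm0[of B] by (simp add: inner_herm0_def real_part_trace_mult)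

instance
proof
  fix A B C :: "'a herm0" and r s :: real
  show "A + B + C = A + (B + C)" by transfer (simp add: algebra_simps)
  show "A + B = B + A" by transfer (simp add: algebra_simps)
  show "0 + A = A" by transfer simp
  show "- A + A = 0" by transfer simp
  show "A - B = A + - B" by (simp add: minus_herm0_def)
  show "r *\<^sub>R (A + B) = r *\<^sub>R A + r *\<^sub>R B" by transfer (simp add: scaleR_right_distrib)
  show "(r + s) *\<^sub>R A = r *\<^sub>R A + s *\<^sub>R A" by transfer (simp add: scaleR_left_distrib)
  show "r *\<^sub>R s *\<^sub>R A = (r * s) *\<^sub>R A" by transfer simp
  show "1 *\<^sub>R A = A" by transfer simp
  show "dist A B = norm (A - B)" by (rule dist_herm0_def)
  show "sgn A = inverse (norm A) *\<^sub>R A" by (rule sgn_herm0_def)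
  show "(uniformity :: ('a herm0 \<times> 'a herm0) filter)
      = (INF e\<in>{0<..}. principal {(x, y). dist x y < e})"
    by (rule uniformity_herm0_def)
  show "open U \<longleftrightarrow> (\<forall>x\<in>U. \<forall>\<^sub>F (x', y) in uniformity. x' = x \<longrightarrow> y \<in> U)" for U :: "'a herm0 set"
    by (rule open_herm0_def)
  show "A \<bullet> B = B \<bullet> A" by (simp add: inner_herm0_Rep inner_commute)
  show "(A + B) \<bullet> C = A \<bullet> C + B \<bullet> C"
    by (simp add: inner_herm0_Rep plus_herm0.rep_eq inner_add_left)
  show "(r *\<^sub>R A) \<bullet> B = r * (A \<bullet> B)"
    by (simp add: inner_herm0_Rep scaleR_herm0.rep_eq)
  show "0 \<le> A \<bullet> A" by (simp add: inner_herm0_Rep)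
  show "A \<bullet> A = 0 \<longleftrightarrow> A = 0"
    by (simp add: inner_herm0_Rep) (metis Rep_herm0_inject zero_herm0.rep_eq)
  show "norm A = sqrt (A \<bullet> A)" by (rule norm_herm0_def)
qed

end

text \<open>
  The orthonormal basis consists of the matrices with rows \<open>(1, 0)\<close>, \<open>(0, -1)\<close> and
  \<open>(0, b)\<close>, \<open>(hconj b, 0)\<close>, each divided by \<open>sqrt 2\<close>.
\<close>

lift_definition mk_herm0 :: "real \<Rightarrow> 'd \<Rightarrow> 'd::{real_normed_div_algebra,euclidean_space} herm0"
  is "\<lambda>t b. \<chi> i j. if i = j then (if i = 1 then of_real t else - of_real t)
                   else if i = 1 then b else hconj b"
  by (auto simp: hermitian_def forall_2 trace_def sum_2 of_real_def hconj_scaleR hconj_minus)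

lemma inner_mk_herm0: "mk_herm0 s a \<bullet> mk_herm0 t b = 2 * (s * t + a \<bullet> b)"
  by (simp add: inner_herm0_Rep mk_herm0.rep_eq inner_vec_def sum_2 inner_hconj_hconj of_real_def
      dot_square_norm)

lemma mk_herm0_surj: "\<exists>t b. A = mk_herm0 t b"
proof -
  define M where "M = Rep_herm0 A"
  have M: "hermitian M" "trace M = 0"
    using Rep_herm0[of A] by (simp_all add: M_def)
  have h: "hconj (M $ i $ j) = M $ j $ i" for i j
    using M(1) by (simp add: hermitian_def)
  have "M $ 1 $ 1 = real_part (M $ 1 $ 1) *\<^sub>R 1"
    by (rule hconj_eq_self) (rule h)
  moreover have "M $ 2 $ 2 = - (M $ 1 $ 1)"
    using M(2) by (simp add: trace_def sum_2 add_eq_0_iff)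
  ultimately have "M = Rep_herm0 (mk_herm0 (real_part (M $ 1 $ 1)) (M $ 1 $ 2))"
    using h[of 1 2]
    by (simp add: mk_herm0.rep_eq vec_eq_iff forall_2 of_real_def)
  then show ?thesis
    unfolding M_def by (metis Rep_herm0_inject)
qed

instantiation herm0 :: ("{real_normed_div_algebra,euclidean_space}") euclidean_space
begin

definition Basis_herm0 :: "'a herm0 set"
  where "Basis_herm0 = insert (mk_herm0 (1 / sqrt 2) 0) ((\<lambda>b. mk_herm0 0 (b /\<^sub>R sqrt 2)) ` Basis)"

instance
proof
  define e :: "'a herm0" where "e = mk_herm0 (1 / sqrt 2) 0"
  define f :: "'a \<Rightarrow> 'a herm0" where "f = (\<lambda>b. mk_herm0 0 (b /\<^sub>R sqrt 2))"
  have B: "(Basis :: 'a herm0 set) = insert e (f ` Basis)"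
    by (simp add: Basis_herm0_def e_def f_def)
  have inv: "2 * (inverse (sqrt 2) * (inverse (sqrt 2) * x)) = x" for x :: real
    by (simp add: field_simps)
  have ee: "e \<bullet> e = 1" by (simp add: e_def inner_mk_herm0)
  have ef: "e \<bullet> f b = 0" "f b \<bullet> e = 0" for b by (simp_all add: e_def f_def inner_mk_herm0)
  have ff: "f b \<bullet> f c = b \<bullet> c" for b c
    unfolding f_def inner_mk_herm0 inner_scaleR_left inner_scaleR_right by (simp only: inv mult_zero_left add_0)
  show "(Basis :: 'a herm0 set) \<noteq> {}" "finite (Basis :: 'a herm0 set)"
    by (simp_all add: B)
  fix u v :: "'a herm0"
  have e_f: "e \<noteq> f b" for b using ee ef(1)[of b] by auto
  have f_f: "f b = f c \<longleftrightarrow> b = c" if "b \<in> Basis" "c \<in> Basis" for b c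
  proof
    assume "f b = f c"
    then have "b \<bullet> c = b \<bullet> b" by (metis ff)
    then show "b = c" using that by (metis inner_Basis zero_neq_one)
  qed simp
  show "u \<bullet> v = (if u = v then 1 else 0)" if uv: "u \<in> Basis" "v \<in> Basis"
  proof (cases "u = e \<or> v = e")
    case True
    then show ?thesis using uv e_f ee ef unfolding B by (metis image_iff insertE)
  next
    case False
    then obtain b c where "u = f b" "v = f c" "b \<in> Basis" "c \<in> Basis"
      using uv unfolding B by auto
    then show ?thesis using f_f ff inner_Basis by metis
  qed
  show "(\<forall>v\<in>Basis. u \<bullet> v = 0) \<longleftrightarrow> u = 0"
  proof
    assume z: "\<forall>v\<in>Basis. u \<bullet> v = 0"
    obtain t b where u: "u = mk_herm0 t b" using mk_herm0_surj by blast
    have "u \<bullet> e = 0" using z B by blast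
    then have "t = 0" by (simp add: u e_def inner_mk_herm0)
    moreover have "b \<bullet> c = 0" if "c \<in> Basis" for c
    proof -
      have "u \<bullet> f c = 0" using z B that by blast
      then show ?thesis by (simp add: u f_def inner_mk_herm0)
    qed
    then have "b = 0" by - (rule euclidean_eqI, simp)
    ultimately have "u \<bullet> u = 0" by (simp add: u inner_mk_herm0)
    then show "u = 0" by simp
  qed simp
qed

end

lemma DIM_herm0:
  "DIM('d::{real_normed_div_algebra,euclidean_space} herm0) = DIM('d) + 1"
proof -
  let ?e = "mk_herm0 (1 / sqrt 2) 0 :: 'd herm0" and ?f = "\<lambda>b::'d. mk_herm0 0 (b /\<^sub>R sqrt 2)"
  have ff: "?f b \<bullet> ?f c = b \<bullet> c" for b c
    by (simp add: inner_mk_herm0 field_simps)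
  have "inj ?f"
  proof (rule injI)
    fix b c assume "?f b = ?f c"
    then have "b \<bullet> x = c \<bullet> x" for x using ff by metis
    then show "b = c" by (metis vector_eq_rdot)
  qed
  moreover have "?e \<notin> ?f ` Basis"
  proof
    assume "?e \<in> ?f ` Basis"
    then obtain b where eq: "?e = ?f b" by blast
    have "?e \<bullet> ?f b = 0" "?e \<bullet> ?e = 1" by (simp_all add: inner_mk_herm0)
    then show False unfolding eq[symmetric] by simp
  qed
  ultimately show ?thesis
    by (simp add: Basis_herm0_def card_image inj_on_subset)
qed


section \<open>Weighted spherical designs\<close>

definition hom_poly :: "nat \<Rightarrow> ('a::euclidean_space \<Rightarrow> real) \<Rightarrow> bool"
  where "hom_poly k p \<longleftrightarrow>
    (\<exists>c. p = (\<lambda>x. \<Sum>m | m \<in> Basis \<rightarrow>\<^sub>E {..k} \<and> sum m Basis = k. c m * (\<Prod>b\<in>Basis. (x \<bullet> b) ^ m b)))"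

definition poly_deg_le :: "nat \<Rightarrow> ('a::euclidean_space \<Rightarrow> real) \<Rightarrow> bool"
  where "poly_deg_le t p \<longleftrightarrow> (\<exists>P. (\<forall>k\<le>t. hom_poly k (P k)) \<and> p = (\<lambda>x. \<Sum>k\<le>t. P k x))"

text \<open>
  The normalized rotation-invariant measure on the unit sphere, as the radial projection of the
  uniform distribution on the unit ball (cone measure).
\<close>

definition sphere_measure :: "'a::euclidean_space measure"
  where "sphere_measure = distr (uniform_measure lborel (ball 0 1)) borel (\<lambda>x. x /\<^sub>R norm x)"

definition weighted_design :: "nat \<Rightarrow> 'a::euclidean_space pmf \<Rightarrow> bool"
  where "weighted_design t \<mu> \<longleftrightarrow>
    finite (set_pmf \<mu>) \<and> set_pmf \<mu> \<subseteq> sphere 0 1 \<and>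
    (\<forall>p. poly_deg_le t p \<longrightarrow> measure_pmf.expectation \<mu> p = integral\<^sup>L sphere_measure p)"

definition spherical_design :: "nat \<Rightarrow> 'a::euclidean_space set \<Rightarrow> bool"
  where "spherical_design t X \<longleftrightarrow> finite X \<and> X \<noteq> {} \<and> weighted_design t (pmf_of_set X)"

text \<open>The convex combination of the \<open>M i\<close>; meaningful for nonnegative weights of total mass 1.\<close>

definition convex_comb :: "'i set \<Rightarrow> ('i \<Rightarrow> real) \<Rightarrow> ('i \<Rightarrow> 'a pmf) \<Rightarrow> 'a pmf"
  where "convex_comb I w M = embed_pmf (\<lambda>x. \<Sum>i\<in>I. w i * pmf (M i) x)"

definition weighted_points :: "'i set \<Rightarrow> ('i \<Rightarrow> real) \<Rightarrow> ('i \<Rightarrow> 'a) \<Rightarrow> 'a pmf"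
  where "weighted_points I w x = convex_comb I w (\<lambda>i. return_pmf (x i))"

definition antipodalization :: "'a::real_vector pmf \<Rightarrow> 'a pmf"
  where "antipodalization \<mu> = embed_pmf (\<lambda>x. (pmf \<mu> x + pmf (map_pmf uminus \<mu>) x) / 2)"


section \<open>Irreducible orthogonal modules and their endomorphism algebra\<close>

definition orthogonal_module ::
    "('g, 'r) monoid_scheme \<Rightarrow> ('g \<Rightarrow> 'w::euclidean_space \<Rightarrow> 'w) \<Rightarrow> bool"
  where "orthogonal_module G \<rho> \<longleftrightarrow>
    group_action G UNIV \<rho> \<and> (\<forall>g\<in>carrier G. orthogonal_transformation (\<rho> g))"

definition irreducible_module ::
    "('g, 'r) monoid_scheme \<Rightarrow> ('g \<Rightarrow> 'w::euclidean_space \<Rightarrow> 'w) \<Rightarrow> bool"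
  where "irreducible_module G \<rho> \<longleftrightarrow>
    (\<forall>U. subspace U \<and> (\<forall>g\<in>carrier G. \<rho> g ` U \<subseteq> U) \<longrightarrow> U = {0} \<or> U = UNIV)"

definition trivial_module :: "('g, 'r) monoid_scheme \<Rightarrow> ('g \<Rightarrow> 'w \<Rightarrow> 'w) \<Rightarrow> bool"
  where "trivial_module G \<rho> \<longleftrightarrow> (\<forall>g\<in>carrier G. \<forall>x. \<rho> g x = x)"

definition End_G :: "('g, 'r) monoid_scheme \<Rightarrow> ('g \<Rightarrow> 'w::real_vector \<Rightarrow> 'w) \<Rightarrow> ('w \<Rightarrow> 'w) set"
  where "End_G G \<rho> = {f. linear f \<and> (\<forall>g\<in>carrier G. \<forall>x. f (\<rho> g x) = \<rho> g (f x))}"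

text \<open>
  \<open>act x a\<close> is \<open>x a\<close>. Right multiplication is an isomorphism of \<open>'d\<close> onto the
  opposite algebra of \<open>End_G G \<rho>\<close> (for commutative \<open>'d\<close> the order is immaterial).
\<close>

definition right_module_over_End ::
    "('g, 'r) monoid_scheme \<Rightarrow> ('g \<Rightarrow> 'w::euclidean_space \<Rightarrow> 'w) \<Rightarrow>
     ('w \<Rightarrow> 'd::{real_normed_div_algebra,euclidean_space} \<Rightarrow> 'w) \<Rightarrow> bool"
  where "right_module_over_End G \<rho> act \<longleftrightarrow>
    bilinear act \<and> (\<forall>x. act x 1 = x) \<and> (\<forall>x a b. act (act x a) b = act x (a * b)) \<and>
    bij_betw (\<lambda>a x. act x a) UNIV (End_G G \<rho>)"

definition invariant_hermitian_form ::
    "('g, 'r) monoid_scheme \<Rightarrow> ('g \<Rightarrow> 'w::euclidean_space \<Rightarrow> 'w) \<Rightarrow>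
     ('w \<Rightarrow> 'd::{real_normed_div_algebra,euclidean_space} \<Rightarrow> 'w) \<Rightarrow> ('w \<Rightarrow> 'w \<Rightarrow> 'd) \<Rightarrow> bool"
  where "invariant_hermitian_form G \<rho> act h \<longleftrightarrow>
    bilinear h \<and>
    (\<forall>x y. h y x = hconj (h x y)) \<and>
    (\<forall>x y a b. h (act x a) (act y b) = hconj a * h x y * b) \<and>
    (\<forall>g\<in>carrier G. \<forall>x y. h (\<rho> g x) (\<rho> g y) = h x y) \<and>
    (\<forall>x y. real_part (h x y) = x \<bullet> y)"

definition right_basis :: "('m::comm_monoid_add \<Rightarrow> 'd::zero \<Rightarrow> 'm) \<Rightarrow> 'm set \<Rightarrow> 'm set \<Rightarrow> bool"
  where "right_basis act U B \<longleftrightarrow> finite B \<and> B \<subseteq> U \<and>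
    (\<forall>x\<in>U. \<exists>!c. (\<forall>b. b \<notin> B \<longrightarrow> c b = 0) \<and> x = (\<Sum>b\<in>B. act b (c b)))"

definition right_dim :: "('m::comm_monoid_add \<Rightarrow> 'd::zero \<Rightarrow> 'm) \<Rightarrow> 'm set \<Rightarrow> nat"
  where "right_dim act U = card (SOME B. right_basis act U B)"

text \<open>Rank over a possibly noncommutative algebra: dimension of the right column space.\<close>

definition matrix_rank :: "'d::ring_1^'n^'m \<Rightarrow> nat"
  where "matrix_rank A = right_dim (\<lambda>v a. \<chi> i. v $ i * a) (range (\<lambda>c. A *v c))"


section \<open>Orbits in the double module and their defects\<close>

text \<open>\<open>V = W \<oplus> W\<close> is the type \<open>'w^2\<close>; the inner product of the library is the orthogonal direct sum.\<close>

definition diag_action :: "('g \<Rightarrow> 'w \<Rightarrow> 'w) \<Rightarrow> 'g \<Rightarrow> 'w^2 \<Rightarrow> 'w^2"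
  where "diag_action \<rho> g x = (\<chi> i. \<rho> g (x $ i))"

definition gram :: "('w \<Rightarrow> 'w \<Rightarrow> 'd) \<Rightarrow> 'w^2 \<Rightarrow> 'd^2^2"
  where "gram h x = (\<chi> i j. h (x $ i) (x $ j))"

text \<open>Only meaningful for \<open>x\<close> in the unit sphere, where \<open>gram h x - 1/2\<close> is traceless Hermitian.\<close>

definition defect ::
    "('w \<Rightarrow> 'w \<Rightarrow> 'd::{real_normed_div_algebra,euclidean_space}) \<Rightarrow> 'w^2 \<Rightarrow> 'd herm0"
  where "defect h x = Abs_herm0 (gram h x - (1/2) *\<^sub>R mat 1)"

definition weighted_collection :: "'i set \<Rightarrow> ('i \<Rightarrow> real) \<Rightarrow> ('i \<Rightarrow> 'a::real_normed_vector) \<Rightarrow> bool"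
  where "weighted_collection I w x \<longleftrightarrow>
    finite I \<and> (\<forall>i\<in>I. 0 < w i) \<and> sum w I = 1 \<and> (\<forall>i\<in>I. x i \<in> sphere 0 1)"

definition second_moment_identity ::
    "'i set \<Rightarrow> ('i \<Rightarrow> real) \<Rightarrow> ('i \<Rightarrow> 'a::real_inner) \<Rightarrow> real \<Rightarrow> bool"
  where "second_moment_identity I w z c \<longleftrightarrow>
    (\<forall>B C. (\<Sum>i\<in>I. w i * (B \<bullet> z i) * (C \<bullet> z i)) = c * (B \<bullet> C))"

definition defect_equations ::
    "('w::euclidean_space \<Rightarrow> 'w \<Rightarrow> 'd::{real_normed_div_algebra,euclidean_space}) \<Rightarrow>
     'i set \<Rightarrow> ('i \<Rightarrow> real) \<Rightarrow> ('i \<Rightarrow> 'w^2) \<Rightarrow> bool"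
  where "defect_equations h I w x \<longleftrightarrow>
    (\<Sum>i\<in>I. w i *\<^sub>R defect h (x i)) = 0 \<and>
    second_moment_identity I w (\<lambda>i. defect h (x i)) (1 / (2 * (real DIM('w) + 1)))"

definition correction_set ::
    "('w \<Rightarrow> 'w \<Rightarrow> 'd::{real_normed_div_algebra,euclidean_space}) \<Rightarrow> 'i set \<Rightarrow> ('i \<Rightarrow> 'w^2) \<Rightarrow> 'i set"
  where "correction_set h I x = {i\<in>I. defect h (x i) \<noteq> 0}"

definition correction_weight ::
    "('w \<Rightarrow> 'w \<Rightarrow> 'd::{real_normed_div_algebra,euclidean_space}) \<Rightarrow>
     'i set \<Rightarrow> ('i \<Rightarrow> real) \<Rightarrow> ('i \<Rightarrow> 'w^2) \<Rightarrow> real"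
  where "correction_weight h I w x = sum w (correction_set h I x)"

definition optimal_weight ::
    "('w::euclidean_space \<Rightarrow> 'w \<Rightarrow> 'd::{real_normed_div_algebra,euclidean_space}) \<Rightarrow> real"
  where "optimal_weight h = (real DIM('d) + 1) / (real DIM('w) + 1)"

definition correction_weight_optimal ::
    "('g, 'r) monoid_scheme \<Rightarrow> ('g \<Rightarrow> 'w::euclidean_space \<Rightarrow> 'w) \<Rightarrow>
     ('w \<Rightarrow> 'w \<Rightarrow> 'd::{real_normed_div_algebra,euclidean_space}) \<Rightarrow>
     'i set \<Rightarrow> ('i \<Rightarrow> real) \<Rightarrow> ('i \<Rightarrow> 'w^2) \<Rightarrow> bool"
  where "correction_weight_optimal G \<rho> h I w x \<longleftrightarrow>
    weighted_collection I w x \<and> defect_equations h I w x \<and>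
    (\<exists>i\<in>I. spherical_design 2 (orbit G (diag_action \<rho>) (x i))) \<and>
    correction_weight h I w x = optimal_weight h"

definition orbit_measure ::
    "('g, 'r) monoid_scheme \<Rightarrow> ('g \<Rightarrow> 'w \<Rightarrow> 'w) \<Rightarrow>
     'i set \<Rightarrow> ('i \<Rightarrow> real) \<Rightarrow> ('i \<Rightarrow> 'w^2) \<Rightarrow> ('w^2) pmf"
  where "orbit_measure G \<rho> I w x =
    convex_comb I w (\<lambda>i. pmf_of_set (orbit G (diag_action \<rho>) (x i)))"

text \<open>
  The passage from the defect equations to the design property in degree 4 needs that the
  \<open>G\<close>-invariant quartic forms on \<open>V\<close> are quadratic forms in the entries of the Gram matrix, and
  irreducibility of \<open>W\<close> does not give this. Example: the dihedral group of order 8 on the plane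
  (real type, \<open>q = 2\<close>) with \<open>x\<^sub>0 = (e\<^sub>1, e\<^sub>2) / sqrt 2\<close> and correction points
  \<open>(cos \<theta> e\<^sub>1, sin \<theta> e\<^sub>1)\<close> for \<open>\<theta> = 0, \<pi>/3, 2\<pi>/3\<close>, each of weight \<open>2/9\<close>. The defect equations
  hold, but the quartic \<open>(x\<^sub>1 \<bullet> e\<^sub>1)^4\<close> has mean \<open>1/6\<close>, as opposed to \<open>1/8\<close> on the sphere.
\<close>

definition quartics_from_gram ::
    "('g, 'r) monoid_scheme \<Rightarrow> ('g \<Rightarrow> 'w::euclidean_space \<Rightarrow> 'w) \<Rightarrow>
     ('w \<Rightarrow> 'w \<Rightarrow> 'd::euclidean_space) \<Rightarrow> bool"
  where "quartics_from_gram G \<rho> h \<longleftrightarrow>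
    (\<forall>p :: 'w^2 \<Rightarrow> real. hom_poly 4 p \<and> (\<forall>g\<in>carrier G. \<forall>x. p (diag_action \<rho> g x) = p x) \<longrightarrow>
       (\<exists>Q :: 'd^2^2 \<Rightarrow> real. hom_poly 2 Q \<and> (\<forall>x. p x = Q (gram h x))))"

end

theory Submission
  imports Defs
begin

text \<open>
  Taking the trace of the second defect equation gives \<open>\<Sum> w\<^sub>i |Z\<^sub>i|\<^sup>2 = r / (2 (q + 1))\<close>, while
  \<open>|Z|\<^sup>2 \<le> 1/2\<close> by Cauchy-Schwarz for the Hermitian form; equality of the weight with
  \<open>r / (q + 1)\<close> therefore forces \<open>|Z\<^sub>i|\<^sup>2 = 1/2\<close> for every nonzero defect, and the defect equations
  become the moment conditions of a 2-design after rescaling. The converse reverses this rescaling.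

  For the design property in degree 4, averaging a quartic over \<open>G\<close> turns it into a quadratic
  polynomial in the defect, so it suffices that the first two moments of the defect over the
  sphere are \<open>0\<close> and \<open>1 / (2 (q + 1))\<close> times the identity. The second one follows from the
  fourth moments of the sphere, because \<open>\<langle>B, Z(x)\<rangle>\<close> is a quadratic form \<open>x \<bullet> M x\<close> with \<open>M\<close>
  traceless and \<open>M\<^sup>2 = |B|\<^sup>2 / 2\<close>. In degree 2, Schur's lemma expresses the average over \<open>G\<close>
  through the Gram matrix, and odd degrees vanish after antipodalization.
\<close>

section \<open>Rotation invariance and moments of the sphere\<close>

text \<open>The number 1/2 is the squared norm of u u* - I/2 for a unit vector u, the largest value
  the squared norm of a defect can take on the sphere. The constant 1/(2(q+1)) reflects dim V = 2q:
  the fourth moments give 2 tr(M^2) / (2q (2q+2)), and tr(M^2) = q |B|^2. That the remaining mass 1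
  - \<alpha> is positive in the converse is a dimension count: a zero-defect point has two
  orthogonal nonzero components, which forces d < q. Two obstacles shape the argument.
  \<open>sphere_measure\<close> is a cone measure on an abstract Euclidean space, so its moments
  have to be derived from rotation invariance, and that in turn from the invariance of Lebesgue
  measure under isometries. And \<open>defect\<close> is specified only on the unit sphere, so
  integrals are taken of a quadratic map on all of V that agrees with it there.\<close>

lemma emeasure_ball_pos_finite:
  "emeasure lborel (ball (0::'a::euclidean_space) 1) \<noteq> 0"
  "emeasure lborel (ball (0::'a::euclidean_space) 1) \<noteq> \<infinity>"
  using content_ball_gt_0_iff[of "0::'a" 1] emeasure_lborel_ball_finite[of "0::'a" 1]
  by (auto simp: measure_def)

lemma emeasure_lborel_ball_0: "emeasure lborel (ball (x::'a) r) = emeasure lborel (ball (0::'a::euclidean_space) r)"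
proof (cases "0 \<le> r")
  case True
  then show ?thesis by (simp add: emeasure_ball)
next
  case False
  then show ?thesis by (simp add: ball_empty)
qed

text \<open>
  Uniqueness of translation invariant measures: integrate \<open>indicator A x * indicator (ball 0 1) (x - y)\<close>
  over the product of the two measures in both orders.
\<close>

lemma lborel_distr_orthogonal_transformation:
  fixes f :: "'a::euclidean_space \<Rightarrow> 'a"
  assumes f: "orthogonal_transformation f"
  shows "distr lborel borel f = lborel"
proof -
  define N where "N = distr lborel borel f"
  have lin: "linear f" using f by (rule orthogonal_transformation_linear)
  have [measurable]: "f \<in> borel_measurable borel"
    using lin by (intro borel_measurable_continuous_onI linear_continuous_on)
      (simp add: linear_conv_bounded_linear)
  have [measurable_cong]: "sets N = sets borel" by (simp add: N_def)
  have ball: "f -` ball (f c) r = ball c r" for c r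
    using f by (auto simp: dist_norm orthogonal_transformation_norm[OF f] linear_diff[OF lin, symmetric])
  have f0: "f 0 = 0" using lin by (rule linear_0)
  \<comment> \<open>Balls around 0 normalize the proportionality factor between the two translation
    invariant measures to 1; they also witness sigma-finiteness of \<open>N\<close>.\<close>
  have Nball: "emeasure N (ball 0 r) = emeasure lborel (ball (0::'a) r)" for r
    using ball[of 0 r] by (simp add: N_def emeasure_distr f0)
  have trans: "(\<integral>\<^sup>+x. g (y + x) \<partial>N) = (\<integral>\<^sup>+x. g x \<partial>N)"
    if [measurable]: "g \<in> borel_measurable borel" for g y
  proof -
    \<comment> \<open>Surjectivity of \<open>f\<close> turns translation by \<open>y\<close> into
      translation by a preimage of \<open>y\<close>, performed before \<open>f\<close>, where
      Lebesgue measure is known to be invariant.\<close>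
    obtain c where c: "y = f c"
      using orthogonal_transformation_surj[OF f] by (metis surjD)
    have "(\<integral>\<^sup>+x. g (y + x) \<partial>N) = (\<integral>\<^sup>+x. g (f (c + x)) \<partial>lborel)"
      by (simp add: N_def nn_integral_distr c linear_add[OF lin])
    also have "\<dots> = (\<integral>\<^sup>+x. g (f x) \<partial>distr lborel borel ((+) c))"
      by (simp add: nn_integral_distr)
    also have "\<dots> = (\<integral>\<^sup>+x. g x \<partial>N)"
      by (simp add: lborel_distr_plus N_def nn_integral_distr)
    finally show ?thesis .
  qed
  have sf: "sigma_finite_measure N"
  proof
    show "\<exists>A. countable A \<and> A \<subseteq> sets N \<and> \<Union> A = space N \<and> (\<forall>a\<in>A. emeasure N a \<noteq> \<infinity>)"
    proof (intro exI conjI)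
      show "countable (range (\<lambda>n::nat. ball (0::'a) (real n)))" by simp
      show "range (\<lambda>n::nat. ball 0 (real n)) \<subseteq> sets N" by (auto simp: N_def)
      show "\<Union> (range (\<lambda>n::nat. ball (0::'a) (real n))) = space N"
        using reals_Archimedean2 by (auto simp: N_def)
      show "\<forall>a\<in>range (\<lambda>n::nat. ball 0 (real n)). emeasure N a \<noteq> \<infinity>"
        using emeasure_lborel_ball_finite[of "0::'a"] by (auto simp: Nball less_top)
    qed
  qed
  interpret sigma_finite_measure N by (rule sf)
  interpret P: pair_sigma_finite lborel N ..
  show ?thesis unfolding N_def[symmetric]
  proof (rule measure_eqI)
    fix A assume "A \<in> sets N"
    then have [measurable]: "A \<in> sets borel" by (simp add: N_def)
    define b where "b = emeasure lborel (ball (0::'a) 1)"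
    let ?k = "\<lambda>x y. indicator A x * indicator (ball 0 1) (x - y) :: ennreal"
    have [measurable]: "ball (0::'a) 1 \<in> sets borel" by simp
    have [measurable]: "case_prod (\<lambda>y x. ?k x y) \<in> borel_measurable (lborel \<Otimes>\<^sub>M N)"
      by measurable
    have inner: "(\<integral>\<^sup>+y. ?k x y \<partial>lborel) = indicator A x * b" for x
    proof -
      have "indicator (ball 0 1) (x - y) = (indicator (ball x 1) y :: ennreal)" for y
        by (simp add: indicator_def dist_norm norm_minus_commute[of x y])
      then have "(\<integral>\<^sup>+y. ?k x y \<partial>lborel) = (\<integral>\<^sup>+y. indicator A x * indicator (ball x 1) y \<partial>lborel)"
        by (simp only:)
      also have "\<dots> = indicator A x * (\<integral>\<^sup>+y. indicator (ball x 1) y \<partial>lborel)"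
        by (rule nn_integral_cmult) (simp add: borel_measurable_indicator)
      finally have "(\<integral>\<^sup>+y. ?k x y \<partial>lborel) = indicator A x * (\<integral>\<^sup>+y. indicator (ball x 1) y \<partial>lborel)" .
      then show ?thesis by (simp add: b_def emeasure_lborel_ball_0[of x])
    qed
    have "emeasure N A * b = (\<integral>\<^sup>+x. indicator A x * b \<partial>N)"
      by (subst nn_integral_multc) (simp_all add: N_def)
    also have "\<dots> = (\<integral>\<^sup>+x. (\<integral>\<^sup>+y. ?k x y \<partial>lborel) \<partial>N)"
      by (simp only: inner)
    also have "\<dots> = (\<integral>\<^sup>+y. (\<integral>\<^sup>+x. ?k x y \<partial>N) \<partial>lborel)"
      by (rule P.Fubini') measurable
    also have "\<dots> = (\<integral>\<^sup>+y. (\<integral>\<^sup>+x. ?k (y + x) y \<partial>N) \<partial>lborel)"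
    proof (rule nn_integral_cong)
      fix y
      have "(\<lambda>x. ?k x y) \<in> borel_measurable borel" by measurable
      from trans[OF this, of y]
      show "(\<integral>\<^sup>+x. ?k x y \<partial>N) = (\<integral>\<^sup>+x. ?k (y + x) y \<partial>N)" by (rule sym)
    qed
    also have "\<dots> = (\<integral>\<^sup>+y. (\<integral>\<^sup>+x. indicator A (y + x) * indicator (ball 0 1) x \<partial>N) \<partial>lborel)"
      by (simp only: add_diff_cancel_left')
    also have "\<dots> = (\<integral>\<^sup>+x. (\<integral>\<^sup>+y. indicator A (y + x) * indicator (ball 0 1) x \<partial>lborel) \<partial>N)"
      by (rule P.Fubini'[symmetric]) measurable
    also have "\<dots> = (\<integral>\<^sup>+x. indicator (ball 0 1) x * emeasure lborel A \<partial>N)"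
    proof (rule nn_integral_cong)
      fix x
      have "(\<integral>\<^sup>+y. indicator A (y + x) * indicator (ball 0 1) x \<partial>lborel)
          = (\<integral>\<^sup>+y. indicator A y * indicator (ball 0 1) x \<partial>distr lborel borel ((+) x))"
        by (simp add: nn_integral_distr add.commute)
      also have "\<dots> = indicator (ball 0 1) x * emeasure lborel A"
        by (simp add: lborel_distr_plus nn_integral_multc mult.commute)
      finally show "(\<integral>\<^sup>+y. indicator A (y + x) * indicator (ball 0 1) x \<partial>lborel)
          = indicator (ball 0 1) x * emeasure lborel A" .
    qed
    also have "\<dots> = emeasure lborel A * b"
      by (subst nn_integral_multc) (simp_all add: N_def[symmetric] Nball b_def mult.commute)
    finally show "emeasure N A = emeasure lborel A"
      using emeasure_ball_pos_finite
      by (auto simp: b_def mult.commute[of _ "emeasure lborel (ball 0 1)"] ennreal_mult_cancel_left)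
  qed (simp add: N_def)
qed

lemma prob_space_sphere_measure: "prob_space (sphere_measure :: 'a::euclidean_space measure)"
proof -
  interpret prob_space "uniform_measure lborel (ball (0::'a) 1)"
    by (rule prob_space_uniform_measure) (use emeasure_ball_pos_finite in auto)
  show ?thesis unfolding sphere_measure_def
    by (rule prob_space_distr) simp
qed

lemma sets_sphere_measure [measurable_cong]: "sets sphere_measure = sets borel"
  by (simp add: sphere_measure_def)

text \<open>Only almost everywhere: the radial projection sends the centre of the ball to 0, since
  the inverse of 0 is 0. A single point is a null set.\<close>

lemma AE_sphere_measure: "AE x in (sphere_measure :: 'a::euclidean_space measure). norm x = 1"
proof -
  have "AE x in uniform_measure lborel (ball (0::'a) 1). norm (x /\<^sub>R norm x) = 1"
    using AE_lborel_singleton[of "0::'a"] by (intro AE_uniform_measureI) auto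
  then show ?thesis
    unfolding sphere_measure_def by (subst AE_distr_iff) auto
qed

text \<open>A linear isometry preserves the unit ball and commutes with the radial projection, so
  the invariance of Lebesgue measure passes to the cone measure.\<close>

lemma sphere_measure_orthogonal:
  fixes f :: "'a::euclidean_space \<Rightarrow> 'a"
  assumes f: "orthogonal_transformation f"
  shows "distr sphere_measure borel f = sphere_measure"
proof -
  let ?U = "uniform_measure lborel (ball (0::'a) 1)"
  have lin: "linear f" using f by (rule orthogonal_transformation_linear)
  have [measurable]: "f \<in> borel_measurable borel"
    using lin by (intro borel_measurable_continuous_onI linear_continuous_on)
      (simp add: linear_conv_bounded_linear)
  have U: "distr ?U borel f = ?U"
  proof (rule measure_eqI)
    fix A assume "A \<in> sets (distr ?U borel f)"
    then have [measurable]: "A \<in> sets borel" by simp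
    have [measurable]: "f -` A \<in> sets borel"
      using measurable_sets_borel[of f borel A] by simp
    have v: "ball 0 1 \<inter> f -` A = f -` (ball 0 1 \<inter> A)"
      by (auto simp: orthogonal_transformation_norm[OF f])
    have "emeasure (distr ?U borel f) A = emeasure (distr lborel borel f) (ball 0 1 \<inter> A) / emeasure lborel (ball (0::'a) 1)"
      by (simp add: emeasure_distr v del: vimage_Int)
    then show "emeasure (distr ?U borel f) A = emeasure ?U A"
      by (simp add: lborel_distr_orthogonal_transformation[OF f])
  qed simp
  have "distr sphere_measure borel f = distr ?U borel (\<lambda>x. f x /\<^sub>R norm (f x))"
    unfolding sphere_measure_def
    by (subst distr_distr) (auto simp: comp_def linear_scale[OF lin] orthogonal_transformation_norm[OF f])
  also have "\<dots> = distr (distr ?U borel f) borel (\<lambda>x. x /\<^sub>R norm x)"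
    by (subst distr_distr) (auto simp: comp_def)
  finally show ?thesis unfolding U by (simp add: sphere_measure_def)
qed

lemma integral_sphere_measure_orthogonal:
  fixes f :: "'a::euclidean_space \<Rightarrow> 'a" and p :: "'a \<Rightarrow> real"
  assumes f: "orthogonal_transformation f" and [measurable]: "p \<in> borel_measurable borel"
  shows "(\<integral>x. p (f x) \<partial>sphere_measure) = (\<integral>x. p x \<partial>sphere_measure)"
proof -
  have [measurable]: "f \<in> borel_measurable borel"
    using orthogonal_transformation_linear[OF f]
    by (intro borel_measurable_continuous_onI linear_continuous_on) (simp add: linear_conv_bounded_linear)
  show ?thesis
    by (subst (2) sphere_measure_orthogonal[OF f, symmetric]) (simp add: integral_distr)
qed

section \<open>Integrals of continuous functions and moments of the sphere\<close>

lemma integrable_sphere_measure: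
  fixes p :: "'a::euclidean_space \<Rightarrow> real"
  assumes "continuous_on UNIV p"
  shows "integrable sphere_measure p"
proof -
  interpret prob_space "sphere_measure :: 'a measure" by (rule prob_space_sphere_measure)
  have [measurable]: "p \<in> borel_measurable borel"
    using assms by (rule borel_measurable_continuous_onI)
  have "compact (p ` sphere 0 1)"
    using assms by (intro compact_continuous_image continuous_on_subset[OF assms]) auto
  then obtain B where B: "\<And>x. x \<in> sphere 0 1 \<Longrightarrow> norm (p x) \<le> B"
    by (metis bounded_iff compact_imp_bounded imageI)
  show ?thesis
    by (rule integrable_const_bound[where B = B])
      (use AE_sphere_measure B in \<open>auto elim!: eventually_mono\<close>)
qed

text \<open>The reflection in the hyperplane orthogonal to \<open>a - b\<close> exchanges the two
  vectors; equality of the norms enters as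
  \<open>2 * (a \<bullet> u) = u \<bullet> u\<close>.\<close>

lemma orthogonal_transformation_exists_euclidean:
  fixes a b :: "'a::euclidean_space"
  assumes "norm a = norm b"
  shows "\<exists>f. orthogonal_transformation f \<and> f a = b"
proof (cases "a = b")
  case True
  then show ?thesis using orthogonal_transformation_id by (metis id_apply)
next
  case False
  define u where "u = a - b"
  define f where "f = (\<lambda>x. x - (2 * (x \<bullet> u) / (u \<bullet> u)) *\<^sub>R u)"
  have u: "u \<bullet> u \<noteq> 0" using False by (simp add: u_def)
  have ab: "a \<bullet> a = b \<bullet> b" using assms by (simp add: norm_eq)
  have "linear f"
    by (rule linearI) (simp_all add: f_def inner_add_left add_divide_distrib algebra_simps)
  moreover have "f x \<bullet> f y = x \<bullet> y" for x y
    using u by (simp add: f_def inner_diff_left inner_diff_right inner_commute field_simps)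
  moreover have "2 * (a \<bullet> u) = u \<bullet> u"
    using ab by (simp add: u_def inner_diff_left inner_diff_right inner_commute)
  then have "f a = b" using u by (simp add: f_def) (simp add: u_def)
  ultimately show ?thesis by (auto simp: orthogonal_transformation_def)
qed

lemma integral_sphere_measure_odd:
  fixes p :: "'a::euclidean_space \<Rightarrow> real"
  assumes "continuous_on UNIV p" "\<And>x. p (- x) = - p x"
  shows "(\<integral>x. p x \<partial>sphere_measure) = 0"
proof -
  have "orthogonal_transformation (uminus :: 'a \<Rightarrow> 'a)"
    by (simp add: orthogonal_transformation_def linear_uminus)
  from integral_sphere_measure_orthogonal[OF this, of p]
  show ?thesis using assms by (simp add: borel_measurable_continuous_onI)
qed

text \<open>An isometry carries a multiple of a fixed basis vector to \<open>a\<close>, so rotation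
  invariance leaves one unknown constant per degree. In degrees 2 and 4 it is evaluated through
  \<open>sphere_sum_Basis\<close>.\<close>

lemma sphere_moment_power:
  "\<exists>K. \<forall>a::'a::euclidean_space. (\<integral>x. (x \<bullet> a) ^ k \<partial>sphere_measure) = K * norm a ^ k"
proof -
  obtain e :: 'a where e: "e \<in> Basis" using nonempty_Basis by blast
  show ?thesis
  proof (intro exI allI)
    fix a :: 'a
    from e have "norm (norm a *\<^sub>R e) = norm a" by simp
    then obtain f where f: "orthogonal_transformation f" and fa: "f (norm a *\<^sub>R e) = a"
      using orthogonal_transformation_exists_euclidean by blast
    have fx: "f x \<bullet> a = norm a * (x \<bullet> e)" for x
      using f fa unfolding orthogonal_transformation_def by (metis inner_scaleR_right)
    have "(\<integral>x. (x \<bullet> a) ^ k \<partial>sphere_measure) = (\<integral>x. (f x \<bullet> a) ^ k \<partial>sphere_measure)"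
      by (rule integral_sphere_measure_orthogonal[OF f, of "\<lambda>x. (x \<bullet> a) ^ k", symmetric]) simp
    then show "(\<integral>x. (x \<bullet> a) ^ k \<partial>sphere_measure)
        = (\<integral>x. (x \<bullet> e) ^ k \<partial>sphere_measure) * norm a ^ k"
        by (simp add: fx power_mult_distrib mult.commute)
  qed
qed

text \<open>Inserting the factor |x|^2, which is 1 almost everywhere, relates moments of degree k +
  2 to moments of degree k.\<close>

lemma sphere_sum_Basis:
  fixes p :: "'a::euclidean_space \<Rightarrow> real"
  assumes p: "continuous_on UNIV p"
  shows "(\<Sum>b\<in>Basis. \<integral>x. p x * (x \<bullet> b)\<^sup>2 \<partial>sphere_measure) = (\<integral>x. p x \<partial>sphere_measure)"
proof -
  have "(\<Sum>b\<in>Basis. \<integral>x. p x * (x \<bullet> b)\<^sup>2 \<partial>sphere_measure)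
      = (\<integral>x. (\<Sum>b\<in>Basis. p x * (x \<bullet> b)\<^sup>2) \<partial>sphere_measure)"
    by (intro Bochner_Integration.integral_sum[symmetric] integrable_sphere_measure continuous_intros p)
  also have "\<dots> = (\<integral>x. p x \<partial>sphere_measure)"
  proof (rule integral_cong_AE)
    show "(\<lambda>x. \<Sum>b\<in>Basis. p x * (x \<bullet> b)\<^sup>2) \<in> borel_measurable sphere_measure"
      unfolding measurable_cong_sets[OF sets_sphere_measure refl]
      by (intro borel_measurable_continuous_onI continuous_intros p)
    show "p \<in> borel_measurable sphere_measure"
      unfolding measurable_cong_sets[OF sets_sphere_measure refl]
      using p by (rule borel_measurable_continuous_onI)
    show "AE x in sphere_measure. (\<Sum>b\<in>Basis. p x * (x \<bullet> b)\<^sup>2) = p x"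
      using AE_sphere_measure
    proof (eventually_elim)
      case (elim x)
      have "(\<Sum>b\<in>Basis. (x \<bullet> b)\<^sup>2) = (norm x)\<^sup>2"
        by (simp add: norm_eq_sqrt_inner euclidean_inner[of x x] power2_eq_square sum_nonneg)
      then show ?case using elim by (simp add: sum_distrib_left[symmetric])
    qed
  qed
  finally show ?thesis .
qed

lemma sphere_moment_2:
  fixes a b :: "'a::euclidean_space"
  shows "(\<integral>x. (x \<bullet> a) * (x \<bullet> b) \<partial>sphere_measure) = (a \<bullet> b) / DIM('a)"
proof -
  interpret prob_space "sphere_measure :: 'a measure" by (rule prob_space_sphere_measure)
  obtain K where K: "(\<integral>x. (x \<bullet> a)\<^sup>2 \<partial>sphere_measure) = K * (a \<bullet> a)" for a :: 'a
    using sphere_moment_power[where 'a = 'a, of 2] by (auto simp: power2_norm_eq_inner)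
  have "real DIM('a) * K = 1"
    using sphere_sum_Basis[of "\<lambda>_::'a. 1"] prob_space by (simp add: K)
  then have K': "K = 1 / DIM('a)" by (simp add: field_simps)
  have eq: "(x \<bullet> a) * (x \<bullet> b) = ((x \<bullet> (a + b))\<^sup>2 - (x \<bullet> (a - b))\<^sup>2) / 4" for x
    by (simp add: inner_add_right inner_diff_right power2_eq_square field_simps)
  have "(\<integral>x. (x \<bullet> a) * (x \<bullet> b) \<partial>sphere_measure)
      = (\<integral>x. (x \<bullet> (a + b))\<^sup>2 - (x \<bullet> (a - b))\<^sup>2 \<partial>sphere_measure) / 4"
    unfolding eq by (rule integral_divide_zero)
  also have "\<dots> = (K * ((a + b) \<bullet> (a + b)) - K * ((a - b) \<bullet> (a - b))) / 4"
    by (subst Bochner_Integration.integral_diff) (auto simp: K intro!: integrable_sphere_measure continuous_intros)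
  finally show ?thesis
    by (simp add: K' inner_add_right inner_diff_right inner_add_left inner_diff_left inner_commute field_simps)
qed

text \<open>As for Gaussian vectors, the value is a sum over the three pairings of the four vectors.
  Polarization is applied three times: from fourth powers to products of two squares, then to one
  square, then to four independent vectors.\<close>

lemma sphere_moment_4:
  fixes a b c d :: "'a::euclidean_space"
  shows "(\<integral>x. (x \<bullet> a) * (x \<bullet> b) * (x \<bullet> c) * (x \<bullet> d) \<partial>sphere_measure)
    = ((a \<bullet> b) * (c \<bullet> d) + (a \<bullet> c) * (b \<bullet> d) + (a \<bullet> d) * (b \<bullet> c)) / (real DIM('a) * (real DIM('a) + 2))"
proof -
  let ?S = "sphere_measure :: 'a measure"
  obtain K0 where K0: "(\<integral>x. (x \<bullet> a) ^ 4 \<partial>?S) = K0 * norm a ^ 4" for a :: 'a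
    using sphere_moment_power[where 'a = 'a, of 4] by auto
  \<comment> \<open>For four equal vectors the three pairings coincide, hence the factor 3.\<close>
  define K where "K = K0 / 3"
  have "norm a ^ 4 = (a \<bullet> a)\<^sup>2" for a :: 'a
    by (simp flip: power2_norm_eq_inner)
  with K0 have K: "(\<integral>x. (x \<bullet> a) ^ 4 \<partial>?S) = 3 * K * (a \<bullet> a)\<^sup>2" for a :: 'a
    by (simp add: K_def)
  have i4: "integrable ?S (\<lambda>x. (x \<bullet> a) ^ 4)" for a
    by (intro integrable_sphere_measure continuous_intros)
  have i22: "integrable ?S (\<lambda>x. (x \<bullet> a)\<^sup>2 * (x \<bullet> b)\<^sup>2)" for a b
    by (intro integrable_sphere_measure continuous_intros)
  have i112: "integrable ?S (\<lambda>x. (x \<bullet> a) * (x \<bullet> b) * (x \<bullet> c)\<^sup>2)" for a b c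
    by (intro integrable_sphere_measure continuous_intros)
  note lin = inner_add_right inner_diff_right inner_add_left inner_diff_left
  have m22: "(\<integral>x. (x \<bullet> a)\<^sup>2 * (x \<bullet> b)\<^sup>2 \<partial>?S) = K * ((a \<bullet> a) * (b \<bullet> b) + 2 * (a \<bullet> b)\<^sup>2)" for a b
  proof -
    have eq: "(x \<bullet> a)\<^sup>2 * (x \<bullet> b)\<^sup>2 = ((x \<bullet> (a + b)) ^ 4 + (x \<bullet> (a - b)) ^ 4 - 2 * (x \<bullet> a) ^ 4 - 2 * (x \<bullet> b) ^ 4) / 12" for x
      unfolding lin by algebra
    have "(\<integral>x. (x \<bullet> a)\<^sup>2 * (x \<bullet> b)\<^sup>2 \<partial>?S)
        = (\<integral>x. (x \<bullet> (a + b)) ^ 4 + (x \<bullet> (a - b)) ^ 4 - 2 * (x \<bullet> a) ^ 4 - 2 * (x \<bullet> b) ^ 4 \<partial>?S) / 12"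
      unfolding eq by (rule integral_divide_zero)
    also have "(\<integral>x. (x \<bullet> (a + b)) ^ 4 + (x \<bullet> (a - b)) ^ 4 - 2 * (x \<bullet> a) ^ 4 - 2 * (x \<bullet> b) ^ 4 \<partial>?S)
        = 3 * K * ((a + b) \<bullet> (a + b))\<^sup>2 + 3 * K * ((a - b) \<bullet> (a - b))\<^sup>2 - 2 * (3 * K * (a \<bullet> a)\<^sup>2) - 2 * (3 * K * (b \<bullet> b)\<^sup>2)"
      by (simp add: K i4)
    also have "\<dots> = 12 * K * ((a \<bullet> a) * (b \<bullet> b) + 2 * (a \<bullet> b)\<^sup>2)"
      unfolding lin inner_commute[of b a] by algebra
    finally show ?thesis by simp
  qed
  have m112: "(\<integral>x. (x \<bullet> a) * (x \<bullet> b) * (x \<bullet> c)\<^sup>2 \<partial>?S) = K * ((a \<bullet> b) * (c \<bullet> c) + 2 * (a \<bullet> c) * (b \<bullet> c))" for a b c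
  proof -
    have eq: "(x \<bullet> a) * (x \<bullet> b) * (x \<bullet> c)\<^sup>2 = ((x \<bullet> (a + b))\<^sup>2 * (x \<bullet> c)\<^sup>2 - (x \<bullet> (a - b))\<^sup>2 * (x \<bullet> c)\<^sup>2) / 4" for x
      unfolding lin by algebra
    have "(\<integral>x. (x \<bullet> a) * (x \<bullet> b) * (x \<bullet> c)\<^sup>2 \<partial>?S)
        = (\<integral>x. (x \<bullet> (a + b))\<^sup>2 * (x \<bullet> c)\<^sup>2 - (x \<bullet> (a - b))\<^sup>2 * (x \<bullet> c)\<^sup>2 \<partial>?S) / 4"
      unfolding eq by (rule integral_divide_zero)
    also have "(\<integral>x. (x \<bullet> (a + b))\<^sup>2 * (x \<bullet> c)\<^sup>2 - (x \<bullet> (a - b))\<^sup>2 * (x \<bullet> c)\<^sup>2 \<partial>?S)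
        = K * (((a + b) \<bullet> (a + b)) * (c \<bullet> c) + 2 * ((a + b) \<bullet> c)\<^sup>2) - K * (((a - b) \<bullet> (a - b)) * (c \<bullet> c) + 2 * ((a - b) \<bullet> c)\<^sup>2)"
      by (simp add: m22 i22)
    also have "\<dots> = 4 * K * ((a \<bullet> b) * (c \<bullet> c) + 2 * (a \<bullet> c) * (b \<bullet> c))"
      unfolding lin inner_commute[of b a] by algebra
    finally show ?thesis by simp
  qed
  have m1111: "(\<integral>x. (x \<bullet> a) * (x \<bullet> b) * (x \<bullet> c) * (x \<bullet> d) \<partial>?S)
      = K * ((a \<bullet> b) * (c \<bullet> d) + (a \<bullet> c) * (b \<bullet> d) + (a \<bullet> d) * (b \<bullet> c))"
  proof -
    have eq: "(x \<bullet> a) * (x \<bullet> b) * (x \<bullet> c) * (x \<bullet> d)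
        = ((x \<bullet> a) * (x \<bullet> b) * (x \<bullet> (c + d))\<^sup>2 - (x \<bullet> a) * (x \<bullet> b) * (x \<bullet> (c - d))\<^sup>2) / 4" for x
      unfolding lin by algebra
    have "(\<integral>x. (x \<bullet> a) * (x \<bullet> b) * (x \<bullet> c) * (x \<bullet> d) \<partial>?S)
        = (\<integral>x. (x \<bullet> a) * (x \<bullet> b) * (x \<bullet> (c + d))\<^sup>2 - (x \<bullet> a) * (x \<bullet> b) * (x \<bullet> (c - d))\<^sup>2 \<partial>?S) / 4"
      unfolding eq by (rule integral_divide_zero)
    also have "(\<integral>x. (x \<bullet> a) * (x \<bullet> b) * (x \<bullet> (c + d))\<^sup>2 - (x \<bullet> a) * (x \<bullet> b) * (x \<bullet> (c - d))\<^sup>2 \<partial>?S)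
        = K * ((a \<bullet> b) * ((c + d) \<bullet> (c + d)) + 2 * (a \<bullet> (c + d)) * (b \<bullet> (c + d)))
        - K * ((a \<bullet> b) * ((c - d) \<bullet> (c - d)) + 2 * (a \<bullet> (c - d)) * (b \<bullet> (c - d)))"
      by (simp add: m112 i112)
    also have "\<dots> = 4 * K * ((a \<bullet> b) * (c \<bullet> d) + (a \<bullet> c) * (b \<bullet> d) + (a \<bullet> d) * (b \<bullet> c))"
      unfolding lin inner_commute[of d c] by algebra
    finally show ?thesis by simp
  qed
  obtain e :: 'a where e: "e \<in> Basis" using nonempty_Basis by blast
  \<comment> \<open>Summing the moments of
    \<open>(x \<bullet> e)\<^sup>2 * (x \<bullet> b)\<^sup>2\<close> over \<open>b\<close> must
    return the second moment of \<open>e\<close>; the left side is \<open>K * (DIM('a) + 2)\<close>,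
    which determines \<open>K\<close>.\<close>
  have "(\<Sum>b\<in>Basis. K * ((e \<bullet> e) * (b \<bullet> b) + 2 * (e \<bullet> b)\<^sup>2)) = 1 / DIM('a)"
    using sphere_sum_Basis[of "\<lambda>x. (x \<bullet> e)\<^sup>2"] sphere_moment_2[of e e] e
    by (simp add: m22) (simp add: power2_eq_square continuous_intros)
  moreover have "(\<Sum>b\<in>Basis. (e \<bullet> b)\<^sup>2) = 1"
    using euclidean_inner[of e e] e by (simp add: power2_eq_square)
  ultimately have "K * (DIM('a) + 2) = 1 / DIM('a)"
    using e by (simp add: sum_distrib_left[symmetric] sum.distrib add.commute)
  then have "K * (real DIM('a) * (real DIM('a) + 2)) = 1"
    by (simp add: field_simps)
  moreover have "real DIM('a) * (real DIM('a) + 2) \<noteq> 0"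
    using DIM_positive[where 'a = 'a] by simp
  ultimately have "K = 1 / (real DIM('a) * (real DIM('a) + 2))"
    by (metis nonzero_eq_divide_eq)
  then show ?thesis using m1111 by simp
qed

lemma linear_inner_self_expand:
  fixes M :: "'a::euclidean_space \<Rightarrow> 'a"
  assumes M: "linear M"
  shows "x \<bullet> M x = (\<Sum>b\<in>Basis. (x \<bullet> b) * (x \<bullet> M b))"
proof -
  have "M x = M (\<Sum>b\<in>Basis. (x \<bullet> b) *\<^sub>R b)"
    by (simp only: euclidean_representation)
  then show ?thesis
    by (simp only: linear_sum[OF M] linear_scale[OF M] inner_sum_right inner_scaleR_right)
qed

lemma sphere_quadratic_form:
  fixes M :: "'a::euclidean_space \<Rightarrow> 'a"
  assumes M: "linear M"
  shows "(\<integral>x. x \<bullet> M x \<partial>sphere_measure) = (\<Sum>b\<in>Basis. b \<bullet> M b) / DIM('a)"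
proof -
  have "integrable sphere_measure (\<lambda>x. (x \<bullet> a) * (x \<bullet> b))" for a b :: 'a
    by (intro integrable_sphere_measure continuous_intros)
  then show ?thesis
    by (simp add: linear_inner_self_expand[OF M] sphere_moment_2 sum_divide_distrib)
qed

text \<open>The three pairings in the fourth moment give the squared trace, the sum of all
  \<open>M b \<bullet> M b\<close>, and a third term that self-adjointness makes equal to the
  second.\<close>

lemma sphere_quadratic_form_square:
  fixes M :: "'a::euclidean_space \<Rightarrow> 'a"
  assumes M: "linear M" and adj: "\<And>x y. M x \<bullet> y = x \<bullet> M y"
  shows "(\<integral>x. (x \<bullet> M x)\<^sup>2 \<partial>sphere_measure)
    = ((\<Sum>b\<in>Basis. b \<bullet> M b)\<^sup>2 + 2 * (\<Sum>b\<in>Basis. M b \<bullet> M b)) / (real DIM('a) * (real DIM('a) + 2))"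
proof -
  define k where "k = 1 / (real DIM('a) * (real DIM('a) + 2))"
  note quad = linear_inner_self_expand[OF M]
  have parseval: "(\<Sum>c\<in>Basis. (y \<bullet> c) * (z \<bullet> c)) = y \<bullet> z" for y z :: 'a
    by (rule euclidean_inner[symmetric])
  have i: "integrable sphere_measure (\<lambda>x. (x \<bullet> a) * (x \<bullet> b) * (x \<bullet> c) * (x \<bullet> d))" for a b c d :: 'a
    by (intro integrable_sphere_measure continuous_intros)
  have "(x \<bullet> M x)\<^sup>2 = (\<Sum>b\<in>Basis. \<Sum>c\<in>Basis. (x \<bullet> b) * (x \<bullet> M b) * (x \<bullet> c) * (x \<bullet> M c))" for x
    unfolding quad power2_eq_square sum_product by (simp only: mult.assoc)
  then have "(\<integral>x. (x \<bullet> M x)\<^sup>2 \<partial>sphere_measure)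
      = (\<Sum>b\<in>Basis. \<Sum>c\<in>Basis. \<integral>x. (x \<bullet> b) * (x \<bullet> M b) * (x \<bullet> c) * (x \<bullet> M c) \<partial>sphere_measure)"
    by (simp add: i)
  also have "\<dots> = (\<Sum>b\<in>Basis. \<Sum>c\<in>Basis.
      k * ((b \<bullet> M b) * (c \<bullet> M c) + (b \<bullet> c) * (M b \<bullet> M c) + (b \<bullet> M c) * (M b \<bullet> c)))"
    by (simp add: sphere_moment_4 k_def)
  also have "\<dots> = k * ((\<Sum>b\<in>Basis. \<Sum>c\<in>Basis. (b \<bullet> M b) * (c \<bullet> M c))
      + (\<Sum>b\<in>Basis. \<Sum>c\<in>Basis. (b \<bullet> c) * (M b \<bullet> M c)) + (\<Sum>b\<in>Basis. \<Sum>c\<in>Basis. (M b \<bullet> c) * (M b \<bullet> c)))"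
    by (simp only: sum_distrib_left sum.distrib distrib_left adj[symmetric])
  also have "(\<Sum>b\<in>Basis. \<Sum>c\<in>Basis. (b \<bullet> c) * (M b \<bullet> M c)) = (\<Sum>b\<in>Basis. M b \<bullet> M b)"
  proof (rule sum.cong)
    fix b :: 'a assume "b \<in> Basis"
    then have "(\<Sum>c\<in>Basis. (b \<bullet> c) * (M b \<bullet> M c)) = (\<Sum>c\<in>Basis. if b = c then M b \<bullet> M b else 0)"
      by (intro sum.cong) (auto simp: inner_Basis)
    then show "(\<Sum>c\<in>Basis. (b \<bullet> c) * (M b \<bullet> M c)) = M b \<bullet> M b"
      using \<open>b \<in> Basis\<close> by simp
  qed simp
  finally show ?thesis
    unfolding parseval sum_product[symmetric] power2_eq_square
    by (simp add: k_def)
qed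

section \<open>Homogeneous polynomials\<close>

lemma finite_exponents: "finite {m. m \<in> Basis \<rightarrow>\<^sub>E {..k::nat} \<and> sum m (Basis :: 'a::euclidean_space set) = k}"
  by (rule finite_subset[of _ "Basis \<rightarrow>\<^sub>E {..k}"]) (auto intro: finite_PiE)

lemma hom_poly_add: "hom_poly k p \<Longrightarrow> hom_poly k q \<Longrightarrow> hom_poly k (\<lambda>x. p x + q x)"
  unfolding hom_poly_def
proof (elim exE)
  fix c d
  assume "p = (\<lambda>x. \<Sum>m | m \<in> Basis \<rightarrow>\<^sub>E {..k} \<and> sum m Basis = k. c m * (\<Prod>b\<in>Basis. (x \<bullet> b) ^ m b))"
    "q = (\<lambda>x. \<Sum>m | m \<in> Basis \<rightarrow>\<^sub>E {..k} \<and> sum m Basis = k. d m * (\<Prod>b\<in>Basis. (x \<bullet> b) ^ m b))"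
  then show "\<exists>c. (\<lambda>x. p x + q x) = (\<lambda>x. \<Sum>m | m \<in> Basis \<rightarrow>\<^sub>E {..k} \<and> sum m Basis = k. c m * (\<Prod>b\<in>Basis. (x \<bullet> b) ^ m b))"
    by (intro exI[of _ "\<lambda>m. c m + d m"]) (simp add: distrib_right sum.distrib)
qed

lemma hom_poly_cmult: "hom_poly k p \<Longrightarrow> hom_poly k (\<lambda>x. r * p x)"
  unfolding hom_poly_def
proof (elim exE)
  fix c
  assume "p = (\<lambda>x. \<Sum>m | m \<in> Basis \<rightarrow>\<^sub>E {..k} \<and> sum m Basis = k. c m * (\<Prod>b\<in>Basis. (x \<bullet> b) ^ m b))"
  then show "\<exists>c. (\<lambda>x. r * p x) = (\<lambda>x. \<Sum>m | m \<in> Basis \<rightarrow>\<^sub>E {..k} \<and> sum m Basis = k. c m * (\<Prod>b\<in>Basis. (x \<bullet> b) ^ m b))"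
    by (intro exI[of _ "\<lambda>m. r * c m"]) (simp add: sum_distrib_left mult.assoc)
qed

lemma hom_poly_zero: "hom_poly k (\<lambda>x. 0)"
  unfolding hom_poly_def by (intro exI[of _ "\<lambda>_. 0"]) simp

lemma hom_poly_sum: "(\<And>i. i \<in> I \<Longrightarrow> hom_poly k (p i)) \<Longrightarrow> hom_poly k (\<lambda>x. \<Sum>i\<in>I. p i x)"
  by (induction I rule: infinite_finite_induct) (auto intro: hom_poly_zero hom_poly_add)

lemma hom_poly_monomial:
  fixes m :: "'a::euclidean_space \<Rightarrow> nat"
  assumes "sum m Basis = k"
  shows "hom_poly k (\<lambda>x. \<Prod>b\<in>Basis. (x \<bullet> b) ^ m b)"
proof -
  let ?S = "{m. m \<in> Basis \<rightarrow>\<^sub>E {..k::nat} \<and> sum m (Basis :: 'a set) = k}"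
  \<comment> \<open>\<open>hom_poly\<close> sums over extensional exponent functions, so the values
    of \<open>m\<close> outside \<open>Basis\<close> have to be erased.\<close>
  let ?m = "restrict m Basis"
  have m: "?m \<in> ?S"
    using assms by (auto intro!: member_le_sum)
  have "(\<Sum>m'\<in>?S. (if m' = ?m then 1 else 0) * (\<Prod>b\<in>Basis. (x \<bullet> b) ^ m' b)) = (\<Prod>b\<in>Basis. (x \<bullet> b) ^ m b)" for x
  proof -
    have "(\<Sum>m'\<in>?S. (if m' = ?m then 1 else 0) * (\<Prod>b\<in>Basis. (x \<bullet> b) ^ m' b))
        = (\<Sum>m'\<in>?S. if m' = ?m then \<Prod>b\<in>Basis. (x \<bullet> b) ^ ?m b else 0)"
      by (rule sum.cong) auto
    also have "\<dots> = (\<Prod>b\<in>Basis. (x \<bullet> b) ^ ?m b)"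
      using m by (simp only: sum.delta[OF finite_exponents] if_True)
    finally show ?thesis by simp
  qed
  then show ?thesis
    unfolding hom_poly_def by (intro exI[of _ "\<lambda>m'. if m' = ?m then 1 else 0"]) simp
qed

lemma hom_poly_mult:
  fixes p q :: "'a::euclidean_space \<Rightarrow> real"
  assumes "hom_poly j p" "hom_poly k q"
  shows "hom_poly (j + k) (\<lambda>x. p x * q x)"
proof -
  obtain c d where
    p: "p = (\<lambda>x. \<Sum>m | m \<in> Basis \<rightarrow>\<^sub>E {..j} \<and> sum m Basis = j. c m * (\<Prod>b\<in>Basis. (x \<bullet> b) ^ m b))" and
    q: "q = (\<lambda>x. \<Sum>m | m \<in> Basis \<rightarrow>\<^sub>E {..k} \<and> sum m Basis = k. d m * (\<Prod>b\<in>Basis. (x \<bullet> b) ^ m b))"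
    using assms unfolding hom_poly_def by blast
  have eq: "(c m * (\<Prod>b\<in>Basis. (x \<bullet> b) ^ m b)) * (d n * (\<Prod>b\<in>Basis. (x \<bullet> b) ^ n b))
      = (c m * d n) * (\<Prod>b\<in>Basis. (x \<bullet> b) ^ (m b + n b))" for m n and x :: 'a
    by (simp add: power_add prod.distrib mult_ac)
  show ?thesis
    unfolding p q sum_product eq
    by (intro hom_poly_sum hom_poly_cmult hom_poly_monomial) (simp add: sum.distrib)
qed

lemma hom_poly_const: "hom_poly 0 (\<lambda>x. c)"
proof -
  have "hom_poly 0 (\<lambda>x. c * (\<Prod>b\<in>Basis. (x \<bullet> b) ^ (\<lambda>_. 0) b))"
    by (intro hom_poly_cmult hom_poly_monomial) simp
  then show ?thesis by simp
qed

lemma hom_poly_inner: "hom_poly 1 (\<lambda>x::'a::euclidean_space. x \<bullet> a)"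
proof -
  have "hom_poly 1 (\<lambda>x::'a. x \<bullet> b)" if b: "b \<in> Basis" for b
  proof -
    have "hom_poly 1 (\<lambda>x::'a. \<Prod>i\<in>Basis. (x \<bullet> i) ^ (if i = b then 1 else 0))"
      using b by (intro hom_poly_monomial) simp
    moreover have "(\<Prod>i\<in>Basis. (x \<bullet> i) ^ (if i = b then 1 else 0)) = x \<bullet> b" for x :: 'a
      using b by (subst prod.remove[of _ b]) auto
    ultimately show ?thesis by simp
  qed
  then have "hom_poly 1 (\<lambda>x::'a. \<Sum>b\<in>Basis. (a \<bullet> b) * (x \<bullet> b))"
    by (intro hom_poly_sum hom_poly_cmult)
  moreover have "x \<bullet> a = (\<Sum>b\<in>Basis. (a \<bullet> b) * (x \<bullet> b))" for x :: 'a
    by (subst euclidean_inner) (simp only: mult.commute)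
  ultimately show ?thesis by simp
qed

lemma hom_poly_power: "hom_poly 1 p \<Longrightarrow> hom_poly k (\<lambda>x. p x ^ k)"
  by (induction k) (use hom_poly_const hom_poly_mult[of 1 p] in auto)

lemma hom_poly_prod:
  "finite I \<Longrightarrow> (\<And>i. i \<in> I \<Longrightarrow> hom_poly (m i) (p i)) \<Longrightarrow> hom_poly (sum m I) (\<lambda>x. \<Prod>i\<in>I. p i x)"
  by (induction I rule: finite_induct) (auto intro: hom_poly_const hom_poly_mult)

text \<open>Each coordinate of \<open>f x\<close> is a linear form in \<open>x\<close>, by means of
  the adjoint. This keeps the degree of a form fixed when it is averaged over the group.\<close>

lemma hom_poly_compose_linear:
  fixes f :: "'a::euclidean_space \<Rightarrow> 'b::euclidean_space"
  assumes "linear f" "hom_poly k p"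
  shows "hom_poly k (\<lambda>x. p (f x))"
proof -
  obtain c where
    p: "p = (\<lambda>x. \<Sum>m | m \<in> Basis \<rightarrow>\<^sub>E {..k} \<and> sum m Basis = k. c m * (\<Prod>b\<in>Basis. (x \<bullet> b) ^ m b))"
    using assms unfolding hom_poly_def by blast
  have "hom_poly 1 (\<lambda>x. f x \<bullet> b)" for b
    using hom_poly_inner[of "adjoint f b"] by (simp add: adjoint_works[OF assms(1)])
  then have "hom_poly (sum m Basis) (\<lambda>x. \<Prod>b\<in>Basis. (f x \<bullet> b) ^ m b)" for m
    by (intro hom_poly_prod hom_poly_power) auto
  then show ?thesis unfolding p
    by (auto intro!: hom_poly_sum hom_poly_cmult)
qed

lemma continuous_on_hom_poly: "hom_poly k p \<Longrightarrow> continuous_on S p"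
  unfolding hom_poly_def by (auto intro!: continuous_intros)

lemma hom_poly_minus:
  assumes "hom_poly k p"
  shows "p (- x) = (- 1) ^ k * p x"
proof -
  obtain c where
    p: "p = (\<lambda>x. \<Sum>m | m \<in> Basis \<rightarrow>\<^sub>E {..k} \<and> sum m Basis = k. c m * (\<Prod>b\<in>Basis. (x \<bullet> b) ^ m b))"
    using assms unfolding hom_poly_def by blast
  have "(\<Prod>b\<in>Basis. (- x \<bullet> b) ^ m b) = (- 1) ^ k * (\<Prod>b\<in>Basis. (x \<bullet> b) ^ m b)" if "sum m Basis = k" for m
    unfolding that[symmetric] power_sum prod.distrib[symmetric]
    by (intro prod.cong refl) (metis inner_minus_left power_minus)
  then show ?thesis
    by (simp add: p sum_distrib_left mult.left_commute cong: conj_cong)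
qed

lemma hom_poly_0_imp_const:
  assumes "hom_poly 0 p"
  shows "\<exists>c. p = (\<lambda>x. c)"
proof -
  obtain c where
    p: "p = (\<lambda>x. \<Sum>m | m \<in> Basis \<rightarrow>\<^sub>E {..0} \<and> sum m Basis = 0. c m * (\<Prod>b\<in>Basis. (x \<bullet> b) ^ m b))"
    using assms unfolding hom_poly_def by blast
  have "p x = (\<Sum>m | m \<in> Basis \<rightarrow>\<^sub>E {..0::nat} \<and> sum m (Basis::'a set) = 0. c m)" for x
    unfolding p by (intro sum.cong refl) simp
  then show ?thesis by blast
qed

text \<open>Every monomial of positive degree contains some variable; one is chosen per monomial,
  and the monomials are grouped by that choice. Iterating writes linear forms as inner products and
  quadratic forms as sums of products of two linear forms.\<close>

lemma hom_poly_Suc_decompose: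
  fixes p :: "'a::euclidean_space \<Rightarrow> real"
  assumes "hom_poly (Suc k) p"
  shows "\<exists>P. (\<forall>b\<in>Basis. hom_poly k (P b)) \<and> (\<forall>x. p x = (\<Sum>b\<in>Basis. (x \<bullet> b) * P b x))"
proof -
  let ?S = "{m. m \<in> Basis \<rightarrow>\<^sub>E {..Suc k} \<and> sum m (Basis :: 'a set) = Suc k}"
  obtain c where p: "p = (\<lambda>x. \<Sum>m\<in>?S. c m * (\<Prod>b\<in>Basis. (x \<bullet> b) ^ m b))"
    using assms unfolding hom_poly_def by blast
  have "\<exists>b\<in>Basis. m b > 0" if "m \<in> ?S" for m
    using that by (metis (mono_tags, lifting) mem_Collect_eq neq0_conv sum.neutral nat.distinct(1))
  then obtain e where e: "\<And>m. m \<in> ?S \<Longrightarrow> e m \<in> Basis \<and> m (e m) > 0" by metis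
  \<comment> \<open>The exponent left after splitting off the variable \<open>e m\<close>; the
    truncated subtraction is harmless because \<open>m (e m) > 0\<close>.\<close>
  define n where "n = (\<lambda>m. m(e m := m (e m) - 1))"
  define P where "P = (\<lambda>b x. \<Sum>m\<in>{m\<in>?S. e m = b}. c m * (\<Prod>i\<in>Basis. (x \<bullet> i) ^ n m i))"
  have n: "sum (n m) Basis = k" if "m \<in> ?S" for m
  proof -
    have "sum m Basis = m (e m) + sum m (Basis - {e m})"
      using e[OF that] by (intro sum.remove) auto
    moreover have "sum (n m) Basis = (m (e m) - 1) + sum m (Basis - {e m})"
      using e[OF that] by (subst sum.remove[of _ "e m"]) (auto simp: n_def)
    ultimately show ?thesis using that e[OF that] by auto
  qed
  have mono: "(\<Prod>b\<in>Basis. (x \<bullet> b) ^ m b) = (x \<bullet> e m) * (\<Prod>i\<in>Basis. (x \<bullet> i) ^ n m i)" if "m \<in> ?S" for m x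
  proof -
    have "(\<Prod>b\<in>Basis. (x \<bullet> b) ^ m b) = (x \<bullet> e m) ^ m (e m) * (\<Prod>b\<in>Basis - {e m}. (x \<bullet> b) ^ m b)"
      using e[OF that] by (intro prod.remove) auto
    moreover have "(\<Prod>b\<in>Basis. (x \<bullet> b) ^ n m b) = (x \<bullet> e m) ^ (m (e m) - 1) * (\<Prod>b\<in>Basis - {e m}. (x \<bullet> b) ^ m b)"
      using e[OF that] by (subst prod.remove[of _ "e m"]) (auto simp: n_def)
    ultimately show ?thesis
      using e[OF that] by (cases "m (e m)") auto
  qed
  have "p x = (\<Sum>b\<in>Basis. (x \<bullet> b) * P b x)" for x
  proof -
    have "p x = (\<Sum>m\<in>?S. c m * ((x \<bullet> e m) * (\<Prod>i\<in>Basis. (x \<bullet> i) ^ n m i)))"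
      unfolding p by (rule sum.cong) (simp_all only: mono)
    also have "\<dots> = (\<Sum>b\<in>Basis. \<Sum>m\<in>{m\<in>?S. e m = b}. c m * ((x \<bullet> e m) * (\<Prod>i\<in>Basis. (x \<bullet> i) ^ n m i)))"
      by (rule sum.group[symmetric]) (use finite_exponents e in auto)
    also have "\<dots> = (\<Sum>b\<in>Basis. (x \<bullet> b) * P b x)"
      unfolding P_def sum_distrib_left by (intro sum.cong refl) (simp add: mult.left_commute)
    finally show ?thesis .
  qed
  moreover have "hom_poly k (P b)" for b
    unfolding P_def by (intro hom_poly_sum hom_poly_cmult hom_poly_monomial n) auto
  ultimately show ?thesis by blast
qed

lemma hom_poly_1_imp_inner:
  fixes p :: "'a::euclidean_space \<Rightarrow> real"
  assumes "hom_poly 1 p"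
  shows "\<exists>a. \<forall>x. p x = x \<bullet> a"
proof -
  obtain P where P: "\<And>b. b \<in> Basis \<Longrightarrow> hom_poly 0 (P b)" and p: "\<And>x. p x = (\<Sum>b\<in>Basis. (x \<bullet> b) * P b x)"
    using hom_poly_Suc_decompose[of 0 p] assms by auto
  have "\<forall>b\<in>Basis. \<exists>c. P b = (\<lambda>x. c)"
    using P hom_poly_0_imp_const by blast
  from bchoice[OF this] obtain c where "\<forall>b\<in>Basis. P b = (\<lambda>x. c b)" by blast
  then have "p x = x \<bullet> (\<Sum>b\<in>Basis. c b *\<^sub>R b)" for x
    by (simp add: p inner_sum_right mult.commute)
  then show ?thesis by blast
qed

lemma hom_poly_2_imp_sum:
  fixes p :: "'a::euclidean_space \<Rightarrow> real"
  assumes "hom_poly 2 p"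
  shows "\<exists>a. \<forall>x. p x = (\<Sum>b\<in>Basis. (x \<bullet> b) * (x \<bullet> a b))"
proof -
  obtain P where P: "\<And>b. b \<in> Basis \<Longrightarrow> hom_poly 1 (P b)" and p: "\<And>x. p x = (\<Sum>b\<in>Basis. (x \<bullet> b) * P b x)"
    using hom_poly_Suc_decompose[of 1 p] assms by (auto simp: numeral_2_eq_2)
  have "\<forall>b\<in>Basis. \<exists>a. \<forall>x. P b x = x \<bullet> a"
    using P hom_poly_1_imp_inner by blast
  from bchoice[OF this] obtain a where "\<forall>b\<in>Basis. \<forall>x. P b x = x \<bullet> a b" by blast
  then have "p x = (\<Sum>b\<in>Basis. (x \<bullet> b) * (x \<bullet> a b))" for x by (simp add: p)
  then show ?thesis by blast
qed

lemma hom_poly_imp_poly_deg_le: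
  assumes "hom_poly k p" "k \<le> t"
  shows "poly_deg_le t p"
  unfolding poly_deg_le_def
proof (intro exI conjI)
  let ?P = "\<lambda>j. if j = k then p else (\<lambda>x. 0)"
  show "\<forall>j\<le>t. hom_poly j (?P j)" using assms hom_poly_zero by auto
  have "(\<Sum>j\<le>t. ?P j x) = (\<Sum>j\<le>t. if j = k then p x else 0)" for x
    by (rule sum.cong) auto
  then show "p = (\<lambda>x. \<Sum>j\<le>t. ?P j x)"
    using assms by auto
qed


section \<open>Weighted designs\<close>

lemma weighted_design_iff_hom_poly:
  fixes \<mu> :: "'a::euclidean_space pmf"
  shows "weighted_design t \<mu> \<longleftrightarrow> finite (set_pmf \<mu>) \<and> set_pmf \<mu> \<subseteq> sphere 0 1 \<and>
    (\<forall>k\<le>t. \<forall>p. hom_poly k p \<longrightarrow> measure_pmf.expectation \<mu> p = integral\<^sup>L sphere_measure p)"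
    (is "_ \<longleftrightarrow> ?fin \<and> ?sub \<and> ?hom")
proof (intro iffI conjI)
  assume "?fin \<and> ?sub \<and> ?hom"
  then have fin: ?fin and sub: ?sub and hom: ?hom by auto
  have "measure_pmf.expectation \<mu> p = integral\<^sup>L sphere_measure p" if p: "poly_deg_le t p" for p
  proof -
    obtain P where P: "\<And>k. k \<le> t \<Longrightarrow> hom_poly k (P k)" and p: "p = (\<lambda>x. \<Sum>k\<le>t. P k x)"
      using p unfolding poly_deg_le_def by blast
    have "measure_pmf.expectation \<mu> p = (\<Sum>k\<le>t. measure_pmf.expectation \<mu> (P k))"
      unfolding p by (rule Bochner_Integration.integral_sum) (rule integrable_measure_pmf_finite[OF fin])
    also have "\<dots> = (\<Sum>k\<le>t. integral\<^sup>L sphere_measure (P k))"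
      using hom P by (intro sum.cong) auto
    also have "\<dots> = integral\<^sup>L sphere_measure p"
      unfolding p
      by (rule Bochner_Integration.integral_sum[symmetric], rule integrable_sphere_measure)
        (use P continuous_on_hom_poly in auto)
    finally show ?thesis .
  qed
  then show "weighted_design t \<mu>" using fin sub by (simp add: weighted_design_def)
qed (auto simp: weighted_design_def intro: hom_poly_imp_poly_deg_le)

text \<open>Constants are integrated correctly by every probability measure, and a quadratic form is
  a sum of products of two linear forms, so it suffices to test linear forms and such
  products.\<close>

lemma weighted_design_2_iff:
  fixes \<mu> :: "'a::euclidean_space pmf"
  shows "weighted_design 2 \<mu> \<longleftrightarrow> finite (set_pmf \<mu>) \<and> set_pmf \<mu> \<subseteq> sphere 0 1 \<and>
    (\<forall>a. measure_pmf.expectation \<mu> (\<lambda>x. x \<bullet> a) = 0) \<and>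
    (\<forall>a b. measure_pmf.expectation \<mu> (\<lambda>x. (x \<bullet> a) * (x \<bullet> b)) = (a \<bullet> b) / DIM('a))"
    (is "_ \<longleftrightarrow> ?fin \<and> ?sub \<and> ?one \<and> ?two")
proof (intro iffI)
  have hom2: "hom_poly 2 (\<lambda>x::'a. (x \<bullet> a) * (x \<bullet> b))" for a b
    using hom_poly_mult[OF hom_poly_inner[of a] hom_poly_inner[of b]] by (simp add: numeral_2_eq_2)
  have lin: "(\<integral>x. x \<bullet> a \<partial>sphere_measure) = 0" for a :: 'a
    by (rule integral_sphere_measure_odd) (auto intro!: continuous_intros)
  {
    assume "weighted_design 2 \<mu>"
    then have D: ?fin ?sub and
      E: "\<And>k p. k \<le> 2 \<Longrightarrow> hom_poly k p \<Longrightarrow> measure_pmf.expectation \<mu> p = integral\<^sup>L sphere_measure p"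
      unfolding weighted_design_iff_hom_poly by blast+
    have ?one using E[OF _ hom_poly_inner] lin by simp
    moreover have ?two using E[OF _ hom2] by (simp add: sphere_moment_2)
    ultimately show "?fin \<and> ?sub \<and> ?one \<and> ?two" using D by blast
  next
    assume A: "?fin \<and> ?sub \<and> ?one \<and> ?two"
    then have fin: ?fin by blast
    have "measure_pmf.expectation \<mu> p = integral\<^sup>L sphere_measure p" if k: "k \<le> 2" "hom_poly k p" for k p
    proof -
      consider "k = 0" | "k = 1" | "k = 2" using k(1) by linarith
      then show ?thesis
      proof cases
        case 1
        interpret S: prob_space "sphere_measure :: 'a measure" by (rule prob_space_sphere_measure)
        from 1 k obtain c where "p = (\<lambda>x. c)" using hom_poly_0_imp_const by blast
        then show ?thesis using S.prob_space by simp
      next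
        case 2
        then obtain a where "p = (\<lambda>x. x \<bullet> a)" using hom_poly_1_imp_inner k by blast
        then show ?thesis using A lin by simp
      next
        case 3
        then obtain a where p: "p = (\<lambda>x. \<Sum>b\<in>Basis. (x \<bullet> b) * (x \<bullet> a b))" using hom_poly_2_imp_sum k by blast
        have "measure_pmf.expectation \<mu> p = (\<Sum>b\<in>Basis. measure_pmf.expectation \<mu> (\<lambda>x. (x \<bullet> b) * (x \<bullet> a b)))"
          unfolding p by (rule Bochner_Integration.integral_sum) (rule integrable_measure_pmf_finite[OF fin])
        also have "\<dots> = (\<Sum>b\<in>Basis. \<integral>x. (x \<bullet> b) * (x \<bullet> a b) \<partial>sphere_measure)"
          using A by (simp add: sphere_moment_2)
        also have "\<dots> = integral\<^sup>L sphere_measure p"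
          unfolding p
          by (intro Bochner_Integration.integral_sum[symmetric] integrable_sphere_measure continuous_intros)
        finally show ?thesis .
      qed
    qed
    then show "weighted_design 2 \<mu>"
      using A unfolding weighted_design_iff_hom_poly by blast
  }
qed

context
  fixes I :: "'i set" and w :: "'i \<Rightarrow> real"
  assumes fin: "finite I" and w_pos: "\<And>i. i \<in> I \<Longrightarrow> 0 < w i" and w_sum: "sum w I = 1"
begin

text \<open>\<open>embed_pmf\<close> has the intended density once nonnegativity and total mass 1
  are established; both are read off from the weights.\<close>

lemma pmf_convex_comb: "pmf (convex_comb I w M) x = (\<Sum>i\<in>I. w i * pmf (M i) x)"
  unfolding convex_comb_def
proof (rule pmf_embed_pmf)
  show "0 \<le> (\<Sum>i\<in>I. w i * pmf (M i) x)" for x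
    using w_pos by (intro sum_nonneg mult_nonneg_nonneg) (auto simp: less_imp_le)
  have "(\<integral>\<^sup>+x. ennreal (\<Sum>i\<in>I. w i * pmf (M i) x) \<partial>count_space UNIV)
      = (\<integral>\<^sup>+x. (\<Sum>i\<in>I. ennreal (w i) * ennreal (pmf (M i) x)) \<partial>count_space UNIV)"
    using w_pos by (intro nn_integral_cong) (simp add: sum_ennreal[symmetric] ennreal_mult less_imp_le)
  also have "\<dots> = (\<Sum>i\<in>I. ennreal (w i))"
    by (simp add: nn_integral_sum nn_integral_cmult nn_integral_pmf measure_pmf.emeasure_space_1[simplified])
  also have "\<dots> = 1"
    using w_pos w_sum by (simp add: less_imp_le)
  finally show "(\<integral>\<^sup>+x. ennreal (\<Sum>i\<in>I. w i * pmf (M i) x) \<partial>count_space UNIV) = 1" .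
qed

lemma set_pmf_convex_comb: "set_pmf (convex_comb I w M) = (\<Union>i\<in>I. set_pmf (M i))"
proof -
  have "(\<Sum>i\<in>I. w i * pmf (M i) x) = 0 \<longleftrightarrow> (\<forall>i\<in>I. pmf (M i) x = 0)" for x
    using fin w_pos by (subst sum_nonneg_eq_0_iff) (auto simp: less_imp_le less_imp_neq[symmetric])
  then show ?thesis
    by (auto simp: set_pmf_iff pmf_convex_comb)
qed

lemma expectation_convex_comb:
  fixes f :: "'a \<Rightarrow> real"
  assumes M: "\<And>i. i \<in> I \<Longrightarrow> finite (set_pmf (M i))"
  shows "measure_pmf.expectation (convex_comb I w M) f = (\<Sum>i\<in>I. w i * measure_pmf.expectation (M i) f)"
proof -
  define A where "A = (\<Union>i\<in>I. set_pmf (M i))"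
  have A: "finite A" using fin M by (simp add: A_def)
  have "measure_pmf.expectation (convex_comb I w M) f = (\<Sum>x\<in>A. f x * (\<Sum>i\<in>I. w i * pmf (M i) x))"
    by (subst integral_measure_pmf_real[OF A]) (auto simp: set_pmf_convex_comb A_def pmf_convex_comb)
  also have "\<dots> = (\<Sum>i\<in>I. w i * (\<Sum>x\<in>A. f x * pmf (M i) x))"
    unfolding sum_distrib_left by (subst sum.swap) (simp add: mult.left_commute)
  also have "\<dots> = (\<Sum>i\<in>I. w i * measure_pmf.expectation (M i) f)"
    by (intro sum.cong arg_cong2[where f = "(*)"] refl integral_measure_pmf_real[OF A, symmetric])
      (auto simp: A_def)
  finally show ?thesis .
qed

text \<open>Dictionary between the measure-theoretic notion of a design and the two vector
  identities in which the defect equations are phrased. Points \<open>v i\<close> may repeat, since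
  expectations are computed over the indices.\<close>

lemma weighted_design_2_weighted_points_iff:
  fixes v :: "'i \<Rightarrow> 'a::euclidean_space"
  shows "weighted_design 2 (weighted_points I w v) \<longleftrightarrow> (\<forall>i\<in>I. norm (v i) = 1) \<and>
    (\<Sum>i\<in>I. w i *\<^sub>R v i) = 0 \<and> second_moment_identity I w v (1 / DIM('a))"
proof -
  have E: "measure_pmf.expectation (weighted_points I w v) f = (\<Sum>i\<in>I. w i * f (v i))" for f :: "'a \<Rightarrow> real"
    unfolding weighted_points_def by (subst expectation_convex_comb) auto
  have set: "set_pmf (weighted_points I w v) = v ` I"
    unfolding weighted_points_def by (subst set_pmf_convex_comb) auto
  have "(\<forall>a. (\<Sum>i\<in>I. w i * (v i \<bullet> a)) = 0) \<longleftrightarrow> (\<Sum>i\<in>I. w i *\<^sub>R v i) = 0"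
    using vector_eq_rdot[of "\<Sum>i\<in>I. w i *\<^sub>R v i" 0] by (simp add: inner_sum_left)
  then show ?thesis
    unfolding weighted_design_2_iff E set second_moment_identity_def
    using fin by (auto simp: inner_commute[of "v _"] mult.assoc)
qed

end

lemma weighted_collectionD:
  assumes "weighted_collection I w x"
  shows "finite I" "\<And>i. i \<in> I \<Longrightarrow> 0 < w i" "sum w I = 1" "\<And>i. i \<in> I \<Longrightarrow> norm (x i) = 1"
  using assms by (auto simp: weighted_collection_def)

section \<open>Antipodalization as a two-term convex combination\<close>

lemma antipodalization_eq_convex_comb:
  "antipodalization \<mu> = convex_comb UNIV (\<lambda>_. 1 / 2) (\<lambda>b. if b then \<mu> else map_pmf uminus \<mu>)"
  by (simp add: antipodalization_def convex_comb_def UNIV_bool add_divide_distrib add.commute)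

lemma pmf_map_uminus: "pmf (map_pmf uminus \<mu>) x = pmf \<mu> (- x)" for x :: "'a::real_vector"
  using pmf_map_inj'[of uminus \<mu> "- x"] by (simp add: inj_def)

lemma pmf_antipodalization:
  fixes \<mu> :: "'a::real_vector pmf"
  shows "pmf (antipodalization \<mu>) x = (pmf \<mu> x + pmf \<mu> (- x)) / 2"
  unfolding antipodalization_eq_convex_comb
  by (subst pmf_convex_comb) (auto simp: UNIV_bool add_divide_distrib pmf_map_uminus)

lemma set_pmf_antipodalization:
  "set_pmf (antipodalization \<mu>) = set_pmf \<mu> \<union> uminus ` set_pmf \<mu>"
  unfolding antipodalization_eq_convex_comb
  by (subst set_pmf_convex_comb) (auto simp: UNIV_bool)

lemma expectation_antipodalization:
  fixes f :: "'a::real_vector \<Rightarrow> real"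
  assumes "finite (set_pmf \<mu>)"
  shows "measure_pmf.expectation (antipodalization \<mu>) f
    = (measure_pmf.expectation \<mu> f + measure_pmf.expectation \<mu> (\<lambda>x. f (- x))) / 2"
  unfolding antipodalization_eq_convex_comb
  by (subst expectation_convex_comb) (use assms in \<open>auto simp: UNIV_bool add_divide_distrib\<close>)

lemma antipodalization_eq_self:
  assumes "map_pmf uminus \<mu> = \<mu>"
  shows "antipodalization \<mu> = \<mu>"
proof (rule pmf_eqI)
  fix x
  have "pmf \<mu> (- x) = pmf \<mu> x"
    using pmf_map_uminus[of \<mu> x] assms by simp
  then show "pmf (antipodalization \<mu>) x = pmf \<mu> x"
    by (simp add: pmf_antipodalization)
qed

section \<open>Conjugation in the division algebra\<close>

lemma real_part_mult_commute: "real_part (a * b) = real_part (b * a)"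
  by (simp add: real_part_mult inner_commute mult.commute)

lemma real_part_hconj_mult: "real_part (hconj a * b) = a \<bullet> b"
  by (subst real_part_mult_commute) (simp add: real_part_mult_hconj inner_commute)

text \<open>Nondegeneracy of the trace form \<open>real_part (a * b)\<close>. In the Schur average
  it recovers a scalar of the division algebra from real traces.\<close>

lemma eq_by_real_part:
  assumes "\<And>z. real_part (a * z) = real_part (b * z)"
  shows "a = b"
proof -
  have "a \<bullet> z = b \<bullet> z" for z
    using assms[of "hconj z"] by (simp add: real_part_mult_hconj)
  then show ?thesis by (metis vector_eq_rdot)
qed


section \<open>Dimension over the division algebra\<close>

lemma right_basis_coeff_unique:
  assumes "right_basis act U B" and "(\<Sum>b\<in>B. act b (c b)) \<in> U"
    and "(\<Sum>b\<in>B. act b (c b)) = (\<Sum>b\<in>B. act b (d b))"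
    and "\<And>b. b \<notin> B \<Longrightarrow> c b = 0" and "\<And>b. b \<notin> B \<Longrightarrow> d b = 0"
  shows "c = d"
  using assms unfolding right_basis_def by metis

lemma right_basis_sum_single:
  assumes "finite B" "b \<in> B" "\<And>v. act v 0 = 0"
  shows "(\<Sum>b'\<in>B. act b' (if b' = b then a else 0)) = act b a"
proof -
  have "(\<Sum>b'\<in>B. act b' (if b' = b then a else 0)) = (\<Sum>b'\<in>B. if b' = b then act b a else 0)"
    by (rule sum.cong) (auto simp: assms(3))
  then show ?thesis using assms(1,2) by simp
qed

text \<open>\<open>right_dim\<close> is the cardinality of an arbitrarily selected basis, so
  exhibiting the basis \<open>{u}\<close> is not enough: every basis has to be shown to be a
  singleton.\<close>

lemma right_dim_line:
  fixes act :: "'m::ab_group_add \<Rightarrow> 'd::division_ring \<Rightarrow> 'm"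
  assumes act0: "\<And>v. act v 0 = 0" and act1: "\<And>v. act v 1 = v"
    and assoc: "\<And>v a b. act (act v a) b = act v (a * b)"
    and inj: "inj (act u)" and U: "U = range (act u)"
  shows "right_dim act U = 1"
proof -
  have u: "u \<in> U" unfolding U by (metis act1 rangeI)
  have basis: "right_basis act U {u}"
    unfolding right_basis_def
  proof (intro conjI ballI)
    fix x assume "x \<in> U"
    then obtain a where a: "x = act u a" unfolding U by blast
    show "\<exists>!c. (\<forall>b. b \<notin> {u} \<longrightarrow> c b = 0) \<and> x = (\<Sum>b\<in>{u}. act b (c b))"
    proof (rule ex1I[of _ "\<lambda>b. if b = u then a else 0"])
      fix c assume "(\<forall>b. b \<notin> {u} \<longrightarrow> c b = 0) \<and> x = (\<Sum>b\<in>{u}. act b (c b))"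
      then have c: "\<And>b. b \<noteq> u \<Longrightarrow> c b = 0" "act u (c u) = act u a" using a by auto
      then have "c u = a" using inj by (simp add: inj_eq)
      then show "c = (\<lambda>b. if b = u then a else 0)" using c by auto
    qed (simp add: a)
  qed (use u in auto)
  have "card B = 1" if B: "right_basis act U B" for B
  proof -
    have fin: "finite B" and sub: "B \<subseteq> U" using B by (auto simp: right_basis_def)
    have "B \<noteq> {}"
    proof
      assume "B = {}"
      then have "u = 0" using B u by (auto simp: right_basis_def)
      then have "act u 1 = act u 0" by (simp add: act0 act1)
      then show False using inj by (simp add: inj_eq)
    qed
    moreover have "b1 = b2" if b: "b1 \<in> B" "b2 \<in> B" for b1 b2
    proof (rule ccontr)
      assume ne: "b1 \<noteq> b2"
      \<comment> \<open>Two vectors on a line over a division ring are proportional unless the first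
        one is zero. In either case some vector gets two different coefficient families.\<close>
      obtain a1 a2 where a: "b1 = act u a1" "b2 = act u a2" using b sub U by blast
      have single: "(\<Sum>b'\<in>B. act b' (if b' = b then a else 0)) = act b a" if "b \<in> B" for b a
        using fin that act0 by (rule right_basis_sum_single)
      have "\<exists>a. act b1 a = b2 \<or> b1 = 0"
      proof (cases "a1 = 0")
        case True
        then show ?thesis by (simp add: a act0)
      next
        case False
        then have "act b1 (inverse a1 * a2) = b2"
          by (simp add: a assoc mult.assoc[symmetric])
        then show ?thesis by blast
      qed
      then consider a where "act b1 a = b2" | "b1 = 0" by blast
      then show False
      proof cases
        case 1
        have "(\<lambda>b. if b = b1 then a else 0) = (\<lambda>b. if b = b2 then 1 else 0)"
          by (rule right_basis_coeff_unique[OF B]) (use b sub single 1 act1 in auto)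
        from fun_cong[OF this, of b2] show False using ne by simp
      next
        case 2
        have "(\<lambda>b. if b = b1 then 1 else 0) = (\<lambda>b. if b = b1 then 0 else (0::'d))"
          by (rule right_basis_coeff_unique[OF B]) (use b sub single[of b1] 2 act1 act0 in auto)
        from fun_cong[OF this, of b1] show False by simp
      qed
    qed
    ultimately show ?thesis by (metis card_1_singleton_iff is_singletonI' is_singleton_def One_nat_def)
  qed
  then show ?thesis
    unfolding right_dim_def using basis by (metis someI)
qed


section \<open>Irreducible modules with an invariant Hermitian form\<close>

locale hermitian_module =
  fixes G :: "('g, 'r) monoid_scheme" (structure)
    and \<rho> :: "'g \<Rightarrow> 'w::euclidean_space \<Rightarrow> 'w"
    and act :: "'w \<Rightarrow> 'd::{real_normed_div_algebra,euclidean_space} \<Rightarrow> 'w"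
    and h :: "'w \<Rightarrow> 'w \<Rightarrow> 'd"
  assumes group: "group G" and finite_carrier: "finite (carrier G)"
    and orthogonal: "orthogonal_module G \<rho>" and irreducible: "irreducible_module G \<rho>"
    and nontrivial: "\<not> trivial_module G \<rho>"
    and right_module: "right_module_over_End G \<rho> act"
    and form: "invariant_hermitian_form G \<rho> act h"
begin

lemma bilinear_act: "bilinear act"
  using right_module by (simp add: right_module_over_End_def)

lemmas act_simps = bilinear_ladd[OF bilinear_act] bilinear_radd[OF bilinear_act]
  bilinear_lmul[OF bilinear_act] bilinear_rmul[OF bilinear_act]
  bilinear_lzero[OF bilinear_act] bilinear_rzero[OF bilinear_act]

lemma act_1 [simp]: "act x 1 = x" and act_act: "act (act x a) b = act x (a * b)"
  using right_module by (simp_all add: right_module_over_End_def)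

lemma bilinear_h: "bilinear h"
  using form by (simp add: invariant_hermitian_form_def)

lemmas h_simps = bilinear_ladd[OF bilinear_h] bilinear_radd[OF bilinear_h]
  bilinear_lsub[OF bilinear_h] bilinear_rsub[OF bilinear_h]
  bilinear_lmul[OF bilinear_h] bilinear_rmul[OF bilinear_h]
  bilinear_lzero[OF bilinear_h] bilinear_rzero[OF bilinear_h]

lemma hconj_h: "hconj (h x y) = h y x"
  and h_act: "h (act x a) (act y b) = hconj a * h x y * b"
  and h_invariant: "g \<in> carrier G \<Longrightarrow> h (\<rho> g x) (\<rho> g y) = h x y"
  and real_part_h: "real_part (h x y) = x \<bullet> y"
proof -
  have "\<forall>x y. h y x = hconj (h x y)"
    using form unfolding invariant_hermitian_form_def by blast
  then show "hconj (h x y) = h y x" by metis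
qed (use form in \<open>unfold invariant_hermitian_form_def, blast+\<close>)

lemma h_act_right: "h x (act y b) = h x y * b"
  using h_act[of x 1 y b] by simp

lemma h_act_left: "h (act x a) y = hconj a * h x y"
  using h_act[of x a y 1] by simp

lemma h_self: "h x x = (x \<bullet> x) *\<^sub>R 1"
  using hconj_eq_self[of "h x x"] by (simp add: hconj_h real_part_h)

lemma inner_act_right: "x \<bullet> act y a = real_part (h x y * a)"
  by (simp only: real_part_h[symmetric] h_act_right)

lemma inner_act_hconj: "x \<bullet> act y (hconj a) = h x y \<bullet> a"
  by (simp add: inner_act_right real_part_mult_hconj)

lemma inner_act_left: "act x a \<bullet> y = a \<bullet> h x y"
  by (simp only: real_part_h[symmetric] h_act_left real_part_hconj_mult)

lemma act_adjoint: "act x a \<bullet> y = x \<bullet> act y (hconj a)"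
  unfolding inner_act_left inner_act_hconj by (rule inner_commute)

lemma act_inner_act: "act x a \<bullet> act x a = (x \<bullet> x) * (a \<bullet> a)"
  by (simp add: inner_act_left h_act_right h_self)

text \<open>Real Cauchy-Schwarz for \<open>act x (h x y)\<close> and \<open>y\<close>: their inner
  product is the square of \<open>norm (h x y)\<close>, and one factor cancels.\<close>

lemma norm_h_le: "norm (h x y) \<le> norm x * norm y"
proof (cases "h x y = 0")
  case False
  have "norm (act x (h x y)) = norm x * norm (h x y)"
    by (simp add: norm_eq_sqrt_inner act_inner_act real_sqrt_mult)
  moreover have "norm (h x y) * norm (h x y) = act x (h x y) \<bullet> y"
    by (simp add: inner_act_left flip: power2_norm_eq_inner power2_eq_square)
  ultimately have "norm (h x y) * norm (h x y) \<le> norm x * norm (h x y) * norm y"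
    by (metis norm_cauchy_schwarz)
  then show ?thesis using False by (simp add: mult_ac)
qed simp

text \<open>Writing the matrix as a value of \<open>Rep_herm0\<close> certifies that it is traceless
  Hermitian, so that \<open>Abs_herm0\<close> in \<open>defect\<close> is applied inside its domain.
  The unit norm makes the two diagonal entries opposite.\<close>

lemma gram_diff_eq_mk:
  assumes "norm x = 1"
  shows "gram h x - (1/2) *\<^sub>R mat 1
    = Rep_herm0 (mk_herm0 ((x $ 1 \<bullet> x $ 1 - x $ 2 \<bullet> x $ 2) / 2) (h (x $ 1) (x $ 2)))"
proof -
  have s: "x $ 1 \<bullet> x $ 1 + x $ 2 \<bullet> x $ 2 = 1"
    using assms by (simp add: norm_eq_1 inner_vec_def sum_2)
  then have "x $ 1 \<bullet> x $ 1 - 1 / 2 = (x $ 1 \<bullet> x $ 1 - x $ 2 \<bullet> x $ 2) / 2"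
    "x $ 2 \<bullet> x $ 2 - 1 / 2 = - ((x $ 1 \<bullet> x $ 1 - x $ 2 \<bullet> x $ 2) / 2)" by (simp_all add: field_simps)
  then have "(x $ 1 \<bullet> x $ 1) *\<^sub>R 1 - (1 / 2) *\<^sub>R (1::'d) = ((x $ 1 \<bullet> x $ 1 - x $ 2 \<bullet> x $ 2) / 2) *\<^sub>R 1"
    "(x $ 2 \<bullet> x $ 2) *\<^sub>R 1 - (1 / 2) *\<^sub>R (1::'d) = - (((x $ 1 \<bullet> x $ 1 - x $ 2 \<bullet> x $ 2) / 2) *\<^sub>R 1)"
    by (simp_all flip: scaleR_left_diff_distrib scaleR_minus_left)
  then show ?thesis
    by (simp add: gram_def mk_herm0.rep_eq vec_eq_iff forall_2 mat_def hconj_h of_real_def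
        h_self[of "x $ 1"] h_self[of "x $ 2"])
qed

lemma defect_eq_mk:
  assumes "norm x = 1"
  shows "defect h x = mk_herm0 ((x $ 1 \<bullet> x $ 1 - x $ 2 \<bullet> x $ 2) / 2) (h (x $ 1) (x $ 2))"
  by (simp add: defect_def gram_diff_eq_mk[OF assms] Rep_herm0_inverse)

lemma gram_eq_defect:
  assumes "norm x = 1"
  shows "gram h x = Rep_herm0 (defect h x) + (1/2) *\<^sub>R mat 1"
  unfolding defect_eq_mk[OF assms] gram_diff_eq_mk[OF assms, symmetric] by simp

lemma defect_uminus: "defect h (- x) = defect h x"
  by (simp add: defect_def gram_def h_simps bilinear_lneg[OF bilinear_h] bilinear_rneg[OF bilinear_h])

text \<open>With diagonal Gram entries a, b and off-diagonal entry c the left side is (a - b)^2 / 2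
  + 2 |c|^2; the bound |c|^2 \<le> a b turns this into (a + b)^2 / 2, and a + b = 1.\<close>

lemma inner_defect_le:
  assumes "norm x = 1"
  shows "defect h x \<bullet> defect h x \<le> 1 / 2"
proof -
  define a b c where "a = x $ 1 \<bullet> x $ 1" and "b = x $ 2 \<bullet> x $ 2" and "c = h (x $ 1) (x $ 2)"
  have ab: "a + b = 1"
    using assms by (simp add: norm_eq_1 inner_vec_def sum_2 a_def b_def)
  have "(norm c)\<^sup>2 \<le> (norm (x $ 1) * norm (x $ 2))\<^sup>2"
    unfolding c_def by (rule power_mono[OF norm_h_le]) simp
  then have "c \<bullet> c \<le> a * b"
    by (simp add: a_def b_def power_mult_distrib power2_norm_eq_inner)
  then have "defect h x \<bullet> defect h x \<le> 2 * ((a - b) / 2 * ((a - b) / 2) + a * b)"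
    by (simp add: defect_eq_mk[OF assms] inner_mk_herm0 a_def[symmetric] b_def[symmetric] c_def[symmetric])
  also have "\<dots> = (a + b)\<^sup>2 / 2" by (simp add: power2_eq_square field_simps)
  finally show ?thesis by (simp add: ab)
qed

section \<open>Group averages and Schur orthogonality\<close>

lemma \<rho>_mult: "g \<in> carrier G \<Longrightarrow> k \<in> carrier G \<Longrightarrow> \<rho> (g \<otimes> k) x = \<rho> g (\<rho> k x)"
  using orthogonal group_action.composition_rule[of G UNIV \<rho> x g k]
  by (simp add: orthogonal_module_def)

lemma orthogonal_\<rho>: "g \<in> carrier G \<Longrightarrow> orthogonal_transformation (\<rho> g)"
  using orthogonal by (simp add: orthogonal_module_def)

lemmas linear_\<rho> = orthogonal_transformation_linear[OF orthogonal_\<rho>]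

lemma inner_\<rho>: "g \<in> carrier G \<Longrightarrow> \<rho> g x \<bullet> \<rho> g y = x \<bullet> y"
  using orthogonal_\<rho> by (simp add: orthogonal_transformation_def)

lemma card_carrier_pos: "card (carrier G) > 0"
  using finite_carrier group.is_monoid[OF group] monoid.one_closed by (auto simp: card_gt_0_iff)

lemma sum_carrier_left:
  assumes "k \<in> carrier G"
  shows "(\<Sum>g\<in>carrier G. f (k \<otimes> g)) = (\<Sum>g\<in>carrier G. f g)"
proof (rule sum.reindex_bij_betw)
  show "bij_betw ((\<otimes>) k) (carrier G) (carrier G)"
    using group.inj_on_cmult[OF group assms] group.surj_const_mult[OF group assms]
    by (simp add: bij_betw_def)
qed

lemma sum_carrier_right:
  assumes "k \<in> carrier G"
  shows "(\<Sum>g\<in>carrier G. f (g \<otimes> k)) = (\<Sum>g\<in>carrier G. f g)"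
proof (rule sum.reindex_bij_betw)
  have "inj_on (\<lambda>g. g \<otimes> k) (carrier G)"
    using group.inj_on_multc[OF group assms] by simp
  moreover have "(\<lambda>g. g \<otimes> k) ` carrier G \<subseteq> carrier G"
    using assms group.is_monoid[OF group] by (auto simp: monoid.m_closed)
  ultimately show "bij_betw (\<lambda>g. g \<otimes> k) (carrier G) (carrier G)"
    using finite_carrier by (simp add: bij_betw_def endo_inj_surj)
qed

text \<open>The sum is fixed by the group. The fixed vectors form an invariant subspace, which is
  proper by nontriviality and hence zero by irreducibility.\<close>

lemma sum_\<rho>_eq_0: "(\<Sum>g\<in>carrier G. \<rho> g x) = 0"
proof -
  define U where "U = {x. \<forall>g\<in>carrier G. \<rho> g x = x}"
  have "subspace U"
    using linear_0[OF linear_\<rho>] linear_add[OF linear_\<rho>] linear_scale[OF linear_\<rho>]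
    by (auto simp: U_def intro!: subspaceI)
  moreover have "\<forall>g\<in>carrier G. \<rho> g ` U \<subseteq> U"
    by (auto simp: U_def)
  ultimately have "U = {0} \<or> U = UNIV"
    using irreducible unfolding irreducible_module_def by blast
  moreover have "U \<noteq> UNIV"
    using nontrivial by (auto simp: U_def trivial_module_def)
  moreover have "(\<Sum>g\<in>carrier G. \<rho> g x) \<in> U"
  proof -
    have "\<rho> k (\<Sum>g\<in>carrier G. \<rho> g x) = (\<Sum>g\<in>carrier G. \<rho> g x)" if k: "k \<in> carrier G" for k
    proof -
      have "\<rho> k (\<Sum>g\<in>carrier G. \<rho> g x) = (\<Sum>g\<in>carrier G. \<rho> (k \<otimes> g) x)"
        unfolding linear_sum[OF linear_\<rho>[OF k]] by (rule sum.cong) (simp_all add: \<rho>_mult k)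
      then show ?thesis using sum_carrier_left[OF k, of "\<lambda>g. \<rho> g x"] by simp
    qed
    then show ?thesis by (simp add: U_def)
  qed
  ultimately show ?thesis by auto
qed

text \<open>
  Schur orthogonality: the averaged operator is \<open>G\<close>-equivariant, hence right multiplication by
  some \<open>c\<close>, and \<open>c\<close> is found by taking traces after right multiplication by an arbitrary scalar.
\<close>

lemma sum_\<rho>_inner_\<rho>:
  "(\<Sum>g\<in>carrier G. (\<rho> g y \<bullet> b) *\<^sub>R \<rho> g x) = (card (carrier G) / DIM('w)) *\<^sub>R act b (h y x)"
proof -
  define T where "T = (\<lambda>b. \<Sum>g\<in>carrier G. (\<rho> g y \<bullet> b) *\<^sub>R \<rho> g x)"
  have "linear T"
    by (rule linearI) (simp_all add: T_def inner_add_right scaleR_left_distrib sum.distrib scaleR_sum_right)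
  moreover have "T (\<rho> k b) = \<rho> k (T b)" if k: "k \<in> carrier G" for k b
  proof -
    have "T (\<rho> k b) = (\<Sum>g\<in>carrier G. (\<rho> (k \<otimes> g) y \<bullet> \<rho> k b) *\<^sub>R \<rho> (k \<otimes> g) x)"
      using sum_carrier_left[OF k, of "\<lambda>g. (\<rho> g y \<bullet> \<rho> k b) *\<^sub>R \<rho> g x"] by (simp add: T_def)
    also have "\<dots> = (\<Sum>g\<in>carrier G. (\<rho> g y \<bullet> b) *\<^sub>R \<rho> k (\<rho> g x))"
      by (rule sum.cong) (simp_all add: \<rho>_mult k inner_\<rho>)
    also have "\<dots> = \<rho> k (T b)"
      by (simp add: T_def linear_sum[OF linear_\<rho>[OF k]] linear_scale[OF linear_\<rho>[OF k]])
    finally show ?thesis .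
  qed
  ultimately have "T \<in> End_G G \<rho>" by (simp add: End_G_def)
  then obtain c where c: "T = (\<lambda>x. act x c)"
    using right_module unfolding right_module_over_End_def bij_betw_def by blast
  have "real DIM('w) *\<^sub>R c = real (card (carrier G)) *\<^sub>R h y x"
  proof (rule eq_by_real_part)
    fix e
    \<comment> \<open>The trace of \<open>T\<close> followed by right multiplication by
      \<open>e\<close> is computed twice: here from \<open>T = (\<lambda>x. act x c)\<close>, where
      every basis vector contributes the same real part, and then from the definition of
      \<open>T\<close> by Parseval.\<close>
    have "(\<Sum>b\<in>Basis. b \<bullet> act (T b) e) = (\<Sum>b::'w\<in>Basis. real_part (c * e))"
      unfolding c act_act inner_act_right by (rule sum.cong) (simp_all add: h_self)
    moreover have "(\<Sum>b\<in>Basis. b \<bullet> act (T b) e) = real (card (carrier G)) * real_part (h y x * e)"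
    proof -
      have lin: "linear (\<lambda>v. act v e)"
        using bilinear_act by (simp add: bilinear_def)
      have "(\<Sum>b\<in>Basis. b \<bullet> act (T b) e)
          = (\<Sum>b\<in>Basis. \<Sum>g\<in>carrier G. (\<rho> g y \<bullet> b) * (act (\<rho> g x) e \<bullet> b))"
        unfolding T_def linear_sum[OF lin] linear_scale[OF lin] inner_sum_right inner_scaleR_right
        by (simp only: inner_commute)
      also have "\<dots> = (\<Sum>g\<in>carrier G. \<rho> g y \<bullet> act (\<rho> g x) e)"
        by (subst sum.swap) (simp only: euclidean_inner[symmetric])
      also have "\<dots> = (\<Sum>g\<in>carrier G. real_part (h y x * e))"
        unfolding inner_act_right by (rule sum.cong) (simp_all add: h_invariant)
      finally show ?thesis by simp
    qed
    ultimately show "real_part (real DIM('w) *\<^sub>R c * e) = real_part (real (card (carrier G)) *\<^sub>R h y x * e)"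
      by (simp add: real_part_scaleR)
  qed
  then have "inverse (real DIM('w)) *\<^sub>R real DIM('w) *\<^sub>R c
      = inverse (real DIM('w)) *\<^sub>R real (card (carrier G)) *\<^sub>R h y x"
    by (simp only:)
  then have "c = (card (carrier G) / DIM('w)) *\<^sub>R h y x"
    by (simp add: divide_inverse mult.commute)
  then have "T b = (card (carrier G) / DIM('w)) *\<^sub>R act b (h y x)"
    unfolding c by (simp add: act_simps)
  then show ?thesis by (simp add: T_def)
qed

lemma sum_inner_\<rho>_inner_\<rho>:
  "(\<Sum>g\<in>carrier G. (\<rho> g x \<bullet> a) * (\<rho> g y \<bullet> b)) = card (carrier G) / DIM('w) * (a \<bullet> act b (h y x))"
proof -
  have "(\<Sum>g\<in>carrier G. (\<rho> g x \<bullet> a) * (\<rho> g y \<bullet> b)) = a \<bullet> (\<Sum>g\<in>carrier G. (\<rho> g y \<bullet> b) *\<^sub>R \<rho> g x)"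
    by (simp add: inner_sum_right inner_commute mult.commute)
  then show ?thesis by (simp add: sum_\<rho>_inner_\<rho>)
qed

section \<open>Orbits in the double module and their low moments\<close>

abbreviation "D \<equiv> diag_action \<rho>"

lemma orthogonal_diag:
  assumes g: "g \<in> carrier G"
  shows "orthogonal_transformation (D g)"
proof -
  have "linear (D g)"
    by (rule linearI)
      (simp_all add: diag_action_def vec_eq_iff linear_add[OF linear_\<rho>[OF g]] linear_scale[OF linear_\<rho>[OF g]])
  then show ?thesis
    by (simp add: orthogonal_transformation_def diag_action_def inner_vec_def inner_\<rho>[OF g])
qed

lemma diag_mult: "g \<in> carrier G \<Longrightarrow> k \<in> carrier G \<Longrightarrow> D (g \<otimes> k) x = D g (D k x)"
  by (simp add: diag_action_def \<rho>_mult)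

lemma gram_diag: "g \<in> carrier G \<Longrightarrow> gram h (D g x) = gram h x"
  by (simp add: gram_def diag_action_def h_invariant)

lemma orbit_diag: "orbit G D x = (\<lambda>g. D g x) ` carrier G"
  by (auto simp: orbit_def)

lemma finite_orbit: "finite (orbit G D x)" and orbit_nonempty: "orbit G D x \<noteq> {}"
  using finite_carrier card_carrier_pos by (auto simp: orbit_diag)

lemma set_pmf_orbit: "set_pmf (pmf_of_set (orbit G D x)) = orbit G D x"
  by (rule set_pmf_of_set[OF orbit_nonempty finite_orbit])

lemma norm_orbit: "y \<in> orbit G D x \<Longrightarrow> norm y = norm x"
  using orthogonal_transformation_norm[OF orthogonal_diag] by (auto simp: orbit_diag)

lemma gram_orbit: "y \<in> orbit G D x \<Longrightarrow> gram h y = gram h x"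
  by (auto simp: orbit_diag gram_diag)

lemma orbit_uminus: "orbit G D (- x) = uminus ` orbit G D x"
proof -
  have "D g (- x) = - D g x" if "g \<in> carrier G" for g
    using linear_neg[OF orthogonal_transformation_linear[OF orthogonal_diag[OF that]]] .
  then show ?thesis by (auto simp: orbit_diag)
qed

text \<open>Every group element permutes the orbit, so the uniform measure on it is invariant.
  Averaging inside the expectation avoids counting stabilizers.\<close>

lemma expectation_orbit_average:
  fixes f :: "'w^2 \<Rightarrow> real"
  shows "measure_pmf.expectation (pmf_of_set (orbit G D x)) f
    = measure_pmf.expectation (pmf_of_set (orbit G D x)) (\<lambda>y. (\<Sum>g\<in>carrier G. f (D g y)) / card (carrier G))"
proof -
  let ?O = "orbit G D x"
  have E: "measure_pmf.expectation (pmf_of_set ?O) f = sum f ?O / card ?O" for f :: "'w^2 \<Rightarrow> real"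
    by (rule integral_pmf_of_set[OF orbit_nonempty finite_orbit])
  have "(\<Sum>y\<in>?O. f (D g y)) = sum f ?O" if g: "g \<in> carrier G" for g
  proof (rule sum.reindex_bij_betw)
    have "inj_on (D g) ?O"
      using orthogonal_transformation_inj[OF orthogonal_diag[OF g]] by (rule inj_on_subset) simp
    moreover have "D g ` ?O \<subseteq> ?O"
      using g monoid.m_closed[OF group.is_monoid[OF group]] by (auto simp: orbit_diag diag_mult[symmetric])
    ultimately show "bij_betw (D g) ?O ?O"
      by (simp add: bij_betw_def endo_inj_surj finite_orbit)
  qed
  then have "(\<Sum>g\<in>carrier G. \<Sum>y\<in>?O. f (D g y)) = card (carrier G) * sum f ?O" by simp
  then have "(\<Sum>y\<in>?O. \<Sum>g\<in>carrier G. f (D g y)) = card (carrier G) * sum f ?O" by (subst sum.swap)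
  then show ?thesis
    using card_carrier_pos by (simp add: E sum_divide_distrib[symmetric])
qed

lemma expectation_orbit_const:
  fixes f :: "'w^2 \<Rightarrow> real" and c :: real
  assumes "\<And>y. y \<in> orbit G D x \<Longrightarrow> (\<Sum>g\<in>carrier G. f (D g y)) = card (carrier G) * c"
  shows "measure_pmf.expectation (pmf_of_set (orbit G D x)) f = c"
proof -
  have "measure_pmf.expectation (pmf_of_set (orbit G D x)) f
      = measure_pmf.expectation (pmf_of_set (orbit G D x)) (\<lambda>y. c)"
    unfolding expectation_orbit_average[of x f]
    by (rule integral_cong_AE) (use card_carrier_pos assms in \<open>auto simp: AE_measure_pmf_iff set_pmf_orbit\<close>)
  then show ?thesis by simp
qed

lemma expectation_orbit_inner: "measure_pmf.expectation (pmf_of_set (orbit G D x)) (\<lambda>y. y \<bullet> a) = 0"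
proof (rule expectation_orbit_const)
  fix y
  have "(\<Sum>g\<in>carrier G. D g y \<bullet> a) = (\<Sum>i\<in>UNIV. (\<Sum>g\<in>carrier G. \<rho> g (y $ i)) \<bullet> a $ i)"
    unfolding inner_vec_def diag_action_def inner_sum_left by (subst sum.swap) simp
  then show "(\<Sum>g\<in>carrier G. D g y \<bullet> a) = real (card (carrier G)) * 0" by (simp add: sum_\<rho>_eq_0)
qed

lemma expectation_orbit_inner_inner:
  "measure_pmf.expectation (pmf_of_set (orbit G D x)) (\<lambda>y. (y \<bullet> a) * (y \<bullet> b))
    = (\<Sum>i\<in>UNIV. \<Sum>j\<in>UNIV. a $ i \<bullet> act (b $ j) (gram h x $ j $ i)) / DIM('w)"
proof (rule expectation_orbit_const)
  fix y assume "y \<in> orbit G D x"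
  then have y: "h (y $ j) (y $ i) = gram h x $ j $ i" for i j
    using gram_orbit[of y x] by (simp add: gram_def vec_eq_iff)
  have "(\<Sum>g\<in>carrier G. (D g y \<bullet> a) * (D g y \<bullet> b))
      = (\<Sum>i\<in>UNIV. \<Sum>j\<in>UNIV. \<Sum>g\<in>carrier G. (\<rho> g (y $ i) \<bullet> a $ i) * (\<rho> g (y $ j) \<bullet> b $ j))"
    unfolding inner_vec_def diag_action_def sum_product
    by (subst sum.swap, rule sum.cong[OF refl], subst sum.swap) simp
  also have "\<dots> = card (carrier G) / DIM('w) * (\<Sum>i\<in>UNIV. \<Sum>j\<in>UNIV. a $ i \<bullet> act (b $ j) (gram h x $ j $ i))"
    by (simp add: sum_inner_\<rho>_inner_\<rho> y sum_distrib_left)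
  finally show "(\<Sum>g\<in>carrier G. (D g y \<bullet> a) * (D g y \<bullet> b)) = card (carrier G)
      * ((\<Sum>i\<in>UNIV. \<Sum>j\<in>UNIV. a $ i \<bullet> act (b $ j) (gram h x $ j $ i)) / DIM('w))"
    by simp
qed

text \<open>The summand I/2 of the Gram matrix contributes exactly the second moment of the sphere,
  because \<open>DIM('w^2)\<close> is twice \<open>DIM('w)\<close>. What remains is linear in the
  defect.\<close>

lemma expectation_orbit_inner_inner_defect:
  assumes "norm x = 1"
  shows "measure_pmf.expectation (pmf_of_set (orbit G D x)) (\<lambda>y. (y \<bullet> a) * (y \<bullet> b))
    = (a \<bullet> b) / DIM('w^2)
      + (\<Sum>i\<in>UNIV. \<Sum>j\<in>UNIV. a $ i \<bullet> act (b $ j) (Rep_herm0 (defect h x) $ j $ i)) / DIM('w)"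
  unfolding expectation_orbit_inner_inner gram_eq_defect[OF assms]
  by (simp add: sum_2 mat_def act_simps inner_add_right inner_vec_def add_divide_distrib)

lemma spherical_design_zero_defect:
  assumes x: "norm x = 1" and Z: "defect h x = 0"
  shows "spherical_design 2 (orbit G D x)"
  unfolding spherical_design_def weighted_design_2_iff set_pmf_orbit
  using x finite_orbit orbit_nonempty norm_orbit[of _ x]
  by (auto simp: expectation_orbit_inner expectation_orbit_inner_inner_defect Z zero_herm0.rep_eq act_simps)

end


section \<open>Moments of the defect over the sphere\<close>

lemma mk_herm0_scaleR: "mk_herm0 (r * t) (r *\<^sub>R b) = r *\<^sub>R mk_herm0 t b"
proof -
  have "Rep_herm0 (mk_herm0 (r * t) (r *\<^sub>R b)) = Rep_herm0 (r *\<^sub>R mk_herm0 t b)"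
    by (simp add: mk_herm0.rep_eq scaleR_herm0.rep_eq vec_eq_iff forall_2 hconj_scaleR of_real_def)
  then show ?thesis by (simp add: Rep_herm0_inject)
qed

lemma linear_Rep_herm0: "linear Rep_herm0"
  by (rule linearI) (simp_all add: plus_herm0.rep_eq scaleR_herm0.rep_eq)

lemma sum_Basis_vec_2:
  fixes f :: "'w::euclidean_space^2 \<Rightarrow> real"
  shows "(\<Sum>b\<in>Basis. f b) = (\<Sum>u\<in>Basis. f (axis 1 u)) + (\<Sum>u\<in>Basis. f (axis 2 u))"
proof -
  have B: "(Basis :: ('w^2) set) = axis 1 ` Basis \<union> axis 2 ` Basis"
    unfolding Basis_vec_def UNIV_2 by auto
  have "inj_on (axis i :: 'w \<Rightarrow> 'w^2) Basis" for i
    by (auto simp: inj_on_def axis_eq_axis)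
  moreover have "axis 1 ` Basis \<inter> axis 2 ` Basis = ({} :: ('w^2) set)"
    by (auto simp: axis_eq_axis)
  ultimately show ?thesis
    unfolding B by (subst sum.union_disjoint) (auto simp: sum.reindex)
qed

context hermitian_module begin

text \<open>The defect extended to all of V as a homogeneous quadratic map, so that continuity and
  integrals make sense; \<open>defect\<close> itself is specified only on the unit sphere.\<close>

definition quad_defect :: "'w^2 \<Rightarrow> 'd herm0"
  where "quad_defect x = mk_herm0 ((x $ 1 \<bullet> x $ 1 - x $ 2 \<bullet> x $ 2) / 2) (h (x $ 1) (x $ 2))"

lemma quad_defect_eq: "norm x = 1 \<Longrightarrow> quad_defect x = defect h x"
  by (simp add: quad_defect_def defect_eq_mk)

text \<open>Right multiplication of the row vector (x1, x2) by the matrix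
  \<open>mk_herm0 t c\<close>. Its square is the scalar t^2 + |c|^2, half the squared norm of that
  matrix.\<close>

definition defect_operator :: "real \<Rightarrow> 'd \<Rightarrow> 'w^2 \<Rightarrow> 'w^2"
  where "defect_operator t c x =
    (\<chi> i. if i = 1 then t *\<^sub>R x $ 1 + act (x $ 2) (hconj c) else act (x $ 1) c - t *\<^sub>R x $ 2)"

lemma linear_defect_operator: "linear (defect_operator t c)"
  by (rule linearI) (simp_all add: defect_operator_def vec_eq_iff act_simps algebra_simps)

lemma defect_operator_adjoint: "defect_operator t c x \<bullet> y = x \<bullet> defect_operator t c y"
  by (simp add: defect_operator_def inner_vec_def sum_2 inner_add_left inner_add_right
      inner_diff_left inner_diff_right act_adjoint)

lemma inner_quad_defect: "mk_herm0 t c \<bullet> quad_defect x = x \<bullet> defect_operator t c x"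
proof -
  have "x $ 2 \<bullet> act (x $ 1) c = c \<bullet> h (x $ 1) (x $ 2)"
    by (subst inner_commute) (rule inner_act_left)
  moreover have "x $ 1 \<bullet> act (x $ 2) (hconj c) = c \<bullet> h (x $ 1) (x $ 2)"
    by (subst inner_act_hconj) (rule inner_commute)
  ultimately show ?thesis
    by (simp add: quad_defect_def defect_operator_def inner_mk_herm0 inner_vec_def sum_2
        inner_add_right inner_diff_right field_simps)
qed

lemma continuous_on_quad_defect: "continuous_on S (\<lambda>x. B \<bullet> quad_defect x)"
proof -
  obtain t c where "B = mk_herm0 t c" using mk_herm0_surj by blast
  then show ?thesis
    by (simp add: inner_quad_defect) (intro continuous_intros linear_continuous_on
      linear_defect_operator[unfolded linear_conv_bounded_linear])
qed

text \<open>The operator behind the quadratic form is traceless: its diagonal blocks t and -t act on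
  summands of equal dimension.\<close>

lemma sphere_quad_defect: "(\<integral>x. B \<bullet> quad_defect x \<partial>sphere_measure) = 0"
proof -
  obtain t c where "B = mk_herm0 t c" using mk_herm0_surj by blast
  then show ?thesis
    by (simp add: inner_quad_defect sphere_quadratic_form[OF linear_defect_operator] sum_Basis_vec_2)
      (simp add: defect_operator_def inner_vec_def sum_2 axis_def act_simps sum_negf)
qed

lemma sphere_quad_defect_square:
  "(\<integral>x. (B \<bullet> quad_defect x)\<^sup>2 \<partial>sphere_measure) = (B \<bullet> B) / (2 * (real DIM('w) + 1))"
proof -
  obtain t c where B: "B = mk_herm0 t c" using mk_herm0_surj by blast
  let ?M = "defect_operator t c"
  have "(\<Sum>b\<in>Basis. b \<bullet> ?M b) = 0"
    by (simp add: sum_Basis_vec_2) (simp add: defect_operator_def inner_vec_def sum_2 axis_def act_simps sum_negf)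
  \<comment> \<open>Each of the \<open>2 * DIM('w)\<close> basis vectors is stretched by the same
    factor: \<open>?M b \<bullet> ?M b = t * t + c \<bullet> c\<close>.\<close>
  moreover have "(\<Sum>b\<in>Basis. ?M b \<bullet> ?M b) = 2 * real DIM('w) * (t * t + c \<bullet> c)"
    by (simp add: sum_Basis_vec_2)
      (simp add: defect_operator_def inner_vec_def sum_2 axis_def act_simps act_inner_act inner_hconj_hconj algebra_simps)
  ultimately have "(\<integral>x. (B \<bullet> quad_defect x)\<^sup>2 \<partial>sphere_measure)
      = 2 * (2 * real DIM('w) * (t * t + c \<bullet> c)) / (real DIM('w^2) * (real DIM('w^2) + 2))"
    unfolding B inner_quad_defect
    by (simp add: sphere_quadratic_form_square linear_defect_operator defect_operator_adjoint)
  \<comment> \<open>Here \<open>DIM('w^2) = 2 * DIM('w)\<close> and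
    \<open>B \<bullet> B = 2 * (t * t + c \<bullet> c)\<close>; the quotient collapses to the
    constant of the defect equations.\<close>
  also have "\<dots> = (B \<bullet> B) / (2 * (real DIM('w) + 1))"
    by (simp add: B inner_mk_herm0 divide_simps) (simp add: algebra_simps)
  finally show ?thesis .
qed

lemma sphere_quad_defect_mult:
  "(\<integral>x. (B \<bullet> quad_defect x) * (C \<bullet> quad_defect x) \<partial>sphere_measure) = (B \<bullet> C) / (2 * (real DIM('w) + 1))"
proof -
  have i: "integrable sphere_measure (\<lambda>x. (B \<bullet> quad_defect x)\<^sup>2)" for B
    by (intro integrable_sphere_measure continuous_intros continuous_on_quad_defect)
  have eq: "(B \<bullet> quad_defect x) * (C \<bullet> quad_defect x)
      = (((B + C) \<bullet> quad_defect x)\<^sup>2 - ((B - C) \<bullet> quad_defect x)\<^sup>2) / 4" for x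
    by (simp add: inner_add_left inner_diff_left power2_eq_square algebra_simps)
  have "(\<integral>x. (B \<bullet> quad_defect x) * (C \<bullet> quad_defect x) \<partial>sphere_measure)
      = (((B + C) \<bullet> (B + C)) / (2 * (real DIM('w) + 1)) - ((B - C) \<bullet> (B - C)) / (2 * (real DIM('w) + 1))) / 4"
    unfolding eq by (simp add: i sphere_quad_defect_square)
  also have "\<dots> = (B \<bullet> C) / (2 * (real DIM('w) + 1))"
  proof -
    have "(B + C) \<bullet> (B + C) - (B - C) \<bullet> (B - C) = 4 * (B \<bullet> C)"
      by (simp add: inner_add_left inner_diff_left inner_add_right inner_diff_right inner_commute)
    then have "((B + C) \<bullet> (B + C) / N - (B - C) \<bullet> (B - C) / N) / 4 = (B \<bullet> C) / N" for N :: real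
      by (simp flip: diff_divide_distrib)
    then show ?thesis .
  qed
  finally show ?thesis .
qed

section \<open>Moments of weighted orbit measures\<close>

lemma expectation_orbit_measure:
  fixes f :: "'w^2 \<Rightarrow> real"
  assumes "weighted_collection J w y"
  shows "measure_pmf.expectation (orbit_measure G \<rho> J w y) f
    = (\<Sum>j\<in>J. w j * measure_pmf.expectation (pmf_of_set (orbit G D (y j))) f)"
  unfolding orbit_measure_def
  by (rule expectation_convex_comb)
    (use weighted_collectionD[OF assms] in \<open>auto simp: set_pmf_orbit finite_orbit\<close>)

lemma set_pmf_orbit_measure:
  assumes "weighted_collection J w y"
  shows "set_pmf (orbit_measure G \<rho> J w y) = (\<Union>j\<in>J. orbit G D (y j))"
  unfolding orbit_measure_def
  by (subst set_pmf_convex_comb) (use weighted_collectionD[OF assms] in \<open>auto simp: set_pmf_orbit\<close>)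

text \<open>Each orbit misses the spherical second moment by a linear functional \<open>L\<close> of
  its defect, and the weighted mean of the defects vanishes.\<close>

lemma orbit_measure_second_moment:
  assumes coll: "weighted_collection J w y" and eqs: "defect_equations h J w y"
  shows "measure_pmf.expectation (orbit_measure G \<rho> J w y) (\<lambda>x. (x \<bullet> a) * (x \<bullet> b)) = (a \<bullet> b) / DIM('w^2)"
proof -
  note coll' = weighted_collectionD[OF coll]
  define L where "L = (\<lambda>Z::'d herm0. \<Sum>i\<in>UNIV. \<Sum>j\<in>UNIV. a $ i \<bullet> act (b $ j) (Rep_herm0 Z $ j $ i))"
  have "linear L"
    by (rule linearI) (simp_all add: L_def plus_herm0.rep_eq scaleR_herm0.rep_eq act_simps
        inner_add_right sum.distrib sum_distrib_left)
  then have L: "(\<Sum>j\<in>J. w j * L (defect h (y j))) = 0"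
    using eqs linear_sum[of L "\<lambda>j. w j *\<^sub>R defect h (y j)" J]
    by (simp add: defect_equations_def linear_scale linear_0)
  have "measure_pmf.expectation (orbit_measure G \<rho> J w y) (\<lambda>x. (x \<bullet> a) * (x \<bullet> b))
      = (\<Sum>j\<in>J. w j * ((a \<bullet> b) / DIM('w^2)) + w j * L (defect h (y j)) / DIM('w))"
    unfolding expectation_orbit_measure[OF coll]
    by (rule sum.cong) (simp_all add: expectation_orbit_inner_inner_defect coll' L_def distrib_left)
  also have "\<dots> = (a \<bullet> b) / DIM('w^2)"
    using L coll' by (simp add: sum.distrib flip: sum_distrib_right sum_divide_distrib)
  finally show ?thesis .
qed

lemma orbit_measure_quartic:
  assumes coll: "weighted_collection J w y" and eqs: "defect_equations h J w y"
    and quartics: "quartics_from_gram G \<rho> h" and p: "hom_poly 4 p"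
  shows "measure_pmf.expectation (orbit_measure G \<rho> J w y) p = integral\<^sup>L sphere_measure p"
proof -
  note coll' = weighted_collectionD[OF coll]
  let ?n = "real (card (carrier G))"
  \<comment> \<open>The average over the group has the same integral over the sphere as
    \<open>p\<close>, and its value at a point is the mean of \<open>p\<close> over the orbit of
    that point. Being invariant, it is a quadratic form in the Gram matrix.\<close>
  define P where "P = (\<lambda>x. inverse ?n * (\<Sum>g\<in>carrier G. p (D g x)))"
  have n: "?n \<noteq> 0" using card_carrier_pos by simp
  have pg: "hom_poly 4 (\<lambda>x. p (D g x))" if "g \<in> carrier G" for g
    using orthogonal_transformation_linear[OF orthogonal_diag[OF that]] p
    by (rule hom_poly_compose_linear)
  then have P: "hom_poly 4 P"
    unfolding P_def by (intro hom_poly_cmult hom_poly_sum)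
  have inv: "P (D k x) = P x" if k: "k \<in> carrier G" for k x
  proof -
    have "(\<Sum>g\<in>carrier G. p (D g (D k x))) = (\<Sum>g\<in>carrier G. p (D (g \<otimes> k) x))"
      by (rule sum.cong) (simp_all add: diag_mult k)
    then show ?thesis using sum_carrier_right[OF k, of "\<lambda>g. p (D g x)"] by (simp add: P_def)
  qed
  obtain Q :: "'d^2^2 \<Rightarrow> real" where Q: "hom_poly 2 Q" and PQ: "\<And>x. P x = Q (gram h x)"
    using quartics P inv unfolding quartics_from_gram_def by blast
  obtain \<alpha> where \<alpha>: "\<And>A. Q A = (\<Sum>b\<in>Basis. (A \<bullet> b) * (A \<bullet> \<alpha> b))"
    using hom_poly_2_imp_sum[OF Q] by blast
  \<comment> \<open>Since the Gram matrix is the defect plus I/2, its inner product with a matrix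
    \<open>A\<close> is affine in the defect: \<open>\<beta> A\<close> is the component of
    \<open>A\<close> visible to traceless Hermitian matrices, \<open>\<kappa> A\<close> the constant
    term.\<close>
  define \<beta> :: "'d^2^2 \<Rightarrow> 'd herm0" where "\<beta> = adjoint Rep_herm0"
  define \<kappa> :: "'d^2^2 \<Rightarrow> real" where "\<kappa> = (\<lambda>A. ((1/2) *\<^sub>R mat 1) \<bullet> A)"
  have P_sphere: "P x = (\<Sum>b\<in>Basis. (\<beta> b \<bullet> defect h x + \<kappa> b) * (\<beta> (\<alpha> b) \<bullet> defect h x + \<kappa> (\<alpha> b)))"
    if "norm x = 1" for x
    unfolding PQ \<alpha> gram_eq_defect[OF that] inner_add_left
    by (simp add: \<kappa>_def \<beta>_def adjoint_works[OF linear_Rep_herm0] inner_commute[of "adjoint _ _"])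
  have expand: "(u + k) * (v + l) = u * v + l * u + k * v + k * l" for u k v l :: real
    by (simp add: algebra_simps)
  let ?c = "1 / (2 * (real DIM('w) + 1))"
  let ?R = "\<Sum>b\<in>Basis. ?c * (\<beta> b \<bullet> \<beta> (\<alpha> b)) + \<kappa> b * \<kappa> (\<alpha> b)"
  have first: "(\<Sum>j\<in>J. w j * (B \<bullet> defect h (y j))) = 0" for B
  proof -
    have "(\<Sum>j\<in>J. w j * (B \<bullet> defect h (y j))) = B \<bullet> (\<Sum>j\<in>J. w j *\<^sub>R defect h (y j))"
      by (simp add: inner_sum_right)
    then show ?thesis using eqs by (simp add: defect_equations_def)
  qed
  have second: "(\<Sum>j\<in>J. w j * ((B \<bullet> defect h (y j)) * (C \<bullet> defect h (y j)))) = ?c * (B \<bullet> C)" for B C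
    using eqs unfolding defect_equations_def second_moment_identity_def by (simp add: mult.assoc)
  have "measure_pmf.expectation (pmf_of_set (orbit G D x)) p = P x" for x
  proof (rule expectation_orbit_const)
    fix z assume "z \<in> orbit G D x"
    then have "P z = P x" using inv by (auto simp: orbit_diag)
    then show "(\<Sum>g\<in>carrier G. p (D g z)) = ?n * P x"
      using n by (auto simp: P_def)
  qed
  then have "measure_pmf.expectation (orbit_measure G \<rho> J w y) p = (\<Sum>j\<in>J. w j * P (y j))"
    by (simp add: expectation_orbit_measure[OF coll])
  also have "\<dots> = (\<Sum>j\<in>J. \<Sum>b\<in>Basis. w j * ((\<beta> b \<bullet> defect h (y j)) * (\<beta> (\<alpha> b) \<bullet> defect h (y j)))
      + \<kappa> (\<alpha> b) * (w j * (\<beta> b \<bullet> defect h (y j))) + \<kappa> b * (w j * (\<beta> (\<alpha> b) \<bullet> defect h (y j)))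
      + w j * (\<kappa> b * \<kappa> (\<alpha> b)))"
    by (rule sum.cong[OF refl]) (simp add: P_sphere coll' expand sum_distrib_left algebra_simps)
  also have "\<dots> = ?R"
    by (subst sum.swap)
      (simp only: sum.distrib sum_distrib_left[symmetric] sum_distrib_right[symmetric]
        first second coll' mult_zero_right add_0_right mult_1)
  finally have left: "measure_pmf.expectation (orbit_measure G \<rho> J w y) p = ?R" .
  have "integral\<^sup>L sphere_measure P = inverse ?n * (\<Sum>g\<in>carrier G. \<integral>x. p (D g x) \<partial>sphere_measure)"
    unfolding P_def
    by (subst integral_mult_right_zero, subst Bochner_Integration.integral_sum)
      (auto intro!: integrable_sphere_measure continuous_on_hom_poly[OF pg])
  also have "\<dots> = integral\<^sup>L sphere_measure p"
    using n by (simp add: integral_sphere_measure_orthogonal[OF orthogonal_diag]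
        borel_measurable_continuous_onI[OF continuous_on_hom_poly[OF p]])
  finally have "integral\<^sup>L sphere_measure p = integral\<^sup>L sphere_measure P" ..
  \<comment> \<open>Almost everywhere \<open>defect\<close> may be replaced by
    \<open>quad_defect\<close>, whose continuity permits integration term by term.\<close>
  also have "\<dots> = (\<integral>x. (\<Sum>b\<in>Basis. (\<beta> b \<bullet> quad_defect x + \<kappa> b) * (\<beta> (\<alpha> b) \<bullet> quad_defect x + \<kappa> (\<alpha> b))) \<partial>sphere_measure)"
  proof (rule integral_cong_AE)
    show "AE x in sphere_measure. P x
        = (\<Sum>b\<in>Basis. (\<beta> b \<bullet> quad_defect x + \<kappa> b) * (\<beta> (\<alpha> b) \<bullet> quad_defect x + \<kappa> (\<alpha> b)))"
      using AE_sphere_measure by eventually_elim (simp add: P_sphere quad_defect_eq)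
    show "P \<in> borel_measurable sphere_measure"
      by (intro borel_measurable_integrable integrable_sphere_measure continuous_on_hom_poly[OF P])
    show "(\<lambda>x. \<Sum>b\<in>Basis. (\<beta> b \<bullet> quad_defect x + \<kappa> b) * (\<beta> (\<alpha> b) \<bullet> quad_defect x + \<kappa> (\<alpha> b)))
        \<in> borel_measurable sphere_measure"
      by (intro borel_measurable_integrable integrable_sphere_measure continuous_intros continuous_on_quad_defect)
  qed
  also have "\<dots> = ?R"
  proof -
    interpret S: prob_space "sphere_measure :: ('w^2) measure" by (rule prob_space_sphere_measure)
    have i1: "integrable sphere_measure (\<lambda>x. B \<bullet> quad_defect x)"
      and i2: "integrable sphere_measure (\<lambda>x. (B \<bullet> quad_defect x) * (C \<bullet> quad_defect x))" for B C
      by (intro integrable_sphere_measure continuous_intros continuous_on_quad_defect)+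
    have space: "measure sphere_measure (space (sphere_measure :: ('w^2) measure)) = 1"
      by (rule S.prob_space)
    show ?thesis
      unfolding expand
      by (simp add: i1 i2 sphere_quad_defect sphere_quad_defect_mult space)
  qed
  finally show ?thesis using left by simp
qed

lemma weighted_design_4:
  assumes coll: "weighted_collection J w y" and eqs: "defect_equations h J w y"
    and quartics: "quartics_from_gram G \<rho> h"
  shows "weighted_design 4 (antipodalization (orbit_measure G \<rho> J w y))"
proof -
  note coll' = weighted_collectionD[OF coll]
  let ?\<mu> = "orbit_measure G \<rho> J w y"
  have fin: "finite (set_pmf ?\<mu>)" and sub: "\<And>x. x \<in> set_pmf ?\<mu> \<Longrightarrow> norm x = 1"
    using coll' by (auto simp: set_pmf_orbit_measure[OF coll] finite_orbit norm_orbit)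
  have "measure_pmf.expectation (antipodalization ?\<mu>) p = integral\<^sup>L sphere_measure p"
    if k: "k \<le> 4" and p: "hom_poly k p" for k p
  proof -
    have cont: "continuous_on UNIV p" using p by (rule continuous_on_hom_poly)
    have E: "measure_pmf.expectation (antipodalization ?\<mu>) p
        = (measure_pmf.expectation ?\<mu> p + (- 1) ^ k * measure_pmf.expectation ?\<mu> p) / 2"
      by (simp add: expectation_antipodalization[OF fin] hom_poly_minus[OF p])
    from k have "k = 0 \<or> k = 1 \<or> k = 2 \<or> k = 3 \<or> k = 4" by linarith
    then consider "odd k" | "k = 0" | "k = 2" | "k = 4" by fastforce
    then show ?thesis
    proof cases
      case 1
      then show ?thesis
        using E integral_sphere_measure_odd[OF cont] hom_poly_minus[OF p] by simp
    next
      case 2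
      interpret S: prob_space "sphere_measure :: ('w^2) measure" by (rule prob_space_sphere_measure)
      from 2 p obtain c where "p = (\<lambda>x. c)" using hom_poly_0_imp_const by blast
      then show ?thesis using S.prob_space by simp
    next
      case 3
      obtain a where p: "p = (\<lambda>x. \<Sum>b\<in>Basis. (x \<bullet> b) * (x \<bullet> a b))"
        using hom_poly_2_imp_sum p 3 by blast
      have "measure_pmf.expectation ?\<mu> p = (\<Sum>b\<in>Basis. measure_pmf.expectation ?\<mu> (\<lambda>x. (x \<bullet> b) * (x \<bullet> a b)))"
        unfolding p by (rule Bochner_Integration.integral_sum) (rule integrable_measure_pmf_finite[OF fin])
      also have "\<dots> = (\<Sum>b\<in>Basis. \<integral>x. (x \<bullet> b) * (x \<bullet> a b) \<partial>sphere_measure)"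
        by (simp only: sphere_moment_2 orbit_measure_second_moment[OF coll eqs])
      also have "\<dots> = integral\<^sup>L sphere_measure p"
        unfolding p
        by (intro Bochner_Integration.integral_sum[symmetric] integrable_sphere_measure continuous_intros)
      finally show ?thesis using E 3 by simp
    next
      case 4
      then show ?thesis using E orbit_measure_quartic[OF coll eqs quartics] p by simp
    qed
  qed
  then show ?thesis
    unfolding weighted_design_iff_hom_poly set_pmf_antipodalization using fin sub by auto
qed

end


section \<open>Rank-one points and optimal completions\<close>

text \<open>Surjectivity of the Hopf map from unit vectors (a1, a2) onto the traceless Hermitian
  matrices of norm 1; the preimage is chosen with a1 real and nonnegative.\<close>

lemma mk_herm0_components:
  fixes b :: "'d::{real_normed_div_algebra,euclidean_space}"
  assumes "norm (mk_herm0 t b) = 1"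
  shows "\<exists>a1 a2 :: 'd. a1 \<bullet> a1 + a2 \<bullet> a2 = 1 \<and> a1 \<bullet> a1 - a2 \<bullet> a2 = sqrt 2 * t
    \<and> hconj a1 * a2 = b /\<^sub>R sqrt 2"
proof -
  have tb: "b \<bullet> b = 1 / 2 - t * t"
    using assms by (simp add: norm_eq_1 inner_mk_herm0)
  have sq: "sqrt 2 * sqrt 2 = 2" by simp
  have one: "(1::'d) \<bullet> 1 = 1" by (simp add: dot_square_norm)
  \<comment> \<open>The value of \<open>a1 \<bullet> a1\<close> forced by the two norm equations.
    The case \<open>u = 0\<close> is the pole, where division by \<open>sqrt u\<close> is impossible
    and \<open>b\<close> vanishes.\<close>
  define u where "u = (1 + sqrt 2 * t) / 2"
  have tu: "t * sqrt 2 = 2 * u - 1" by (simp add: u_def field_simps)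
  have "2 * (t * t) = (t * sqrt 2)\<^sup>2" by (simp add: power_mult_distrib power2_eq_square)
  then have bu: "b \<bullet> b = 2 * (u * (1 - u))"
    unfolding tb tu by (simp add: power2_eq_square algebra_simps)
  have "0 \<le> u * (1 - u)" using bu inner_ge_zero[of b] by linarith
  then have u: "0 \<le> u" "u \<le> 1" by (auto simp: zero_le_mult_iff)
  show ?thesis
  proof (cases "u = 0")
    case True
    then have "b = 0" using bu by simp
    then show ?thesis
      using True tu one by (intro exI[of _ 0] exI[of _ 1]) (simp add: mult.commute)
  next
    case False
    define s where "s = sqrt u"
    have s: "s * s = u" "s \<noteq> 0" using u False by (simp_all add: s_def)
    define a2 where "a2 = b /\<^sub>R (sqrt 2 * s)"
    have "a2 \<bullet> a2 = (b \<bullet> b) / ((sqrt 2 * s) * (sqrt 2 * s))"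
      unfolding a2_def inner_scaleR_left inner_scaleR_right divide_inverse inverse_mult_distrib
      by (simp only: mult_ac)
    also have "(sqrt 2 * s) * (sqrt 2 * s) = 2 * u"
      using s(1) sq by (metis mult.assoc mult.left_commute)
    finally have "a2 \<bullet> a2 = (b \<bullet> b) / (2 * u)" .
    then have a2: "a2 \<bullet> a2 = 1 - u" using False by (simp add: bu)
    have a1: "(s *\<^sub>R 1 :: 'd) \<bullet> (s *\<^sub>R 1) = u" by (simp add: one s)
    have "hconj (s *\<^sub>R 1) * a2 = b /\<^sub>R sqrt 2"
      using s(2) by (simp add: hconj_scaleR a2_def)
    then show ?thesis
      using a1 a2 tu by (intro exI[of _ "s *\<^sub>R 1"] exI[of _ a2]) (simp add: mult.commute)
  qed
qed

context hermitian_module begin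

text \<open>The Gram matrix is the product of the column with entries \<open>hconj (a i)\<close> and
  the row with entries \<open>a j\<close>, so its column space is the right line spanned by that
  column.\<close>

lemma matrix_rank_gram_line:
  assumes e: "norm e = 1" and a: "a k \<noteq> 0"
  shows "matrix_rank (gram h (\<chi> i. act e (a i))) = 1"
proof -
  let ?act = "\<lambda>(v::'d^2) c. \<chi> i. v $ i * c"
  define u :: "'d^2" where "u = (\<chi> i. hconj (a i))"
  have hk: "hconj (a k) \<noteq> 0" using a by (metis hconj_0 hconj_hconj)
  have ee: "h e e = 1" using e by (simp add: h_self norm_eq_1)
  have A: "gram h (\<chi> i. act e (a i)) *v c = ?act u (\<Sum>j\<in>UNIV. a j * c $ j)" for c
    by (simp add: gram_def matrix_vector_mult_def h_act ee u_def vec_eq_iff sum_distrib_left mult.assoc)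
  have "range (\<lambda>c. gram h (\<chi> i. act e (a i)) *v c) = range (?act u)"
  proof (intro equalityI subsetI)
    fix y assume "y \<in> range (?act u)"
    then obtain d where y: "y = ?act u d" by blast
    \<comment> \<open>One invertible coordinate \<open>a k\<close> suffices to reach every right
      multiple of \<open>u\<close>.\<close>
    have "(\<Sum>j\<in>UNIV. a j * axis k (inverse (a k) * d) $ j) = (\<Sum>j\<in>UNIV. if j = k then d else 0)"
      using a by (intro sum.cong) (auto simp: axis_def mult.assoc[symmetric])
    then have "y = gram h (\<chi> i. act e (a i)) *v axis k (inverse (a k) * d)"
      by (simp add: A y)
    then show "y \<in> range (\<lambda>c. gram h (\<chi> i. act e (a i)) *v c)" by blast
  qed (auto simp: A)
  moreover have "inj (?act u)"
    by (rule injI) (use hk in \<open>auto simp: vec_eq_iff u_def dest: spec[of _ k]\<close>)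
  ultimately show ?thesis
    unfolding matrix_rank_def
    by (intro right_dim_line[of _ u]) (simp_all add: vec_eq_iff mult.assoc)
qed

text \<open>Both components are placed on the right line through one unit vector \<open>e\<close>,
  with the coordinates of a Hopf preimage of \<open>v\<close>.\<close>

lemma exists_rank_one:
  assumes v: "norm v = 1"
  shows "\<exists>x\<in>sphere 0 1. matrix_rank (gram h x) = 1 \<and> defect h x = v /\<^sub>R sqrt 2"
proof -
  obtain t b where tb: "v = mk_herm0 t b" using mk_herm0_surj by blast
  obtain a1 a2 where a: "a1 \<bullet> a1 + a2 \<bullet> a2 = 1" "a1 \<bullet> a1 - a2 \<bullet> a2 = sqrt 2 * t" "hconj a1 * a2 = b /\<^sub>R sqrt 2"
    using mk_herm0_components[of t b] v tb by blast
  obtain e :: 'w where "e \<in> Basis" using nonempty_Basis by blast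
  then have e: "norm e = 1" by simp
  then have ee: "e \<bullet> e = 1" by (simp add: norm_eq_1)
  define c :: "2 \<Rightarrow> 'd" where "c = (\<lambda>i. if i = 1 then a1 else a2)"
  define x :: "'w^2" where "x = (\<chi> i. act e (c i))"
  have x: "norm x = 1"
    by (simp add: norm_eq_1 inner_vec_def sum_2 x_def c_def act_inner_act ee a)
  have "c 1 \<noteq> 0 \<or> c 2 \<noteq> 0" using a(1) by (auto simp: c_def)
  then have "matrix_rank (gram h x) = 1"
    unfolding x_def using matrix_rank_gram_line[OF e] by blast
  moreover have "defect h x = v /\<^sub>R sqrt 2"
  proof -
    have "defect h x = mk_herm0 (sqrt 2 * t / 2) (b /\<^sub>R sqrt 2)"
      unfolding defect_eq_mk[OF x]
      by (simp add: x_def c_def act_inner_act ee a h_act h_self)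
    also have "inverse (sqrt 2) = sqrt 2 / 2"
      by (rule inverse_unique) simp
    then have "sqrt 2 * t / 2 = inverse (sqrt 2) * t" by simp
    finally show ?thesis by (simp only: mk_herm0_scaleR tb)
  qed
  ultimately show ?thesis using x by auto
qed

section \<open>Zero defect and the dimension over the division algebra\<close>

lemma zero_defect_imp:
  assumes x: "norm x = 1" and Z: "defect h x = 0"
  shows "x $ 1 \<bullet> x $ 1 = 1 / 2" "x $ 2 \<bullet> x $ 2 = 1 / 2" "h (x $ 1) (x $ 2) = 0"
proof -
  have g: "gram h x = (1/2) *\<^sub>R mat 1"
    by (simp add: gram_eq_defect[OF x] Z zero_herm0.rep_eq)
  have "h (x $ i) (x $ j) = (if i = j then (1/2) *\<^sub>R 1 else 0)" for i j
    using arg_cong[OF g, of "\<lambda>A. A $ i $ j"] by (simp add: gram_def mat_def)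
  note hx = this
  show "h (x $ 1) (x $ 2) = 0" by (simp add: hx)
  show "x $ 1 \<bullet> x $ 1 = 1 / 2" "x $ 2 \<bullet> x $ 2 = 1 / 2"
    by (simp_all add: real_part_h[symmetric] hx real_part_scaleR real_part_1)
qed

text \<open>The right line through \<open>x $ 1\<close> has real dimension \<open>DIM('d)\<close>
  and misses the nonzero vector \<open>x $ 2\<close>, which is orthogonal to it. The strict
  inequality puts the optimal weight below 1 and so leaves positive mass for the zero-defect
  orbit.\<close>

lemma DIM_less_zero_defect:
  assumes x: "norm x = 1" and Z: "defect h x = 0"
  shows "DIM('d) < DIM('w)"
proof -
  note z = zero_defect_imp[OF x Z]
  let ?f = "\<lambda>a. act (x $ 1) a"
  have lin: "linear ?f" using bilinear_act by (simp add: bilinear_def)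
  have "inj ?f"
  proof (rule injI)
    fix a b assume "act (x $ 1) a = act (x $ 1) b"
    then have "act (x $ 1) (a - b) = 0" by (simp add: bilinear_rsub[OF bilinear_act])
    then have "(x $ 1 \<bullet> x $ 1) * ((a - b) \<bullet> (a - b)) = 0"
      using act_inner_act[of "x $ 1" "a - b"] by simp
    then show "a = b" by (simp add: z)
  qed
  then have "dim (range ?f) = DIM('d)"
    using dim_image_eq[OF lin, of UNIV] by simp
  moreover have "x $ 2 \<notin> range ?f"
  proof
    assume "x $ 2 \<in> range ?f"
    then obtain a where a: "x $ 2 = act (x $ 1) a" by blast
    then have "x $ 2 \<bullet> x $ 2 = a \<bullet> h (x $ 1) (x $ 2)"
      using inner_act_left[of "x $ 1" a "x $ 2"] by simp
    then show False by (simp add: z)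
  qed
  then have "range ?f \<noteq> UNIV" by blast
  then have "dim (range ?f) \<noteq> DIM('w)"
    using dim_eq_full[of "range ?f"] span_eq_iff[THEN iffD2, OF linear_subspace_image[OF lin subspace_UNIV]]
    by simp
  ultimately show ?thesis using dim_subset_UNIV[of "range ?f"] by linarith
qed

definition h_orthonormal :: "'w set \<Rightarrow> bool"
  where "h_orthonormal S \<longleftrightarrow> finite S \<and> (\<forall>b\<in>S. \<forall>c\<in>S. h b c = (if b = c then 1 else 0))"

text \<open>Sets orthonormal for \<open>h\<close> are independent over the reals, so their size is
  bounded and a largest one exists. If it did not generate, a normalized residual would enlarge it;
  coefficients are unique because \<open>h b\<close> reads them off.\<close>

lemma exists_right_basis: "\<exists>B. right_basis act UNIV B"
proof -
  have bound: "card S \<le> DIM('w)" if "h_orthonormal S" for S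
  proof -
    have ip: "b \<bullet> c = (if b = c then 1 else 0)" if "b \<in> S" "c \<in> S" for b c
    proof -
      have "h b c = (if b = c then 1 else 0)"
        using \<open>h_orthonormal S\<close> that by (simp add: h_orthonormal_def)
      then show ?thesis
        using real_part_h[of b c] real_part_1[where 'a = 'd] by (auto simp: real_part_def)
    qed
    then have "pairwise orthogonal S" "0 \<notin> S"
      by (auto simp: pairwise_def orthogonal_def) (metis inner_zero_left zero_neq_one)
    then show ?thesis
      using pairwise_orthogonal_independent independent_bound by blast
  qed
  have "h_orthonormal {}" by (simp add: h_orthonormal_def)
  then obtain S where S: "h_orthonormal S" and max: "\<And>T. h_orthonormal T \<Longrightarrow> card T \<le> card S"
    using ex_has_greatest_nat[of h_orthonormal "{}" card "DIM('w) + 1"] bound by fastforce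
  have fin: "finite S" and hS: "\<And>b c. b \<in> S \<Longrightarrow> c \<in> S \<Longrightarrow> h b c = (if b = c then 1 else 0)"
    using S by (auto simp: h_orthonormal_def)
  have coeff: "h b (\<Sum>b'\<in>S. act b' (c b')) = c b" if "b \<in> S" for b c
  proof -
    have "h b (\<Sum>b'\<in>S. act b' (c b')) = (\<Sum>b'\<in>S. h b b' * c b')"
      using bilinear_h by (simp add: bilinear_def linear_sum h_act_right)
    also have "\<dots> = (\<Sum>b'\<in>S. if b' = b then c b else 0)"
      by (rule sum.cong) (use that hS in auto)
    finally show ?thesis using that fin by simp
  qed
  have rep: "x = (\<Sum>b\<in>S. act b (h b x))" for x
  proof (rule ccontr)
    assume ne: "x \<noteq> (\<Sum>b\<in>S. act b (h b x))"
    define y where "y = x - (\<Sum>b\<in>S. act b (h b x))"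
    have y: "norm y \<noteq> 0" using ne by (simp add: y_def)
    have hy: "h b y = 0" if "b \<in> S" for b
      by (simp add: y_def h_simps coeff[OF that])
    define z where "z = y /\<^sub>R norm y"
    have hz: "h b z = 0" if "b \<in> S" for b
      by (simp add: z_def h_simps hy[OF that])
    then have hz': "h z b = 0" if "b \<in> S" for b
      using that by (metis hconj_0 hconj_h)
    have zz: "h z z = 1"
      using y by (simp add: h_self z_def dot_square_norm)
    then have zS: "z \<notin> S" using hz[of z] by auto
    have "h_orthonormal (insert z S)"
      unfolding h_orthonormal_def
    proof (intro conjI ballI)
      fix b c assume bc: "b \<in> insert z S" "c \<in> insert z S"
      show "h b c = (if b = c then 1 else 0)"
      proof (cases "b = z")
        case True
        then show ?thesis using bc(2) zz hz'[of c] zS by auto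
      next
        case False
        then have "b \<in> S" using bc(1) by blast
        then show ?thesis using bc(2) hz[of b] hS[of b c] False by auto
      qed
    qed (use fin in simp)
    then show False using max[of "insert z S"] fin zS by simp
  qed
  have "right_basis act UNIV S"
    unfolding right_basis_def
  proof (intro conjI ballI)
    fix x
    show "\<exists>!c. (\<forall>b. b \<notin> S \<longrightarrow> c b = 0) \<and> x = (\<Sum>b\<in>S. act b (c b))"
    proof (rule ex1I[of _ "\<lambda>b. if b \<in> S then h b x else 0"])
      show "(\<forall>b. b \<notin> S \<longrightarrow> (if b \<in> S then h b x else 0) = 0)
          \<and> x = (\<Sum>b\<in>S. act b (if b \<in> S then h b x else 0))"
        using rep[of x] by (simp cong: sum.cong)
      fix c assume "(\<forall>b. b \<notin> S \<longrightarrow> c b = 0) \<and> x = (\<Sum>b\<in>S. act b (c b))"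
      then show "c = (\<lambda>b. if b \<in> S then h b x else 0)"
        using coeff[of _ c] by auto
    qed
  qed (use fin in auto)
  then show ?thesis ..
qed

text \<open>This is the condition n \<ge> 2. On a single right line \<open>x $ 2\<close> would be a
  multiple of \<open>x $ 1\<close>, although the two are nonzero and \<open>h\<close>-orthogonal.
  Existence of a basis is what makes the one selected by \<open>SOME\<close> usable.\<close>

lemma right_dim_ge_2:
  assumes x: "norm x = 1" and Z: "defect h x = 0"
  shows "2 \<le> right_dim act UNIV"
proof -
  note z = zero_defect_imp[OF x Z]
  have x0: "x $ 1 \<noteq> 0" "x $ 2 \<noteq> 0" using z by auto
  define B where "B = (SOME B. right_basis act UNIV B)"
  have B: "right_basis act UNIV B"
    unfolding B_def using exists_right_basis by (rule someI_ex)
  then have fin: "finite B" by (simp add: right_basis_def)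
  have rep: "\<exists>c. y = (\<Sum>b\<in>B. act b (c b))" for y
    using B unfolding right_basis_def by blast
  have "card B \<noteq> 0"
    using rep[of "x $ 1"] x0 fin by auto
  moreover have "card B \<noteq> 1"
  proof
    assume "card B = 1"
    then obtain b where "B = {b}" by (auto simp: card_1_singleton_iff)
    then obtain a1 a2 where a: "x $ 1 = act b a1" "x $ 2 = act b a2"
      using rep[of "x $ 1"] rep[of "x $ 2"] by auto
    have "a1 \<noteq> 0" using x0 a by (auto simp: act_simps)
    then have x2: "x $ 2 = act (x $ 1) (inverse a1 * a2)"
      unfolding a act_act by (simp add: mult.assoc[symmetric])
    then have "x $ 2 \<bullet> x $ 2 = (inverse a1 * a2) \<bullet> h (x $ 1) (x $ 2)"
      using inner_act_left[of "x $ 1" "inverse a1 * a2" "x $ 2"] by simp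
    then show False by (simp add: z)
  qed
  ultimately show ?thesis
    unfolding right_dim_def B_def[symmetric] by linarith
qed

end

section \<open>Equality in the correction bound\<close>

lemma second_moment_trace:
  fixes z :: "'i \<Rightarrow> 'a::euclidean_space"
  assumes "second_moment_identity I w z c"
  shows "(\<Sum>i\<in>I. w i * (z i \<bullet> z i)) = c * DIM('a)"
proof -
  have "(\<Sum>i\<in>I. w i * (z i \<bullet> z i)) = (\<Sum>i\<in>I. \<Sum>B\<in>Basis. w i * (B \<bullet> z i) * (B \<bullet> z i))"
    by (rule sum.cong[OF refl], subst euclidean_inner) (simp add: sum_distrib_left mult.assoc inner_commute)
  also have "\<dots> = (\<Sum>B::'a\<in>Basis. c * (B \<bullet> B))"
    by (subst sum.swap) (use assms in \<open>simp add: second_moment_identity_def\<close>)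
  finally show ?thesis by simp
qed

context hermitian_module begin

lemma sum_correction_set:
  fixes f :: "'i \<Rightarrow> 'b::comm_monoid_add"
  assumes "finite I" "\<And>i. i \<in> I \<Longrightarrow> defect h (x i) = 0 \<Longrightarrow> f i = 0"
  shows "(\<Sum>i\<in>correction_set h I x. f i) = (\<Sum>i\<in>I. f i)"
  by (rule sum.mono_neutral_left) (use assms in \<open>auto simp: correction_set_def\<close>)

lemma correction_orbits_form_2_design:
  fixes x :: "'i \<Rightarrow> 'w^2"
  assumes coll: "weighted_collection I w x" and eqs: "defect_equations h I w x"
    and \<alpha>: "\<alpha> = correction_weight h I w x" "\<alpha> = (real DIM('d) + 1) / (real DIM('w) + 1)"
    and v: "v = (\<lambda>i. sqrt 2 *\<^sub>R defect h (x i))" and lam: "lam = (\<lambda>i. w i / \<alpha>)"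
  shows "weighted_collection (correction_set h I x) lam v"
    and "(\<Sum>i\<in>correction_set h I x. lam i *\<^sub>R v i) = 0"
    and "second_moment_identity (correction_set h I x) lam v (1 / (real DIM('d) + 1))"
    and "weighted_design 2 (weighted_points (correction_set h I x) lam v)"
proof -
  let ?C = "correction_set h I x" and ?Z = "\<lambda>i. defect h (x i)"
  note coll' = weighted_collectionD[OF coll]
  have C: "?C \<subseteq> I" "finite ?C" using coll'(1) by (auto simp: correction_set_def)
  have pos: "\<alpha> > 0" unfolding \<alpha>(2) by simp
  have first: "(\<Sum>i\<in>I. w i *\<^sub>R ?Z i) = 0"
    and second: "second_moment_identity I w ?Z (1 / (2 * (real DIM('w) + 1)))"
    using eqs by (simp_all add: defect_equations_def)
  have half: "?Z i \<bullet> ?Z i = 1 / 2" if i: "i \<in> ?C" for i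
  proof -
    have nn: "0 \<le> w i * (1 / 2 - ?Z i \<bullet> ?Z i)" if "i \<in> ?C" for i
      using that C coll'(2)[of i] inner_defect_le[OF coll'(4)[of i]] by auto
    \<comment> \<open>The total deficit is \<alpha>/2 minus the trace r/(2(q+1)), that is, zero. As
      a sum of nonnegative terms with positive weights it vanishes term by term.\<close>
    have "(\<Sum>i\<in>?C. w i * (1 / 2 - ?Z i \<bullet> ?Z i)) = sum w ?C / 2 - (\<Sum>i\<in>I. w i * (?Z i \<bullet> ?Z i))"
      by (subst sum_correction_set[OF coll'(1), of x "\<lambda>i. w i * (?Z i \<bullet> ?Z i)", symmetric])
        (simp_all add: right_diff_distrib sum_subtractf sum_divide_distrib)
    also have "\<dots> = 0"
      unfolding second_moment_trace[OF second] DIM_herm0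
        \<alpha>(1)[unfolded correction_weight_def, symmetric] \<alpha>(2)
      by (simp add: field_simps)
    finally have "w i * (1 / 2 - ?Z i \<bullet> ?Z i) = 0"
      using nn i C(2) by (simp only: sum_nonneg_eq_0_iff)
    moreover have "w i > 0" using i C coll'(2) by blast
    ultimately show ?thesis by simp
  qed
  show A: "weighted_collection ?C lam v"
    unfolding weighted_collection_def
  proof (intro conjI ballI)
    show "sum lam ?C = 1"
      using pos \<alpha>(1) by (simp add: lam correction_weight_def flip: sum_divide_distrib)
    fix i assume i: "i \<in> ?C"
    then show "0 < lam i" using C coll'(2) pos by (auto simp: lam)
    have "v i \<bullet> v i = 1" by (simp add: v half[OF i])
    then show "v i \<in> sphere 0 1" by (simp add: norm_eq_1)
  qed (rule C)
  have "(\<Sum>i\<in>?C. lam i *\<^sub>R v i) = (\<Sum>i\<in>I. (sqrt 2 / \<alpha>) *\<^sub>R (w i *\<^sub>R ?Z i))"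
    by (subst sum_correction_set[OF coll'(1)]) (simp_all add: v lam mult.commute)
  then show B: "(\<Sum>i\<in>?C. lam i *\<^sub>R v i) = 0"
    by (simp only: scaleR_sum_right[symmetric] first scaleR_zero_right)
  show E: "second_moment_identity ?C lam v (1 / (real DIM('d) + 1))"
    unfolding second_moment_identity_def
  proof (intro allI)
    fix b c
    have s2: "u * (sqrt 2 * y) * (sqrt 2 * z) = 2 * (u * y * z)" for u y z :: real
    proof -
      have "u * (sqrt 2 * y) * (sqrt 2 * z) = (sqrt 2 * sqrt 2) * (u * y * z)"
        by (simp only: mult_ac)
      then show ?thesis by simp
    qed
    have "(\<Sum>i\<in>?C. lam i * (b \<bullet> v i) * (c \<bullet> v i)) = (\<Sum>i\<in>I. (2 / \<alpha>) * (w i * (b \<bullet> ?Z i) * (c \<bullet> ?Z i)))"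
      by (subst sum_correction_set[OF coll'(1)]) (simp_all add: v lam s2)
    also have "\<dots> = (2 / \<alpha>) * (1 / (2 * (real DIM('w) + 1)) * (b \<bullet> c))"
      using second unfolding sum_distrib_left[symmetric] second_moment_identity_def by simp
    \<comment> \<open>The factor 2/\<alpha> with \<alpha> = r/(q+1) turns 1/(2(q+1)) into
      1/r.\<close>
    also have "\<dots> = 1 / (real DIM('d) + 1) * (b \<bullet> c)"
      unfolding \<alpha>(2) by (simp add: divide_simps)
    finally show "(\<Sum>i\<in>?C. lam i * (b \<bullet> v i) * (c \<bullet> v i)) = 1 / (real DIM('d) + 1) * (b \<bullet> c)" .
  qed
  note A' = weighted_collectionD[OF A]
  show "weighted_design 2 (weighted_points ?C lam v)"
    using weighted_design_2_weighted_points_iff[OF A'(1-3), of v] A'(4) B E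
    by (simp add: DIM_herm0 add.commute)
qed

section \<open>Antipodal doubling of a collection\<close>

lemma weighted_collection_antipodal:
  fixes x :: "'i \<Rightarrow> 'w^2"
  assumes "weighted_collection J w y"
  shows "weighted_collection (J \<times> (UNIV :: bool set)) (\<lambda>(j, b). w j / 2) (\<lambda>(j, b). if b then y j else - y j)"
  using weighted_collectionD[OF assms]
  by (auto simp: weighted_collection_def sum.cartesian_product[symmetric] UNIV_bool)

text \<open>The defect is even, so splitting each orbit into an antipodal pair of half weights
  preserves both defect equations and the correction weight.\<close>

lemma correction_weight_optimal_antipodal:
  fixes y :: "'i \<Rightarrow> 'w^2"
  assumes "correction_weight_optimal G \<rho> h J w y"
  shows "correction_weight_optimal G \<rho> h (J \<times> (UNIV :: bool set))
    (\<lambda>(j, b). w j / 2) (\<lambda>(j, b). if b then y j else - y j)"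
proof -
  let ?w = "\<lambda>(j, b :: bool). w j / 2" and ?y = "\<lambda>(j, b). if b then y j else - y j"
  have coll: "weighted_collection J w y" and eqs: "defect_equations h J w y"
    and des: "\<exists>j\<in>J. spherical_design 2 (orbit G D (y j))"
    and weight: "correction_weight h J w y = optimal_weight h"
    using assms by (auto simp: correction_weight_optimal_def)
  have Z: "defect h (?y p) = defect h (y (fst p))" for p
    by (cases p) (simp add: defect_uminus)
  have "defect_equations h (J \<times> UNIV) ?w ?y"
    using eqs unfolding defect_equations_def second_moment_identity_def Z
    by (simp add: sum.cartesian_product[symmetric] UNIV_bool case_prod_unfold sum.cartesian_product'
        flip: scaleR_left_distrib)
  moreover have "correction_set h (J \<times> UNIV) ?y = correction_set h J y \<times> UNIV"
    unfolding correction_set_def Z by auto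
  then have "correction_weight h (J \<times> UNIV) ?w ?y = correction_weight h J w y"
    by (simp add: correction_weight_def sum.cartesian_product[symmetric] UNIV_bool)
  moreover have "\<exists>p\<in>J \<times> UNIV. spherical_design 2 (orbit G D (?y p))"
    using des by (auto intro!: bexI[of _ "(_, True)"])
  ultimately show ?thesis
    using weighted_collection_antipodal[OF coll] weight
    by (simp add: correction_weight_optimal_def)
qed

text \<open>By linearity the negative of an orbit is the orbit of the negative point. The comparison
  is made on densities, so orbits that happen to coincide simply add up.\<close>

lemma antipodalization_orbit_measure:
  fixes y :: "'i \<Rightarrow> 'w^2"
  assumes coll: "weighted_collection J w y"
  shows "antipodalization (orbit_measure G \<rho> J w y) = orbit_measure G \<rho> (J \<times> (UNIV :: bool set))
    (\<lambda>(j, b). w j / 2) (\<lambda>(j, b). if b then y j else - y j)"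
proof (rule pmf_eqI)
  fix x
  note c1 = weighted_collectionD[OF coll] and c2 = weighted_collectionD[OF weighted_collection_antipodal[OF coll]]
  have p1: "pmf (convex_comb J w M) z = (\<Sum>j\<in>J. w j * pmf (M j) z)" for M and z :: "'w^2"
    by (rule pmf_convex_comb) (use c1 in auto)
  have p2: "pmf (convex_comb (J \<times> (UNIV :: bool set)) (\<lambda>(j, b). w j / 2) M) z
      = (\<Sum>(j, b)\<in>J \<times> UNIV. w j / 2 * pmf (M (j, b)) z)" for M and z :: "'w^2"
    by (subst pmf_convex_comb) (use c2 in \<open>auto simp: case_prod_unfold\<close>)
  have neg: "pmf (pmf_of_set (orbit G D (- z))) x = pmf (pmf_of_set (orbit G D z)) (- x)" for z
  proof -
    have "pmf_of_set (orbit G D (- z)) = map_pmf uminus (pmf_of_set (orbit G D z))"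
      unfolding orbit_uminus
      by (rule map_pmf_of_set_inj[symmetric]) (simp_all add: finite_orbit orbit_nonempty)
    then show ?thesis by (simp add: pmf_map_uminus)
  qed
  show "pmf (antipodalization (orbit_measure G \<rho> J w y)) x = pmf (orbit_measure G \<rho> (J \<times> (UNIV :: bool set))
    (\<lambda>(j, b). w j / 2) (\<lambda>(j, b). if b then y j else - y j)) x"
    unfolding pmf_antipodalization orbit_measure_def p1 p2 sum.cartesian_product[symmetric]
    by (simp add: UNIV_bool neg sum.distrib sum_divide_distrib add_divide_distrib)
qed

text \<open>\<open>None\<close> indexes the zero-defect orbit and \<open>Some i\<close> the
  correction orbits, which keeps the new index apart from those in \<open>I\<close>.\<close>

lemma optimal_completion_of_2_design:
  fixes x :: "'i \<Rightarrow> 'w^2"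
  assumes x0: "norm x0 = 1" "defect h x0 = 0"
    and lam: "weighted_collection I lam v" "weighted_design 2 (weighted_points I lam v)"
    and x: "\<And>i. i \<in> I \<Longrightarrow> norm (x i) = 1" "\<And>i. i \<in> I \<Longrightarrow> defect h (x i) = v i /\<^sub>R sqrt 2"
    and \<alpha>: "\<alpha> = (real DIM('d) + 1) / (real DIM('w) + 1)"
    and J: "J = insert None (Some ` I)"
    and w: "w = case_option (1 - \<alpha>) (\<lambda>i. \<alpha> * lam i)" and y: "y = case_option x0 x"
  shows "weighted_collection J w y" "defect_equations h J w y"
    "correction_weight h J w y = (real DIM('d) + 1) / (real DIM('w) + 1)"
    "correction_weight_optimal G \<rho> h J w y"
proof -
  note L = weighted_collectionD[OF lam(1)]
  have v: "(\<Sum>i\<in>I. lam i *\<^sub>R v i) = 0" "second_moment_identity I lam v (1 / (real DIM('d) + 1))"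
    using weighted_design_2_weighted_points_iff[OF L(1-3), of v] lam(2) by (simp_all add: DIM_herm0 add.commute)
  have \<alpha>_pos: "0 < \<alpha>" by (simp add: \<alpha>)
  \<comment> \<open>The existence of a zero-defect point forces \<open>DIM('d) < DIM('w)\<close>, so
    the weight at \<open>None\<close> is positive.\<close>
  have \<alpha>_less: "\<alpha> < 1" using DIM_less_zero_defect[OF x0] by (simp add: \<alpha>)
  have sumJ: "(\<Sum>j\<in>J. f j) = f None + (\<Sum>i\<in>I. f (Some i))" for f :: "'i option \<Rightarrow> 'b::comm_monoid_add"
    unfolding J using L(1) by (subst sum.insert) (auto simp: sum.reindex)
  show coll: "weighted_collection J w y"
    unfolding weighted_collection_def
  proof (intro conjI ballI)
    show "sum w J = 1" using L(3) by (simp add: sumJ w flip: sum_distrib_left)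
    show "finite J" using L(1) by (simp add: J)
    fix j assume "j \<in> J"
    then show "0 < w j" "y j \<in> sphere 0 1"
      using \<alpha>_pos \<alpha>_less L(2) x0 x by (auto simp: J w y)
  qed
  have "(\<Sum>j\<in>J. w j *\<^sub>R defect h (y j)) = (\<alpha> / sqrt 2) *\<^sub>R (\<Sum>i\<in>I. lam i *\<^sub>R v i)"
    unfolding scaleR_sum_right by (simp add: sumJ w y x0 x divide_inverse mult_ac cong: sum.cong)
  then have first: "(\<Sum>j\<in>J. w j *\<^sub>R defect h (y j)) = 0" by (simp add: v)
  have second: "second_moment_identity J w (\<lambda>j. defect h (y j)) (1 / (2 * (real DIM('w) + 1)))"
    unfolding second_moment_identity_def
  proof (intro allI)
    fix B C
    have i2: "inverse (sqrt 2) * inverse (sqrt 2) = (1 / 2 :: real)"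
      by (simp flip: inverse_mult_distrib)
    have "(\<Sum>j\<in>J. w j * (B \<bullet> defect h (y j)) * (C \<bullet> defect h (y j)))
        = (\<Sum>i\<in>I. (\<alpha> / 2) * (lam i * (B \<bullet> v i) * (C \<bullet> v i)))"
      unfolding sumJ by (simp add: w y x0) (rule sum.cong, simp_all add: x mult_ac i2)
    also have "\<dots> = (\<alpha> / 2) * (1 / (real DIM('d) + 1) * (B \<bullet> C))"
      using v(2) unfolding sum_distrib_left[symmetric] second_moment_identity_def by simp
    \<comment> \<open>The 1/2 left by the two factors \<open>1 / sqrt 2\<close> meets \<alpha>/r =
      1/(q+1).\<close>
    also have "\<dots> = 1 / (2 * (real DIM('w) + 1)) * (B \<bullet> C)"
      by (simp add: \<alpha> divide_simps)
    finally show "(\<Sum>j\<in>J. w j * (B \<bullet> defect h (y j)) * (C \<bullet> defect h (y j)))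
        = 1 / (2 * (real DIM('w) + 1)) * (B \<bullet> C)" .
  qed
  show eqs: "defect_equations h J w y"
    using first second by (simp add: defect_equations_def)
  \<comment> \<open>Unit vectors are nonzero, so the correction set is exactly the image of
    \<open>I\<close>, and its weight is \<alpha>.\<close>
  have "v i \<noteq> 0" if "i \<in> I" for i using L(4)[OF that] by auto
  then have "correction_set h J y = Some ` I"
    using x0 x by (auto simp: correction_set_def J y)
  then have "correction_weight h J w y = \<alpha>"
    using L(3) by (simp add: correction_weight_def sum.reindex w flip: sum_distrib_left)
  then show weight: "correction_weight h J w y = (real DIM('d) + 1) / (real DIM('w) + 1)"
    by (simp add: \<alpha>)
  have "spherical_design 2 (orbit G D (y None))"
    using spherical_design_zero_defect[OF x0] by (simp add: y)
  then show "correction_weight_optimal G \<rho> h J w y"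
    unfolding correction_weight_optimal_def
    using coll eqs weight by (auto simp: J optimal_weight_def)
qed

end

text \<open>The middle conjunct supplies the rank-one representatives that the converse takes as
  given. The collection doubled over \<open>bool\<close> presents the antipodalized measure as a
  weighted family of orbits, so that optimality can be asserted of it; the last implication covers
  measures that are symmetric from the start.\<close>

theorem theorem5p4:
  fixes G :: "('g, 'r) monoid_scheme"
    and \<rho> :: "'g \<Rightarrow> 'w::euclidean_space \<Rightarrow> 'w"
    and act :: "'w \<Rightarrow> 'd::{real_normed_div_algebra,euclidean_space} \<Rightarrow> 'w"
    and h :: "'w \<Rightarrow> 'w \<Rightarrow> 'd"
    and q r :: real
  assumes "group G" and "finite (carrier G)"
    and "orthogonal_module G \<rho>" and "irreducible_module G \<rho>" and "\<not> trivial_module G \<rho>"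
    and "right_module_over_End G \<rho> act"
    and "invariant_hermitian_form G \<rho> act h"
    and "q = real DIM('w)" and "r = real DIM('d) + 1"
  shows
    "(\<forall>(I :: 'i set) w x \<alpha> v lam.
        weighted_collection I w x \<and>
        defect_equations h I w x \<and>
        (\<exists>i\<in>I. spherical_design 2 (orbit G (diag_action \<rho>) (x i))) \<and>
        \<alpha> = correction_weight h I w x \<and> \<alpha> = r / (q + 1) \<and>
        v = (\<lambda>i. sqrt 2 *\<^sub>R defect h (x i)) \<and> lam = (\<lambda>i. w i / \<alpha>)
      \<longrightarrow>
        weighted_collection (correction_set h I x) lam v \<and>
        (\<Sum>i\<in>correction_set h I x. lam i *\<^sub>R v i) = 0 \<and>
        second_moment_identity (correction_set h I x) lam v (1 / r) \<and>
        weighted_design 2 (weighted_points (correction_set h I x) lam v))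
     \<and>
     (\<forall>v :: 'd herm0. v \<in> sphere 0 1 \<longrightarrow>
        (\<exists>x\<in>sphere 0 1. matrix_rank (gram h x) = 1 \<and> defect h x = v /\<^sub>R sqrt 2))
     \<and>
     (\<forall>x0 (I :: 'i set) lam v x \<alpha> J w y.
        x0 \<in> sphere 0 1 \<and> defect h x0 = 0 \<and>
        weighted_collection I lam v \<and> weighted_design 2 (weighted_points I lam v) \<and>
        (\<forall>i\<in>I. x i \<in> sphere 0 1 \<and> matrix_rank (gram h (x i)) = 1 \<and>
                defect h (x i) = v i /\<^sub>R sqrt 2) \<and>
        \<alpha> = r / (q + 1) \<and>
        J = insert None (Some ` I) \<and>
        w = case_option (1 - \<alpha>) (\<lambda>i. \<alpha> * lam i) \<and>
        y = case_option x0 x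
      \<longrightarrow>
        2 \<le> right_dim act UNIV \<and>
        weighted_collection J w y \<and>
        defect_equations h J w y \<and>
        correction_weight h J w y = r / (q + 1) \<and>
        correction_weight_optimal G \<rho> h J w y \<and>
        correction_weight_optimal G \<rho> h (J \<times> (UNIV :: bool set))
          (\<lambda>(j, b). w j / 2) (\<lambda>(j, b). if b then y j else - y j) \<and>
        antipodalization (orbit_measure G \<rho> J w y) =
          orbit_measure G \<rho> (J \<times> (UNIV :: bool set))
            (\<lambda>(j, b). w j / 2) (\<lambda>(j, b). if b then y j else - y j) \<and>
        (quartics_from_gram G \<rho> h \<longrightarrow>
          weighted_design 4 (antipodalization (orbit_measure G \<rho> J w y)) \<and>
          (map_pmf uminus (orbit_measure G \<rho> J w y) = orbit_measure G \<rho> J w y \<longrightarrow>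
            weighted_design 4 (orbit_measure G \<rho> J w y))))"
proof -
  interpret hermitian_module G \<rho> act h
    by (rule hermitian_module.intro) (fact assms)+
  have q: "q = real DIM('w)" and r: "r = real DIM('d) + 1" using assms by simp_all
  show ?thesis
  proof (intro conjI, goal_cases)
    case 1
    show ?case
    proof (intro allI impI, elim conjE, goal_cases)
      case (1 I w x \<alpha> v lam)
      show ?case
        using correction_orbits_form_2_design[OF 1(1,2,4) 1(5)[unfolded q r] 1(6,7)] unfolding r by (intro conjI)
    qed
  next
    case 2
    show ?case using exists_rank_one by simp
  next
    case 3
    show ?case
    proof (intro allI impI, elim conjE, goal_cases)
      case (1 x0 I lam v x \<alpha> J w y)
      then have x0: "norm x0 = 1"
        and x: "\<And>i. i \<in> I \<Longrightarrow> norm (x i) = 1" "\<And>i. i \<in> I \<Longrightarrow> defect h (x i) = v i /\<^sub>R sqrt 2"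
        by auto
      have conv: "weighted_collection J w y" "defect_equations h J w y"
        "correction_weight h J w y = r / (q + 1)" "correction_weight_optimal G \<rho> h J w y"
        using optimal_completion_of_2_design[OF x0 1(2,3,4) x 1(6)[unfolded q r] 1(7,8,9)] unfolding q r by blast+
      note facts = conv right_dim_ge_2[OF x0 1(2)] correction_weight_optimal_antipodal[OF conv(4)]
        antipodalization_orbit_measure[OF conv(1)]
      have quartics: "weighted_design 4 (antipodalization (orbit_measure G \<rho> J w y)) \<and>
          (map_pmf uminus (orbit_measure G \<rho> J w y) = orbit_measure G \<rho> J w y \<longrightarrow>
            weighted_design 4 (orbit_measure G \<rho> J w y))"
        if "quartics_from_gram G \<rho> h"
        using weighted_design_4[OF conv(1,2) that] antipodalization_eq_self[of "orbit_measure G \<rho> J w y"] by auto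
      show ?case
        by (intro conjI impI) (use facts quartics in \<open>simp_all only:\<close>)
    qed
  qed
qed

end
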